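(* Let $\Gamma$ be the free group of rank $r$ with $2\le r<\infty$, let $\partial\Gamma$ be its boundary, and let $\mu$ be a quasi-invariant and doubly-ergodic measure on $\partial\Gamma$. Regard $C^*_{\mathrm{r}}\Gamma\subset C^*_{\mathrm{r}}(\Gamma,\partial\Gamma)\subset \Gamma\ltimes L^\infty(\partial\Gamma,\mu)$ via the natural inclusions. If $$\theta\colon C^*_{\mathrm{r}}(\Gamma,\partial\Gamma)\to \Gamma\ltimes L^\infty(\partial\Gamma,\mu)$$ is a completely positive map with $\theta(x)=x$ for all $x\in C^*_{\mathrm{r}}\Gamma$, then $\theta(x)=x$ for all $x\in C^*_{\mathrm{r}}(\Gamma,\partial\Gamma)$ (that is, $\theta$ is the natural inclusion map).
   Context: The boundary $\partial\Gamma$ of the free group $\Gamma$ (with respect to a fixed free generating set) is the compact space of all one-sided infinite reduced words in the generators and their inverses, with the (relative) product topology. $\Gamma$ acts on $\partial\Gamma$ by homeomorphisms by left translation (left multiplication followed by reduction). Measures on $\partial\Gamma$ are nonzero $\sigma$-finite Borel measures. A measure $\mu$ on $\partial\Gamma$ is quasi-invariant if for every measurable $X\subset\partial\Gamma$ and every $s\in\Gamma$, $\mu(sX)=0$ if and only if $\mu(X)=0$. It is doubly-ergodic if the diagonal action of $\Gamma$ on $(\partial\Gamma\times\partial\Gamma,\mu\otimes\mu)$ is ergodic, i.e. every $\Gamma$-invariant measurable subset is $\mu\otimes\mu$-null or $\mu\otimes\mu$-conull. For $s\in\Gamma$ and $f\in L^\infty(\partial\Gamma,\mu)$ put $(s\cdot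 f)(\xi)=f(s^{-1}\xi)$. $\Gamma\ltimes L^\infty(\partial\Gamma,\mu)$ is the crossed product von Neumann algebra: it is generated as a von Neumann algebra by $L^\infty(\partial\Gamma,\mu)$ and a unitary representation $\lambda$ of $\Gamma$ satisfying $\lambda(s)f\lambda(s)^*=s\cdot f$, and it has a normal faithful conditional expectation $E$ onto $L^\infty(\partial\Gamma,\mu)$ with $E(\lambda(s)f)=f$ if $s=1$ and $E(\lambda(s)f)=0$ if $s\ne1$. $C(\partial\Gamma)$ is viewed inside $L^\infty(\partial\Gamma,\mu)$ by taking $\mu$-classes of functions. The $C^*$-subalgebra of $\Gamma\ltimes L^\infty(\partial\Gamma,\mu)$ generated by $\lambda(\Gamma)$ and $C(\partial\Gamma)$ is naturally isomorphic to the reduced crossed product $C^*$-algebra $C^*_{\mathrm{r}}(\Gamma,\partial\Gamma)$ of $C(\partial\Gamma)$ by $\Gamma$, and the $C^*$-subalgebra generated by $\lambda(\Gamma)$ is naturally isomorphic to the reduced group $C^*$-algebra $C^*_{\mathrm{r}}\Gamma$; these are the natural inclusions. *)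

theory Defs
  imports "HOL-Analysis.Analysis" "HOL-Algebra.Group"
begin

section \<open>The free group and its boundary\<close>

text \<open>A letter \<open>(s, True)\<close> stands for the generator \<open>s\<close> and \<open>(s, False)\<close> for its inverse.
  The free group on \<open>S\<close> is realised on the reduced words.\<close>

type_synonym 'a letter = "'a \<times> bool"

definition letter_inv :: "'a letter \<Rightarrow> 'a letter" where
  "letter_inv a = (fst a, \<not> snd a)"

definition letters :: "'a set \<Rightarrow> 'a letter set" where
  "letters S = S \<times> UNIV"

definition reduced_words :: "'a set \<Rightarrow> 'a letter list set" where
  "reduced_words S = {w \<in> lists (letters S). successively (\<lambda>a b. b \<noteq> letter_inv a) w}"

fun letter_mult :: "'a letter \<Rightarrow> 'a letter list \<Rightarrow> 'a letter list" where
  "letter_mult a [] = [a]"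
| "letter_mult a (b # w) = (if b = letter_inv a then w else a # b # w)"

definition word_mult :: "'a letter list \<Rightarrow> 'a letter list \<Rightarrow> 'a letter list" where
  "word_mult u v = foldr letter_mult u v"

definition free_group :: "'a set \<Rightarrow> 'a letter list monoid" where
  "free_group S = \<lparr>carrier = reduced_words S, mult = word_mult, one = []\<rparr>"

type_synonym 'a bpoint = "nat \<Rightarrow> 'a letter"

definition boundary :: "'a set \<Rightarrow> 'a bpoint set" where
  "boundary S = {x. (\<forall>n. x n \<in> letters S) \<and> (\<forall>n. x (Suc n) \<noteq> letter_inv (x n))}"

definition boundary_topology :: "'a set \<Rightarrow> 'a bpoint topology" where
  "boundary_topology S =
     subtopology (product_topology (\<lambda>_. discrete_topology (letters S)) UNIV) (boundary S)"

definition letter_act :: "'a letter \<Rightarrow> 'a bpoint \<Rightarrow> 'a bpoint" where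
  "letter_act a x = (if x 0 = letter_inv a then (\<lambda>n. x (Suc n)) else case_nat a x)"

definition word_act :: "'a letter list \<Rightarrow> 'a bpoint \<Rightarrow> 'a bpoint" where
  "word_act w x = foldr letter_act w x"

lemma letter_inv_inv [simp]: "letter_inv (letter_inv a) = a"
  by (simp add: letter_inv_def)

lemma letter_inv_neq [simp]: "letter_inv a \<noteq> a" "a \<noteq> letter_inv a"
  by (auto simp: letter_inv_def prod_eq_iff)

lemma letter_inv_letters [simp]: "letter_inv a \<in> letters S \<longleftrightarrow> a \<in> letters S"
  by (auto simp: letter_inv_def letters_def mem_Times_iff)

lemma letter_mult_reduced:
  "a \<in> letters S \<Longrightarrow> w \<in> reduced_words S \<Longrightarrow> letter_mult a w \<in> reduced_words S"
  by (cases w) (auto simp: reduced_words_def successively_Cons)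

lemma letter_mult_cancel:
  assumes "w \<in> reduced_words S"
  shows "letter_mult a (letter_mult (letter_inv a) w) = w"
proof (cases w)
  case (Cons b v)
  with assms show ?thesis
    by (cases v) (auto simp: reduced_words_def successively_Cons)
qed simp

lemma word_mult_reduced:
  "u \<in> lists (letters S) \<Longrightarrow> w \<in> reduced_words S \<Longrightarrow> word_mult u w \<in> reduced_words S"
  unfolding word_mult_def by (induction u) (auto intro: letter_mult_reduced)

lemma word_mult_letter_mult:
  assumes "u \<in> reduced_words S" "a \<in> letters S" "w \<in> reduced_words S"
  shows "word_mult (letter_mult a u) w = letter_mult a (word_mult u w)"
proof (cases u)
  case (Cons b v)
  have "word_mult v w \<in> reduced_words S"
    using assms Cons by (intro word_mult_reduced) (auto simp: reduced_words_def)
  then show ?thesis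
    using Cons letter_mult_cancel[of "word_mult v w" S a] by (auto simp: word_mult_def)
qed (simp add: word_mult_def)

lemma word_mult_assoc:
  assumes "u \<in> lists (letters S)" "v \<in> reduced_words S" "w \<in> reduced_words S"
  shows "word_mult (word_mult u v) w = word_mult u (word_mult v w)"
  using assms(1)
proof (induction u)
  case (Cons a u)
  then show ?case
    using word_mult_letter_mult[of "word_mult u v" S a w] word_mult_reduced[of u S v] assms
    by (simp add: word_mult_def)
qed (simp add: word_mult_def)

lemma word_mult_Nil: "u \<in> reduced_words S \<Longrightarrow> word_mult u [] = u"
proof (induction u)
  case (Cons a u)
  then have "u \<in> reduced_words S"
    by (auto simp: reduced_words_def successively_Cons)
  with Cons show ?case
    by (cases u) (auto simp: word_mult_def reduced_words_def)
qed (simp add: word_mult_def)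

lemma word_mult_left_inv:
  "u \<in> reduced_words S \<Longrightarrow> \<exists>v\<in>reduced_words S. word_mult v u = []"
proof (induction u)
  case Nil
  then show ?case by (intro bexI[of _ "[]"]) (auto simp: word_mult_def)
next
  case (Cons a u)
  then have u: "u \<in> reduced_words S" and a: "a \<in> letters S"
    by (auto simp: reduced_words_def successively_Cons)
  then obtain v where v: "v \<in> reduced_words S" "word_mult v u = []"
    using Cons.IH by auto
  have 1: "[letter_inv a] \<in> reduced_words S"
    using a by (simp add: reduced_words_def)
  have "word_mult (word_mult v [letter_inv a]) (a # u) = word_mult v (word_mult [letter_inv a] (a # u))"
    using v(1) 1 Cons.prems by (intro word_mult_assoc[of _ S]) (auto simp: reduced_words_def)
  also have "word_mult [letter_inv a] (a # u) = u"
    by (simp add: word_mult_def)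
  finally have "word_mult (word_mult v [letter_inv a]) (a # u) = []"
    using v by simp
  moreover have "word_mult v [letter_inv a] \<in> reduced_words S"
    using v 1 by (intro word_mult_reduced) (auto simp: reduced_words_def)
  ultimately show ?case by blast
qed

lemma group_free_group: "group (free_group S)"
proof (rule groupI)
  show "\<And>x y. x \<in> carrier (free_group S) \<Longrightarrow> y \<in> carrier (free_group S)
      \<Longrightarrow> x \<otimes>\<^bsub>free_group S\<^esub> y \<in> carrier (free_group S)"
    using word_mult_reduced by (auto simp: free_group_def reduced_words_def)
  show "\<And>x y z. x \<in> carrier (free_group S) \<Longrightarrow> y \<in> carrier (free_group S) \<Longrightarrow> z \<in> carrier (free_group S)
      \<Longrightarrow> x \<otimes>\<^bsub>free_group S\<^esub> y \<otimes>\<^bsub>free_group S\<^esub> z = x \<otimes>\<^bsub>free_group S\<^esub> (y \<otimes>\<^bsub>free_group S\<^esub> z)"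
    using word_mult_assoc[of _ S] by (auto simp: free_group_def reduced_words_def)
  show "\<And>x. x \<in> carrier (free_group S) \<Longrightarrow>
      \<exists>y\<in>carrier (free_group S). y \<otimes>\<^bsub>free_group S\<^esub> x = \<one>\<^bsub>free_group S\<^esub>"
    using word_mult_left_inv[of _ S] by (simp add: free_group_def)
qed (auto simp: free_group_def reduced_words_def word_mult_def)

lemma letter_act_boundary:
  "a \<in> letters S \<Longrightarrow> x \<in> boundary S \<Longrightarrow> letter_act a x \<in> boundary S"
  by (auto simp: boundary_def letter_act_def split: nat.splits)

lemma word_act_boundary:
  "w \<in> reduced_words S \<Longrightarrow> x \<in> boundary S \<Longrightarrow> word_act w x \<in> boundary S"
proof -
  assume "w \<in> reduced_words S" and x: "x \<in> boundary S"
  then have "w \<in> lists (letters S)" by (simp add: reduced_words_def)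
  then show ?thesis
    unfolding word_act_def using x by induction (auto intro: letter_act_boundary)
qed

lemma letter_act_cancel:
  assumes "x \<in> boundary S"
  shows "letter_act a (letter_act (letter_inv a) x) = x"
  using assms by (auto simp: boundary_def letter_act_def fun_eq_iff split: nat.splits)

lemma word_act_letter_mult:
  assumes "u \<in> reduced_words S" "a \<in> letters S" "x \<in> boundary S"
  shows "word_act (letter_mult a u) x = letter_act a (word_act u x)"
proof (cases u)
  case (Cons b v)
  then have "v \<in> reduced_words S"
    using assms by (auto simp: reduced_words_def successively_Cons)
  then have "word_act v x \<in> boundary S"
    using assms(3) by (rule word_act_boundary)
  then show ?thesis
    using Cons letter_act_cancel[of "word_act v x" S a] by (auto simp: word_act_def)
qed (simp add: word_act_def)

lemma word_act_mult:
  assumes "u \<in> reduced_words S" "v \<in> reduced_words S" "x \<in> boundary S"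
  shows "word_act (u \<otimes>\<^bsub>free_group S\<^esub> v) x = word_act u (word_act v x)"
proof -
  have "u \<in> lists (letters S)" using assms(1) by (simp add: reduced_words_def)
  then have "word_act (word_mult u v) x = word_act u (word_act v x)"
  proof induction
    case (Cons a u)
    then show ?case
      using word_act_letter_mult[of "word_mult u v" S a x] word_mult_reduced[of u S v] assms
      by (simp add: word_mult_def word_act_def)
  qed (simp add: word_mult_def word_act_def)
  then show ?thesis by (simp add: free_group_def)
qed


section \<open>Measures on the boundary\<close>

definition boundary_measure :: "'a set \<Rightarrow> 'a bpoint measure \<Rightarrow> bool" where
  "boundary_measure S \<mu> \<longleftrightarrow>
     space \<mu> = boundary S \<and>
     sets \<mu> = sigma_sets (boundary S) {U. openin (boundary_topology S) U} \<and>
     sigma_finite_measure \<mu> \<and>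
     emeasure \<mu> (space \<mu>) \<noteq> 0"

definition quasi_invariant ::
  "('g, 'm) monoid_scheme \<Rightarrow> ('g \<Rightarrow> 'x \<Rightarrow> 'x) \<Rightarrow> 'x measure \<Rightarrow> bool" where
  "quasi_invariant G act \<mu> \<longleftrightarrow>
     (\<forall>s\<in>carrier G. \<forall>X\<in>sets \<mu>. act s ` X \<in> null_sets \<mu> \<longleftrightarrow> X \<in> null_sets \<mu>)"

definition ergodic ::
  "('g, 'm) monoid_scheme \<Rightarrow> ('g \<Rightarrow> 'x \<Rightarrow> 'x) \<Rightarrow> 'x measure \<Rightarrow> bool" where
  "ergodic G act \<mu> \<longleftrightarrow>
     (\<forall>X\<in>sets \<mu>. (\<forall>s\<in>carrier G. act s ` X = X) \<longrightarrow>
        X \<in> null_sets \<mu> \<or> space \<mu> - X \<in> null_sets \<mu>)"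

definition doubly_ergodic ::
  "('g, 'm) monoid_scheme \<Rightarrow> ('g \<Rightarrow> 'x \<Rightarrow> 'x) \<Rightarrow> 'x measure \<Rightarrow> bool" where
  "doubly_ergodic G act \<mu> \<longleftrightarrow>
     ergodic G (\<lambda>s. map_prod (act s) (act s)) (\<mu> \<Otimes>\<^sub>M \<mu>)"


section \<open>Operators on a complex Hilbert space\<close>

text \<open>Since the space \<open>L\<^sup>2(\<mu>)\<close> depends on the term \<open>\<mu>\<close>, Hilbert spaces are given by an explicit
  carrier.  The inner product is linear in its first argument.  Operators are functions on
  the carrier that are \<^const>\<open>undefined\<close> outside, so that equality of operators is \<open>=\<close>.\<close>

record 'h ip_space =
  vecs :: "'h set"
  vadd :: "'h \<Rightarrow> 'h \<Rightarrow> 'h"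
  vscale :: "complex \<Rightarrow> 'h \<Rightarrow> 'h"
  vinner :: "'h \<Rightarrow> 'h \<Rightarrow> complex"

definition vnorm :: "('h, 'm) ip_space_scheme \<Rightarrow> 'h \<Rightarrow> real" where
  "vnorm H x = sqrt (Re (vinner H x x))"

definition bounded_ops :: "('h, 'm) ip_space_scheme \<Rightarrow> ('h \<Rightarrow> 'h) set" where
  "bounded_ops H = {T \<in> vecs H \<rightarrow>\<^sub>E vecs H.
     (\<forall>x\<in>vecs H. \<forall>y\<in>vecs H. T (vadd H x y) = vadd H (T x) (T y)) \<and>
     (\<forall>c. \<forall>x\<in>vecs H. T (vscale H c x) = vscale H c (T x)) \<and>
     (\<exists>C. \<forall>x\<in>vecs H. vnorm H (T x) \<le> C * vnorm H x)}"

definition op_add :: "('h, 'm) ip_space_scheme \<Rightarrow> ('h \<Rightarrow> 'h) \<Rightarrow> ('h \<Rightarrow> 'h) \<Rightarrow> ('h \<Rightarrow> 'h)" where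
  "op_add H T U = (\<lambda>x\<in>vecs H. vadd H (T x) (U x))"

definition op_scale :: "('h, 'm) ip_space_scheme \<Rightarrow> complex \<Rightarrow> ('h \<Rightarrow> 'h) \<Rightarrow> ('h \<Rightarrow> 'h)" where
  "op_scale H c T = (\<lambda>x\<in>vecs H. vscale H c (T x))"

definition op_mult :: "('h, 'm) ip_space_scheme \<Rightarrow> ('h \<Rightarrow> 'h) \<Rightarrow> ('h \<Rightarrow> 'h) \<Rightarrow> ('h \<Rightarrow> 'h)" where
  "op_mult H T U = compose (vecs H) T U"

definition is_adjoint :: "('h, 'm) ip_space_scheme \<Rightarrow> ('h \<Rightarrow> 'h) \<Rightarrow> ('h \<Rightarrow> 'h) \<Rightarrow> bool" where
  "is_adjoint H T U \<longleftrightarrow> U \<in> bounded_ops H \<and>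
     (\<forall>x\<in>vecs H. \<forall>y\<in>vecs H. vinner H (T x) y = vinner H x (U y))"

definition op_norm :: "('h, 'm) ip_space_scheme \<Rightarrow> ('h \<Rightarrow> 'h) \<Rightarrow> real" where
  "op_norm H T = Inf {C. 0 \<le> C \<and> (\<forall>x\<in>vecs H. vnorm H (T x) \<le> C * vnorm H x)}"

inductive_set star_alg_gen :: "('h, 'm) ip_space_scheme \<Rightarrow> ('h \<Rightarrow> 'h) set \<Rightarrow> ('h \<Rightarrow> 'h) set"
  for H :: "('h, 'm) ip_space_scheme" and A :: "('h \<Rightarrow> 'h) set" where
  gen: "T \<in> A \<Longrightarrow> T \<in> star_alg_gen H A"
| add: "T \<in> star_alg_gen H A \<Longrightarrow> U \<in> star_alg_gen H A \<Longrightarrow> op_add H T U \<in> star_alg_gen H A"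
| scale: "T \<in> star_alg_gen H A \<Longrightarrow> op_scale H c T \<in> star_alg_gen H A"
| mult: "T \<in> star_alg_gen H A \<Longrightarrow> U \<in> star_alg_gen H A \<Longrightarrow> op_mult H T U \<in> star_alg_gen H A"
| adj: "T \<in> star_alg_gen H A \<Longrightarrow> is_adjoint H T U \<Longrightarrow> U \<in> star_alg_gen H A"

definition cstar_gen :: "('h, 'm) ip_space_scheme \<Rightarrow> ('h \<Rightarrow> 'h) set \<Rightarrow> ('h \<Rightarrow> 'h) set" where
  "cstar_gen H A = {T \<in> bounded_ops H.
     \<forall>e>0. \<exists>U\<in>star_alg_gen H A. op_norm H (op_add H T (op_scale H (-1) U)) < e}"

definition commutant :: "('h, 'm) ip_space_scheme \<Rightarrow> ('h \<Rightarrow> 'h) set \<Rightarrow> ('h \<Rightarrow> 'h) set" where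
  "commutant H A = {T \<in> bounded_ops H. \<forall>U\<in>A. op_mult H T U = op_mult H U T}"

definition vn_gen :: "('h, 'm) ip_space_scheme \<Rightarrow> ('h \<Rightarrow> 'h) set \<Rightarrow> ('h \<Rightarrow> 'h) set" where
  "vn_gen H A = commutant H (commutant H (A \<union> {U. \<exists>T\<in>A. is_adjoint H T U}))"

text \<open>Positivity of the matrix \<open>(a i j)\<close>, \<open>i, j < n\<close>, as an operator on the \<open>n\<close>-fold direct sum
  of the Hilbert space.\<close>

definition positive_matrix ::
  "('h, 'm) ip_space_scheme \<Rightarrow> nat \<Rightarrow> (nat \<Rightarrow> nat \<Rightarrow> 'h \<Rightarrow> 'h) \<Rightarrow> bool" where
  "positive_matrix H n a \<longleftrightarrow> (\<forall>v. (\<forall>i<n. v i \<in> vecs H) \<longrightarrow>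
     (\<Sum>i<n. \<Sum>j<n. vinner H (a i j (v j)) (v i)) \<in> \<real>\<^sub>\<ge>\<^sub>0)"

definition completely_positive ::
  "('h, 'm) ip_space_scheme \<Rightarrow> ('h \<Rightarrow> 'h) set \<Rightarrow> ('h \<Rightarrow> 'h) set \<Rightarrow> (('h \<Rightarrow> 'h) \<Rightarrow> ('h \<Rightarrow> 'h)) \<Rightarrow> bool"
  where
  "completely_positive H A B \<theta> \<longleftrightarrow>
     \<theta> \<in> A \<rightarrow> B \<and>
     (\<forall>T\<in>A. \<forall>U\<in>A. \<theta> (op_add H T U) = op_add H (\<theta> T) (\<theta> U)) \<and>
     (\<forall>c. \<forall>T\<in>A. \<theta> (op_scale H c T) = op_scale H c (\<theta> T)) \<and>
     (\<forall>n a. (\<forall>i<n. \<forall>j<n. a i j \<in> A) \<longrightarrow> positive_matrix H n a \<longrightarrow>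
        positive_matrix H n (\<lambda>i j. \<theta> (a i j)))"


section \<open>The Hilbert space of square-integrable functions\<close>

definition square_integrable :: "'x measure \<Rightarrow> ('x \<Rightarrow> complex) set" where
  "square_integrable M = {f \<in> borel_measurable M. integrable M (\<lambda>x. (cmod (f x))\<^sup>2)}"

definition L2_class :: "'x measure \<Rightarrow> ('x \<Rightarrow> complex) \<Rightarrow> ('x \<Rightarrow> complex) set" where
  "L2_class M f = {g \<in> square_integrable M. AE x in M. g x = f x}"

definition L2_rep :: "('x \<Rightarrow> complex) set \<Rightarrow> 'x \<Rightarrow> complex" where
  "L2_rep u = (SOME f. f \<in> u)"

definition L2 :: "'x measure \<Rightarrow> ('x \<Rightarrow> complex) set ip_space" where
  "L2 M = \<lparr>
     vecs = L2_class M ` square_integrable M,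
     vadd = (\<lambda>u v. L2_class M (\<lambda>x. L2_rep u x + L2_rep v x)),
     vscale = (\<lambda>c u. L2_class M (\<lambda>x. c * L2_rep u x)),
     vinner = (\<lambda>u v. \<integral>x. L2_rep u x * cnj (L2_rep v x) \<partial>M)\<rparr>"

definition Linfty :: "'x measure \<Rightarrow> ('x \<Rightarrow> complex) set" where
  "Linfty M = {f \<in> borel_measurable M. \<exists>C. AE x in M. cmod (f x) \<le> C}"


section \<open>Crossed products\<close>

text \<open>The crossed product acts on \<open>L\<^sup>2(X \<times> G) = \<ell>\<^sup>2(G, L\<^sup>2(X))\<close> by its regular representation
  \<open>(\<pi>(f)\<xi>)(x,t) = f(t x) \<xi>(x,t)\<close> and \<open>(\<lambda>(s)\<xi>)(x,t) = \<xi>(x, s\<^sup>-\<^sup>1 t)\<close>; thus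
  \<open>\<lambda>(s) \<pi>(f) \<lambda>(s)\<^sup>* = \<pi>(s\<cdot>f)\<close> where \<open>(s\<cdot>f)(x) = f(s\<^sup>-\<^sup>1 x)\<close>.  The conditional expectation onto
  \<open>\<pi>(L\<^sup>\<infinity>)\<close> is compression to the functions supported on \<open>X \<times> {1}\<close>.
  For a quasi-invariant measure, \<open>\<pi>(f)\<close> depends only on the class of \<open>f\<close>.\<close>

definition cp_space ::
  "('g, 'm) monoid_scheme \<Rightarrow> 'x measure \<Rightarrow> ('x \<times> 'g \<Rightarrow> complex) set ip_space" where
  "cp_space G \<mu> = L2 (\<mu> \<Otimes>\<^sub>M count_space (carrier G))"

definition cp_fun ::
  "('g, 'm) monoid_scheme \<Rightarrow> ('g \<Rightarrow> 'x \<Rightarrow> 'x) \<Rightarrow> 'x measure \<Rightarrow> ('x \<Rightarrow> complex) \<Rightarrow>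
   ('x \<times> 'g \<Rightarrow> complex) set \<Rightarrow> ('x \<times> 'g \<Rightarrow> complex) set" where
  "cp_fun G act \<mu> f = (\<lambda>u\<in>vecs (cp_space G \<mu>).
     L2_class (\<mu> \<Otimes>\<^sub>M count_space (carrier G)) (\<lambda>(x, t). f (act t x) * L2_rep u (x, t)))"

definition cp_unitary ::
  "('g, 'm) monoid_scheme \<Rightarrow> 'x measure \<Rightarrow> 'g \<Rightarrow>
   ('x \<times> 'g \<Rightarrow> complex) set \<Rightarrow> ('x \<times> 'g \<Rightarrow> complex) set" where
  "cp_unitary G \<mu> s = (\<lambda>u\<in>vecs (cp_space G \<mu>).
     L2_class (\<mu> \<Otimes>\<^sub>M count_space (carrier G)) (\<lambda>(x, t). L2_rep u (x, inv\<^bsub>G\<^esub> s \<otimes>\<^bsub>G\<^esub> t)))"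

definition vn_crossed_product ::
  "('g, 'm) monoid_scheme \<Rightarrow> ('g \<Rightarrow> 'x \<Rightarrow> 'x) \<Rightarrow> 'x measure \<Rightarrow>
   (('x \<times> 'g \<Rightarrow> complex) set \<Rightarrow> ('x \<times> 'g \<Rightarrow> complex) set) set" where
  "vn_crossed_product G act \<mu> = vn_gen (cp_space G \<mu>)
     (cp_fun G act \<mu> ` Linfty \<mu> \<union> cp_unitary G \<mu> ` carrier G)"

text \<open>\<open>C\<^sup>*\<^sub>r(G, X)\<close> and \<open>C\<^sup>*\<^sub>r(G)\<close>, as subalgebras of the von Neumann algebra crossed product.\<close>

definition cstar_crossed_product ::
  "('g, 'm) monoid_scheme \<Rightarrow> ('g \<Rightarrow> 'x \<Rightarrow> 'x) \<Rightarrow> 'x topology \<Rightarrow> 'x measure \<Rightarrow>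
   (('x \<times> 'g \<Rightarrow> complex) set \<Rightarrow> ('x \<times> 'g \<Rightarrow> complex) set) set" where
  "cstar_crossed_product G act X \<mu> = cstar_gen (cp_space G \<mu>)
     (cp_fun G act \<mu> ` {f. continuous_map X euclidean f} \<union> cp_unitary G \<mu> ` carrier G)"

definition cstar_group ::
  "('g, 'm) monoid_scheme \<Rightarrow> 'x measure \<Rightarrow>
   (('x \<times> 'g \<Rightarrow> complex) set \<Rightarrow> ('x \<times> 'g \<Rightarrow> complex) set) set" where
  "cstar_group G \<mu> = cstar_gen (cp_space G \<mu>) (cp_unitary G \<mu> ` carrier G)"

end

theory Submission
  imports Defs
begin

text \<open>
  By Choi's multiplicative domain argument \<open>\<theta>\<close> is equivariant, so compressing \<open>\<theta>(1\<^sub>C)\<close>, for clopen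
  \<open>C\<close>, to the functions supported on \<open>\<partial>\<Gamma> \<times> {1}\<close> gives functions \<open>p\<^sub>C\<close> that are nonnegative, additive in
  \<open>C\<close>, equal to 1 for \<open>C = \<partial>\<Gamma>\<close>, and satisfy \<open>p\<^sub>s\<^sub>C(\<xi>) = p\<^sub>C(s\<^sup>-\<^sup>1 \<xi>)\<close>: an equivariant field of finitely
  additive probabilities on the clopen sets.  It is the Dirac field.  Otherwise, for some letters
  \<open>x \<noteq> y\<close>, the mass \<open>p\<^sub>y\<close> of the words starting with \<open>y\<close> exceeds some \<open>\<epsilon> > 0\<close> on a nonnull set \<open>P\<close> of
  words starting with \<open>x\<close>.  Take a third letter \<open>z\<close> and \<open>G = P \<times> C\<^sub>z\<close>.  If \<open>(\<xi>, \<eta>)\<close> lies in several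
  translates \<open>v G\<close>, the sets \<open>v C\<^sub>y\<close> are disjoint, since a tripod has only one center, and each has
  \<open>\<xi>\<close>-mass above \<open>\<epsilon>\<close>; so there are at most \<open>1/\<epsilon>\<close> of them.  This finiteness contradicts double ergodicity.
  Hence the compressions of \<open>\<theta>(1\<^sub>C)\<close> and \<open>1\<^sub>C\<close> agree for the sets \<open>C\<close> of words with a given first letter,
  positivity of \<open>\<theta>(1\<^sub>C)\<close> and \<open>1 - \<theta>(1\<^sub>C)\<close> forces \<open>\<theta>(1\<^sub>C) = 1\<^sub>C\<close>, and the translates of these projections
  generate \<open>C(\<partial>\<Gamma>)\<close>.
\<close>

text \<open>The obstacle is that \<theta> takes values in the von Neumann crossed product:
  \<theta>(1_C) need not lie in L^\<infinity>, and the ergodicity argument says nothing about its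
  off-diagonal coefficients. Only the diagonal is controlled. Positivity turns this into full
  information, since a positive operator whose form vanishes at a vector kills that vector. The
  argument uses \<theta>(1_C) and \<theta>(1 - 1_C) together, so vanishing is proved for finite
  unions of first-letter sets.

  The second factor of \<open>\<mu> \<Otimes>\<^sub>M \<mu>\<close> pins down a tripod: the point
  lies in direction x, the mass in direction y, and the direction z makes the center unique. Rank at
  least 2 gives four letters, so z exists.

  Continuity of \<theta> is extracted from the positivity of 2 by 2 matrices. The measure may be
  infinite, so a nowhere vanishing square-integrable function stands in for the constant 1. Elements
  of the von Neumann algebra are tested against two explicit families in its commutant:
  multiplications by functions on the boundary and weighted right translations.\<close>

text \<open>Along a real line through the origin the expression is a quadratic without constant
  term; being nonnegative for both signs of the parameter, it has no linear term. The lines through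
  1 and \<i> give \<open>z + w = 0\<close> and \<open>z = w\<close>.\<close>

lemma complex_quadratic_nonneg_imp_zero:
  fixes z w k :: complex
  assumes "\<And>a::complex. a * z + cnj a * w + of_real ((cmod a)\<^sup>2) * k \<in> \<real>\<^sub>\<ge>\<^sub>0"
  shows "z = 0" "w = 0"
proof -
  have linear: "d = 0" if d: "\<And>t::real. of_real t * d + of_real (t\<^sup>2) * k \<in> \<real>\<^sub>\<ge>\<^sub>0" for d
  proof -
    have Re: "0 \<le> t * Re d + t\<^sup>2 * Re k" for t
      using d[of t] by (simp add: complex_nonneg_Reals_iff)
    have Im: "t * Im d + t\<^sup>2 * Im k = 0" for t
      using d[of t] by (simp add: complex_nonneg_Reals_iff)
    have "Im d = 0"
      using Im[of 1] Im[of "-1"] by simp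
    moreover have "Re d = 0"
    proof (rule ccontr)
      assume "Re d \<noteq> 0"
      \<comment> \<open>The denominator exceeds \<open>Re k\<close>, so the linear term beats the
        quadratic one, and adding 1 keeps it nonzero when \<open>Re k = 0\<close>.\<close>
      define t where "t = - Re d / (\<bar>Re k\<bar> + 1)"
      have "t * c + t\<^sup>2 * b = c\<^sup>2 / a * (b / a - 1)" if "t = - c / a" for a b c :: real
        using that by (simp add: power2_eq_square field_simps add_divide_distrib diff_divide_distrib)
      from this[OF t_def] have "t * Re d + t\<^sup>2 * Re k = (Re d)\<^sup>2 / (\<bar>Re k\<bar> + 1) * (Re k / (\<bar>Re k\<bar> + 1) - 1)" .
      moreover have "Re k / (\<bar>Re k\<bar> + 1) - 1 < 0"
        using abs_ge_self[of "Re k"] by (simp add: divide_less_eq)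
      moreover have "(Re d)\<^sup>2 / (\<bar>Re k\<bar> + 1) > 0"
        using \<open>Re d \<noteq> 0\<close> by (intro divide_pos_pos) auto
      ultimately have "t * Re d + t\<^sup>2 * Re k < 0"
        by (metis mult_pos_neg)
      with Re[of t] show False by simp
    qed
    ultimately show ?thesis by (simp add: complex_eq_iff)
  qed
  have "z + w = 0"
    using assms[of "of_real t" for t] by (intro linear) (simp add: algebra_simps)
  moreover have "\<i> * z - \<i> * w = 0"
    using assms[of "of_real t * \<i>" for t] by (intro linear) (simp add: algebra_simps norm_mult)
  then have "z = w" by simp
  ultimately show "z = 0" "w = 0" by auto
qed

section \<open>Completely positive maps on a concrete C*-algebra\<close>

text \<open>Completeness enters only through the existence of weak limits of rapidly Cauchy sequences.\<close>

locale hilbert =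
  fixes H :: "('h, 'm) ip_space_scheme"
  assumes vadd_closed: "x \<in> vecs H \<Longrightarrow> y \<in> vecs H \<Longrightarrow> vadd H x y \<in> vecs H"
    and vscale_closed: "x \<in> vecs H \<Longrightarrow> vscale H c x \<in> vecs H"
    and vinner_add: "x \<in> vecs H \<Longrightarrow> y \<in> vecs H \<Longrightarrow> z \<in> vecs H \<Longrightarrow>
      vinner H (vadd H x y) z = vinner H x z + vinner H y z"
    and vinner_scale: "x \<in> vecs H \<Longrightarrow> z \<in> vecs H \<Longrightarrow> vinner H (vscale H c x) z = c * vinner H x z"
    and vinner_commute: "x \<in> vecs H \<Longrightarrow> y \<in> vecs H \<Longrightarrow> vinner H y x = cnj (vinner H x y)"
    and vinner_nonneg: "x \<in> vecs H \<Longrightarrow> 0 \<le> Re (vinner H x x)"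
    and vinner_ext: "x \<in> vecs H \<Longrightarrow> y \<in> vecs H \<Longrightarrow>
      (\<And>z. z \<in> vecs H \<Longrightarrow> vinner H x z = vinner H y z) \<Longrightarrow> x = y"
    and weak_limit: "(\<And>n. v n \<in> vecs H) \<Longrightarrow>
      (\<And>n. vnorm H (vadd H (v (Suc n)) (vscale H (-1) (v n))) \<le> C * (1/2) ^ n) \<Longrightarrow>
      \<exists>w\<in>vecs H. \<forall>x\<in>vecs H. (\<lambda>n. vinner H x (v n)) \<longlonglongrightarrow> vinner H x w"
begin

section \<open>Inner product geometry on an explicit carrier\<close>

abbreviation "V \<equiv> vecs H"
abbreviation "ip \<equiv> vinner H"
abbreviation "vsub x y \<equiv> vadd H x (vscale H (-1) y)"

lemma vinner_add_right:
  "x \<in> V \<Longrightarrow> y \<in> V \<Longrightarrow> z \<in> V \<Longrightarrow>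
    ip z (vadd H x y) = ip z x + ip z y"
  using vinner_add[of x y z] vinner_commute vadd_closed by (metis complex_cnj_add)

lemma vinner_scale_right:
  "x \<in> V \<Longrightarrow> z \<in> V \<Longrightarrow> ip z (vscale H c x) = cnj c * ip z x"
  using vinner_scale[of x z c] vinner_commute vscale_closed by (metis complex_cnj_mult)

lemmas vinner_simps = vinner_add vinner_scale vinner_add_right vinner_scale_right
  vadd_closed vscale_closed

lemma vinner_self:
  assumes x: "x \<in> V"
  shows "ip x x = of_real ((vnorm H x)\<^sup>2)"
proof (rule complex_eqI)
  have "cnj (ip x x) = ip x x"
    using vinner_commute[OF x x] by simp
  then have "Im (cnj (ip x x)) = Im (ip x x)"
    by (rule arg_cong)
  then show "Im (ip x x) = Im (of_real ((vnorm H x)\<^sup>2))"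
    by (simp del: of_real_power)
  show "Re (ip x x) = Re (of_real ((vnorm H x)\<^sup>2))"
    using vinner_nonneg[OF x] by (simp add: vnorm_def del: of_real_power)
qed

lemma vnorm_nonneg [simp]: "x \<in> V \<Longrightarrow> 0 \<le> vnorm H x"
  using vinner_nonneg by (simp add: vnorm_def)

text \<open>The usual minimisation over \<open>vadd H x (vscale H a y)\<close>. Definiteness of the
  form is not at hand yet, so \<open>vnorm H y = 0\<close> is a case of its own, in which multiples
  of \<open>y\<close> would drive a square below zero.\<close>

lemma Cauchy_Schwarz:
  assumes x: "x \<in> V" and y: "y \<in> V"
  shows "cmod (ip x y) \<le> vnorm H x * vnorm H y"
proof -
  define b where "b = ip x y"
  have b': "ip y x = cnj b"
    using vinner_commute[OF x y] by (simp add: b_def)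
  have exp: "0 \<le> (vnorm H x)\<^sup>2 + 2 * Re (cnj a * b) + (cmod a)\<^sup>2 * (vnorm H y)\<^sup>2" for a
  proof -
    have "ip (vadd H x (vscale H a y)) (vadd H x (vscale H a y)) =
      ip x x + cnj a * b + a * cnj b + a * cnj a * ip y y"
      using x y by (simp add: vinner_simps b' b_def algebra_simps)
    also have "Re \<dots> = (vnorm H x)\<^sup>2 + 2 * Re (cnj a * b) + (cmod a)\<^sup>2 * (vnorm H y)\<^sup>2"
      using vinner_self[OF x] vinner_self[OF y]
      by (simp add: cmod_power2 power2_eq_square[of "Im a"] power2_eq_square[of "Re a"]
          algebra_simps flip: of_real_power)
    finally show ?thesis
      using vinner_nonneg[of "vadd H x (vscale H a y)"] x y by (simp add: vinner_simps)
  qed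
  have "(cmod b)\<^sup>2 \<le> (vnorm H x)\<^sup>2 * (vnorm H y)\<^sup>2"
  proof (cases "vnorm H y = 0")
    case False
    define s where "s = (vnorm H y)\<^sup>2"
    have s: "s > 0" using False by (simp add: s_def)
    \<comment> \<open>The expanded square is minimal at \<open>a = - b / s\<close>.\<close>
    have "cnj (- b / of_real s) * b = of_real (- (cmod b)\<^sup>2 / s)"
      using complex_norm_square[of b] by (simp add: mult.commute)
    moreover have "(cmod (- b / of_real s))\<^sup>2 * s = (cmod b)\<^sup>2 / s"
      using s by (simp add: norm_divide power_divide power2_eq_square)
    ultimately have "0 \<le> (vnorm H x)\<^sup>2 - (cmod b)\<^sup>2 / s"
      using exp[of "- b / of_real s"] by (simp add: s_def[symmetric] del: times_complex.sel complex_cnj_divide)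
    then show ?thesis using s by (simp add: s_def[symmetric] field_simps)
  next
    case True
    have "b = 0"
    proof (rule ccontr)
      assume "b \<noteq> 0"
      \<comment> \<open>With the quadratic term gone, any \<open>t\<close> above
        \<open>(vnorm H x)\<^sup>2 / (2 * (cmod b)\<^sup>2)\<close> contradicts
        \<open>exp\<close>.\<close>
      define t where "t = ((vnorm H x)\<^sup>2 + 1) / (cmod b)\<^sup>2"
      have "cnj (- of_real t * b) * b = of_real (- t * (cmod b)\<^sup>2)"
        by (simp add: complex_norm_square mult.commute del: of_real_power)
      moreover have "t * (cmod b)\<^sup>2 = (vnorm H x)\<^sup>2 + 1"
        using \<open>b \<noteq> 0\<close> by (simp add: t_def)
      ultimately have "Re (cnj (- of_real t * b) * b) = - ((vnorm H x)\<^sup>2 + 1)"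
        by (metis Re_complex_of_real mult_minus_left)
      then have "0 \<le> (vnorm H x)\<^sup>2 - 2 * ((vnorm H x)\<^sup>2 + 1)"
        using exp[of "- of_real t * b"] True by (simp del: mult_minus_left complex_cnj_mult times_complex.sel)
      then show False by (smt (verit) zero_le_power2)
    qed
    then show ?thesis by simp
  qed
  then show ?thesis
    using x y unfolding b_def by (metis abs_le_square_iff abs_norm_cancel abs_of_nonneg mult_nonneg_nonneg
        power_mult_distrib vnorm_nonneg)
qed

lemma vnorm_scale: "x \<in> V \<Longrightarrow> vnorm H (vscale H c x) = cmod c * vnorm H x"
proof -
  assume x: "x \<in> V"
  have "complex_of_real ((vnorm H (vscale H c x))\<^sup>2) = of_real ((cmod c * vnorm H x)\<^sup>2)"
    using vinner_self[of x] vinner_self[of "vscale H c x"] x complex_norm_square[of c]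
    by (simp add: vinner_simps power_mult_distrib mult.assoc mult.left_commute)
  then show ?thesis
    using x by (simp add: vinner_simps del: of_real_power of_real_mult)
qed

lemma vnorm_add: "x \<in> V \<Longrightarrow> y \<in> V \<Longrightarrow> vnorm H (vadd H x y) \<le> vnorm H x + vnorm H y"
proof -
  assume xy: "x \<in> V" "y \<in> V"
  have "(vnorm H (vadd H x y))\<^sup>2 = Re (ip (vadd H x y) (vadd H x y))"
    using xy vinner_self[of "vadd H x y"] by (simp add: vinner_simps flip: of_real_power)
  also have "\<dots> = (vnorm H x)\<^sup>2 + (vnorm H y)\<^sup>2 + 2 * Re (ip x y)"
    using xy vinner_self[of x] vinner_self[of y] vinner_commute[of x y] 
    by (simp add: vinner_simps flip: of_real_power)
  also have "\<dots> \<le> (vnorm H x)\<^sup>2 + (vnorm H y)\<^sup>2 + 2 * (vnorm H x * vnorm H y)"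
    using complex_Re_le_cmod[of "ip x y"] Cauchy_Schwarz[OF xy] by simp
  also have "\<dots> = (vnorm H x + vnorm H y)\<^sup>2"
    by (simp add: power2_sum)
  finally show ?thesis
    using xy by (meson add_nonneg_nonneg power2_le_imp_le vnorm_nonneg)
qed

section \<open>Bounded operators\<close>

definition op_one :: "'h \<Rightarrow> 'h" where
  "op_one = (\<lambda>x\<in>V. x)"

lemma bounded_opsD: "T \<in> bounded_ops H \<Longrightarrow> x \<in> V \<Longrightarrow> T x \<in> V"
  by (auto simp: bounded_ops_def)

lemma bounded_ops_lin:
  "T \<in> bounded_ops H \<Longrightarrow> x \<in> V \<Longrightarrow> y \<in> V \<Longrightarrow> T (vadd H x y) = vadd H (T x) (T y)"
  "T \<in> bounded_ops H \<Longrightarrow> x \<in> V \<Longrightarrow> T (vscale H c x) = vscale H c (T x)"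
  by (auto simp: bounded_ops_def)

lemma bounded_ops_bound:
  assumes "T \<in> bounded_ops H"
  obtains C where "C > 0" "\<And>x. x \<in> V \<Longrightarrow> vnorm H (T x) \<le> C * vnorm H x"
proof -
  from assms obtain C where C: "\<forall>x\<in>V. vnorm H (T x) \<le> C * vnorm H x"
    by (auto simp: bounded_ops_def)
  show thesis
  proof (rule that)
    fix x assume "x \<in> V"
    then show "vnorm H (T x) \<le> (\<bar>C\<bar> + 1) * vnorm H x"
      using C by (smt (verit) mult_right_mono vnorm_nonneg)
  qed simp
qed

lemma op_ext:
  assumes "T \<in> bounded_ops H" "U \<in> bounded_ops H"
    "\<And>x y. x \<in> V \<Longrightarrow> y \<in> V \<Longrightarrow> ip (T x) y = ip (U x) y"
  shows "T = U"
proof (rule extensionalityI)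
  show "T \<in> extensional (V)" "U \<in> extensional (V)"
    using assms(1,2) by (auto simp: bounded_ops_def PiE_def)
  show "T x = U x" if "x \<in> V" for x
    using that bounded_opsD[OF assms(1)] bounded_opsD[OF assms(2)] assms(3) by (intro vinner_ext) auto
qed

lemma op_apply [simp]:
  "x \<in> V \<Longrightarrow> op_add H T U x = vadd H (T x) (U x)"
  "x \<in> V \<Longrightarrow> op_scale H c T x = vscale H c (T x)"
  "x \<in> V \<Longrightarrow> op_mult H T U x = T (U x)"
  "x \<in> V \<Longrightarrow> op_one x = x"
  by (auto simp: op_add_def op_scale_def op_mult_def op_one_def compose_eq)

text \<open>Linearity is checked after pairing with a vector: the interface contains no vector space
  axioms, so identities between vectors come from scalar identities through
  \<open>vinner_ext\<close>.\<close>

lemma bounded_opsI: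
  assumes "T \<in> extensional (V)" "\<And>x. x \<in> V \<Longrightarrow> T x \<in> V"
    "\<And>x y z. x \<in> V \<Longrightarrow> y \<in> V \<Longrightarrow> z \<in> V \<Longrightarrow>
       ip (T (vadd H x y)) z = ip (T x) z + ip (T y) z"
    "\<And>x c z. x \<in> V \<Longrightarrow> z \<in> V \<Longrightarrow> ip (T (vscale H c x)) z = c * ip (T x) z"
    "\<And>x. x \<in> V \<Longrightarrow> vnorm H (T x) \<le> C * vnorm H x"
  shows "T \<in> bounded_ops H"
  unfolding bounded_ops_def
proof (intro CollectI conjI ballI allI exI[of _ C])
  show "T \<in> V \<rightarrow>\<^sub>E V"
    using assms(1,2) by (auto simp: PiE_def)
qed (use assms in \<open>auto intro!: vinner_ext simp: vinner_simps\<close>)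

lemma bounded_op_one: "op_one \<in> bounded_ops H"
  by (rule bounded_opsI[where C = 1]) (auto simp: op_one_def vinner_simps)

lemma bounded_op_add:
  assumes T: "T \<in> bounded_ops H" and U: "U \<in> bounded_ops H"
  shows "op_add H T U \<in> bounded_ops H"
proof -
  obtain C D where C: "\<And>x. x \<in> V \<Longrightarrow> vnorm H (T x) \<le> C * vnorm H x"
    and D: "\<And>x. x \<in> V \<Longrightarrow> vnorm H (U x) \<le> D * vnorm H x"
    using assms bounded_ops_bound by metis
  note v = bounded_opsD[OF T] bounded_opsD[OF U]
  show ?thesis
  proof (rule bounded_opsI[where C = "C + D"])
    show "vnorm H (op_add H T U x) \<le> (C + D) * vnorm H x" if "x \<in> V" for x
      using that C[OF that] D[OF that] vnorm_add[of "T x" "U x"] by (simp add: v algebra_simps)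
    show "op_add H T U \<in> extensional (V)"
      by (simp add: op_add_def)
  qed (simp_all add: v vinner_simps distrib_left bounded_ops_lin[OF T] bounded_ops_lin[OF U])
qed

lemma bounded_op_scale:
  assumes T: "T \<in> bounded_ops H"
  shows "op_scale H c T \<in> bounded_ops H"
proof -
  obtain C where C: "\<And>x. x \<in> V \<Longrightarrow> vnorm H (T x) \<le> C * vnorm H x"
    using assms bounded_ops_bound by metis
  note v = bounded_opsD[OF T]
  show ?thesis
  proof (rule bounded_opsI[where C = "cmod c * C"])
    show "vnorm H (op_scale H c T x) \<le> cmod c * C * vnorm H x" if "x \<in> V" for x
      using that mult_left_mono[OF C[OF that], of "cmod c"] by (simp add: v vnorm_scale mult.assoc)
    show "op_scale H c T \<in> extensional (V)"
      by (simp add: op_scale_def)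
  qed (simp_all add: v vinner_simps distrib_left bounded_ops_lin[OF T])
qed

lemma bounded_op_mult:
  assumes "T \<in> bounded_ops H" "U \<in> bounded_ops H"
  shows "op_mult H T U \<in> bounded_ops H"
proof -
  obtain C D where C: "C > 0" "\<And>x. x \<in> V \<Longrightarrow> vnorm H (T x) \<le> C * vnorm H x"
    and D: "\<And>x. x \<in> V \<Longrightarrow> vnorm H (U x) \<le> D * vnorm H x"
    using assms bounded_ops_bound by metis
  show ?thesis
  proof (rule bounded_opsI[where C = "C * D"])
    show "vnorm H (op_mult H T U x) \<le> C * D * vnorm H x" if "x \<in> V" for x
    proof -
      have "vnorm H (T (U x)) \<le> C * vnorm H (U x)"
        using that bounded_opsD[OF assms(2)] by (intro C(2)) auto
      also have "\<dots> \<le> C * (D * vnorm H x)"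
        using D[OF that] C(1) by (intro mult_left_mono) auto
      finally show ?thesis
        using that by (simp add: mult.assoc)
    qed
    show "op_mult H T U \<in> extensional (V)"
      unfolding op_mult_def by (rule compose_extensional)
    show "op_mult H T U x \<in> V" if "x \<in> V" for x
      using that bounded_opsD[OF assms(1)] bounded_opsD[OF assms(2)] by simp
    fix x y z assume xy: "x \<in> V" "y \<in> V" and z: "z \<in> V"
    note v = bounded_opsD[OF assms(2) xy(1)] bounded_opsD[OF assms(2) xy(2)]
    show "ip (op_mult H T U (vadd H x y)) z = ip (op_mult H T U x) z + ip (op_mult H T U y) z"
      using xy v z bounded_ops_lin(1)[OF assms(2) xy] bounded_ops_lin(1)[OF assms(1) v] 
        bounded_opsD[OF assms(1) v(1)] bounded_opsD[OF assms(1) v(2)]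
      by (simp add: vadd_closed vinner_add)
  next
    fix x c z assume x: "x \<in> V" and z: "z \<in> V"
    note v = bounded_opsD[OF assms(2) x]
    show "ip (op_mult H T U (vscale H c x)) z = c * ip (op_mult H T U x) z"
      using x v z bounded_ops_lin(2)[OF assms(2) x] bounded_ops_lin(2)[OF assms(1) v] 
        bounded_opsD[OF assms(1) v] by (simp add: vscale_closed vinner_scale)
  qed
qed

lemmas bounded_simps = bounded_op_one bounded_op_add bounded_op_scale bounded_op_mult

section \<open>Adjoints\<close>

lemma is_adjointD:
  assumes "is_adjoint H T U"
  shows "U \<in> bounded_ops H"
    "x \<in> V \<Longrightarrow> y \<in> V \<Longrightarrow> ip (T x) y = ip x (U y)"
  using assms by (auto simp: is_adjoint_def)

lemma is_adjoint_sym: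
  assumes "is_adjoint H T U" "T \<in> bounded_ops H"
  shows "is_adjoint H U T"
  unfolding is_adjoint_def
proof (intro conjI ballI)
  fix x y assume xy: "x \<in> V" "y \<in> V"
  then show "ip (U x) y = ip x (T y)"
    using bounded_opsD[OF is_adjointD(1)[OF assms(1)]] is_adjointD(2)[OF assms(1), of y x] bounded_opsD[OF assms(2)]
      vinner_commute[of "U x" y] vinner_commute[of x "T y"] by simp
qed (fact assms(2))

text \<open>The rule \<open>adj\<close> of \<open>star_alg_gen\<close> admits any operator related
  by \<open>is_adjoint\<close>; uniqueness identifies it with an adjoint computed
  explicitly.\<close>

lemma is_adjoint_unique:
  assumes "is_adjoint H T U" "is_adjoint H T U'" "T \<in> bounded_ops H"
  shows "U = U'"
proof (rule op_ext)
  show "U \<in> bounded_ops H" "U' \<in> bounded_ops H"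
    using assms by (auto simp: is_adjoint_def)
  fix x y assume "x \<in> V" "y \<in> V"
  then show "ip (U x) y = ip (U' x) y"
    using is_adjointD(2)[OF is_adjoint_sym[OF assms(1,3)], of x y]
      is_adjointD(2)[OF is_adjoint_sym[OF assms(2,3)], of x y] by simp
qed

lemma is_adjoint_one: "is_adjoint H op_one op_one"
  unfolding is_adjoint_def
proof (intro conjI ballI)
  show "op_one \<in> bounded_ops H" by (fact bounded_op_one)
  fix x y assume "x \<in> V" "y \<in> V"
  then show "ip (op_one x) y = ip x (op_one y)" by (simp only: op_apply)
qed

lemma is_adjoint_add:
  assumes "is_adjoint H T T'" "is_adjoint H U U'" "T \<in> bounded_ops H" "U \<in> bounded_ops H"
  shows "is_adjoint H (op_add H T U) (op_add H T' U')"
  unfolding is_adjoint_def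
proof (intro conjI ballI)
  note b = is_adjointD(1)[OF assms(1)] is_adjointD(1)[OF assms(2)] assms(3,4)
  note v = b[THEN bounded_opsD]
  show "op_add H T' U' \<in> bounded_ops H" using b by (intro bounded_op_add)
  fix x y assume "x \<in> V" "y \<in> V"
  then show "ip (op_add H T U x) y = ip x (op_add H T' U' y)"
    using v is_adjointD(2)[OF assms(1), of x y] is_adjointD(2)[OF assms(2), of x y]
    by (simp add: vinner_simps)
qed

lemma is_adjoint_scale:
  assumes "is_adjoint H T T'" "T \<in> bounded_ops H"
  shows "is_adjoint H (op_scale H c T) (op_scale H (cnj c) T')"
  unfolding is_adjoint_def
proof (intro conjI ballI)
  note b = is_adjointD(1)[OF assms(1)] assms(2)
  note v = b[THEN bounded_opsD]
  show "op_scale H (cnj c) T' \<in> bounded_ops H" using b by (intro bounded_op_scale)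
  fix x y assume "x \<in> V" "y \<in> V"
  then show "ip (op_scale H c T x) y = ip x (op_scale H (cnj c) T' y)"
    using v is_adjointD(2)[OF assms(1), of x y] by (simp add: vinner_simps)
qed

lemma is_adjoint_mult:
  assumes "is_adjoint H T T'" "is_adjoint H U U'" "T \<in> bounded_ops H" "U \<in> bounded_ops H"
  shows "is_adjoint H (op_mult H T U) (op_mult H U' T')"
  unfolding is_adjoint_def
proof (intro conjI ballI)
  note b = is_adjointD(1)[OF assms(1)] is_adjointD(1)[OF assms(2)] assms(3,4)
  note v = b[THEN bounded_opsD]
  show "op_mult H U' T' \<in> bounded_ops H" by (rule bounded_op_mult[OF b(2,1)])
  fix x y assume "x \<in> V" "y \<in> V"
  then show "ip (op_mult H T U x) y = ip x (op_mult H U' T' y)"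
    by (simp add: v is_adjointD(2)[OF assms(1)] is_adjointD(2)[OF assms(2)])
qed

text \<open>Testing the identity at \<open>z\<close> bounds its squared norm by
  \<open>C * vnorm H z * vnorm H y\<close>. Only one pair \<open>y\<close>, \<open>z\<close> occurs,
  so the bound applies before an adjoint operator has been assembled from its values.\<close>

lemma adjoint_bound:
  assumes adj: "\<And>x. x \<in> V \<Longrightarrow> ip (T x) y = ip x z" and y: "y \<in> V" and z: "z \<in> V"
    and T: "T \<in> bounded_ops H" and C: "\<And>x. x \<in> V \<Longrightarrow> vnorm H (T x) \<le> C * vnorm H x"
  shows "vnorm H z \<le> C * vnorm H y"
proof (cases "vnorm H z = 0")
  case True
  have "0 \<le> C * vnorm H y"
    using C[OF y] vnorm_nonneg[OF bounded_opsD[OF T y]] by linarith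
  then show ?thesis using True by simp
next
  case False
  have "(vnorm H z)\<^sup>2 = cmod (ip (T z) y)"
    unfolding adj[OF z] vinner_self[OF z] by (simp add: norm_power)
  also have "\<dots> \<le> vnorm H (T z) * vnorm H y"
    by (intro Cauchy_Schwarz y bounded_opsD[OF T z])
  also have "\<dots> \<le> C * vnorm H z * vnorm H y"
    using C[OF z] vnorm_nonneg[OF y] by (rule mult_right_mono)
  finally have "vnorm H z * vnorm H z \<le> vnorm H z * (C * vnorm H y)"
    by (simp add: power2_eq_square mult_ac)
  then show ?thesis
    using False vnorm_nonneg[OF z] by (auto simp only: mult_le_cancel_left)
qed

text \<open>A pointwise form of closeness in norm, free of the infimum in
  \<open>op_norm\<close>.\<close>

definition op_close :: "real \<Rightarrow> ('h \<Rightarrow> 'h) \<Rightarrow> ('h \<Rightarrow> 'h) \<Rightarrow> bool" where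
  "op_close e T U \<longleftrightarrow> (\<forall>x\<in>V. vnorm H (vsub (T x) (U x)) \<le> e * vnorm H x)"

lemma op_close_weak:
  assumes "op_close e T U" "T \<in> bounded_ops H" "U \<in> bounded_ops H" "x \<in> V" "y \<in> V"
  shows "cmod (ip (T x) y - ip (U x) y) \<le> e * (vnorm H x * vnorm H y)"
proof -
  note v = bounded_opsD[OF assms(2,4)] bounded_opsD[OF assms(3,4)] assms(4,5)
  have "cmod (ip (T x) y - ip (U x) y) = cmod (ip (vsub (T x) (U x)) y)"
    using v by (simp add: vinner_simps)
  also have "\<dots> \<le> vnorm H (vsub (T x) (U x)) * vnorm H y"
    using v by (intro Cauchy_Schwarz) (auto simp: vinner_simps)
  also have "\<dots> \<le> e * vnorm H x * vnorm H y"
    using assms v by (intro mult_right_mono) (auto simp: op_close_def)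
  finally show ?thesis by (simp add: mult.assoc)
qed

lemma op_close_self: "T \<in> bounded_ops H \<Longrightarrow> 0 \<le> e \<Longrightarrow> op_close e T T"
  by (auto simp: op_close_def vnorm_def vinner_simps bounded_opsD vinner_nonneg)

lemma op_close_mult:
  assumes "op_close e T U" "0 \<le> e" "x \<in> bounded_ops H" "\<And>v. v \<in> V \<Longrightarrow> vnorm H (x v) \<le> C * vnorm H v"
  shows "op_close (e * C) (op_mult H T x) (op_mult H U x)"
  unfolding op_close_def
proof
  fix v assume v: "v \<in> V"
  have "vnorm H (vsub (T (x v)) (U (x v))) \<le> e * vnorm H (x v)"
    using assms(1) bounded_opsD[OF assms(3) v] by (simp add: op_close_def)
  also have "\<dots> \<le> e * (C * vnorm H v)" using assms(2,4) v by (intro mult_left_mono)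
  finally show "vnorm H (vsub (op_mult H T x v) (op_mult H U x v)) \<le> e * C * vnorm H v"
    using v by (simp add: mult.assoc)
qed

lemma op_norm_less:
  assumes "T \<in> bounded_ops H" "op_norm H T < e"
  obtains C where "0 \<le> C" "C < e" "\<And>x. x \<in> V \<Longrightarrow> vnorm H (T x) \<le> C * vnorm H x"
proof -
  obtain C where "C > 0" "\<And>x. x \<in> V \<Longrightarrow> vnorm H (T x) \<le> C * vnorm H x"
    using assms bounded_ops_bound by metis
  then have "{C. 0 \<le> C \<and> (\<forall>x\<in>V. vnorm H (T x) \<le> C * vnorm H x)} \<noteq> {}"
    by (auto intro!: exI[of _ C])
  from cInf_lessD[OF this, of e] assms(2) obtain D where
    "D \<ge> 0" "\<forall>x\<in>V. vnorm H (T x) \<le> D * vnorm H x" "D < e"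
    unfolding op_norm_def by blast
  then show thesis
    using that by blast
qed

lemma op_norm_le:
  "0 \<le> C \<Longrightarrow> (\<And>x. x \<in> V \<Longrightarrow> vnorm H (T x) \<le> C * vnorm H x) \<Longrightarrow> op_norm H T \<le> C"
  unfolding op_norm_def by (rule cInf_lower) (auto intro!: bdd_belowI[of _ 0])

section \<open>Positive operators and positive matrices\<close>

text \<open>The quadratic form at \<open>v\<close> is the squared norm of the sum of the vectors
  \<open>a j (v j)\<close>.\<close>

lemma positive_matrix_gram:
  assumes "\<And>i. i < n \<Longrightarrow> a i \<in> bounded_ops H" "\<And>i. i < n \<Longrightarrow> is_adjoint H (a i) (a' i)"
  shows "positive_matrix H n (\<lambda>i j. op_mult H (a' i) (a j))"
  unfolding positive_matrix_def
proof (intro allI impI)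
  fix v assume v: "\<forall>i<n. v i \<in> V"
  have av: "a i x \<in> V" if "i < n" "x \<in> V" for i x
    using bounded_opsD[OF assms(1)] that by blast
  \<comment> \<open>The interface names no zero vector, so the sum is built up from its first
    summand and described by its inner products; hence the separate case
    \<open>n = 0\<close>.\<close>
  have "\<exists>w. w \<in> V \<and> (\<forall>z\<in>V. ip w z = (\<Sum>j<m. ip (a j (v j)) z))"
    if "0 < m" "m \<le> n" for m
    using that
  proof (induction m)
    case (Suc m)
    show ?case
    proof (cases "m = 0")
      case True
      then show ?thesis using Suc.prems v assms by (intro exI[of _ "a 0 (v 0)"]) (auto simp: av)
    next
      case False
      then obtain w where "w \<in> V" "\<forall>z\<in>V. ip w z = (\<Sum>j<m. ip (a j (v j)) z)"
        using Suc by auto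
      then show ?thesis
        using Suc.prems v by (intro exI[of _ "vadd H w (a m (v m))"]) (auto simp: vinner_simps av)
    qed
  qed simp
  then consider "n = 0" | w where "w \<in> V"
    "\<forall>z\<in>V. ip w z = (\<Sum>j<n. ip (a j (v j)) z)"
    by (metis gr0I order_refl)
  then show "(\<Sum>i<n. \<Sum>j<n. ip (op_mult H (a' i) (a j) (v j)) (v i)) \<in> \<real>\<^sub>\<ge>\<^sub>0"
  proof cases
    case (2 w)
    have "(\<Sum>i<n. \<Sum>j<n. ip (op_mult H (a' i) (a j) (v j)) (v i)) =
      (\<Sum>i<n. \<Sum>j<n. ip (a j (v j)) (a i (v i)))"
      using v is_adjointD(2)[OF is_adjoint_sym[OF assms(2,1)]] by (intro sum.cong refl) (auto simp: av)
    also have "\<dots> = (\<Sum>i<n. ip w (a i (v i)))"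
      using 2 v by (intro sum.cong refl) (auto simp: av)
    also have "\<dots> = (\<Sum>i<n. cnj (ip (a i (v i)) w))"
      using 2 v by (intro sum.cong refl vinner_commute) (auto simp: av)
    also have "\<dots> = ip w w"
      using 2(1) 2(2)[rule_format, OF 2(1)] vinner_commute[of w w] by simp
    finally show ?thesis
      using vinner_self[OF 2(1)] by (simp add: complex_nonneg_Reals_iff del: of_real_power)
  qed simp
qed

lemma positive_matrix_1:
  "positive_matrix H 1 (\<lambda>i j. T) \<longleftrightarrow> (\<forall>v\<in>V. ip (T v) v \<in> \<real>\<^sub>\<ge>\<^sub>0)"
  unfolding positive_matrix_def proof (intro iffI allI impI ballI)
  fix v assume *: "\<forall>v. (\<forall>i<1. v i \<in> V) \<longrightarrow> (\<Sum>i<1::nat. \<Sum>j<1::nat. ip (T (v j)) (v i)) \<in> \<real>\<^sub>\<ge>\<^sub>0"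
    and "v \<in> V"
  then show "ip (T v) v \<in> \<real>\<^sub>\<ge>\<^sub>0"
    using spec[OF *, of "\<lambda>_. v"] by simp
qed simp

lemma positive_op_expand:
  assumes T: "T \<in> bounded_ops H" and x: "x \<in> V" and y: "y \<in> V"
  shows "ip (T (vadd H x (vscale H a y))) (vadd H x (vscale H a y)) =
    ip (T x) x + (a * ip (T y) x + cnj a * ip (T x) y
      + of_real ((cmod a)\<^sup>2) * ip (T y) y)"
  using x y by (simp add: bounded_ops_lin[OF T] bounded_opsD[OF T] vinner_simps complex_norm_square algebra_simps del: of_real_power)

text \<open>In the expansion of the form along \<open>x + a y\<close> the constant term is gone, so
  the linear coefficients must vanish. As \<open>y\<close> is arbitrary, a zero of the form is
  annihilated by \<open>T\<close>.\<close>

lemma positive_op_zero: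
  assumes T: "T \<in> bounded_ops H" and pos: "\<And>v. v \<in> V \<Longrightarrow> ip (T v) v \<in> \<real>\<^sub>\<ge>\<^sub>0"
    and x: "x \<in> V" and zero: "ip (T x) x = 0" and y: "y \<in> V"
  shows "ip (T x) y = 0"
proof (rule complex_quadratic_nonneg_imp_zero(2))
  fix a
  show "a * ip (T y) x + cnj a * ip (T x) y + of_real ((cmod a)\<^sup>2) * ip (T y) y \<in> \<real>\<^sub>\<ge>\<^sub>0"
    using pos[of "vadd H x (vscale H a y)"] positive_op_expand[OF T x y, of a] zero x y
    by (simp add: vinner_simps)
qed

text \<open>Polarisation: the cross terms are real for \<open>a = 1\<close> and
  \<open>a = \<i>\<close>, which makes them conjugate to each other.\<close>

lemma positive_op_hermitian:
  assumes T: "T \<in> bounded_ops H" and pos: "\<And>v. v \<in> V \<Longrightarrow> ip (T v) v \<in> \<real>\<^sub>\<ge>\<^sub>0"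
    and x: "x \<in> V" and y: "y \<in> V"
  shows "ip (T x) y = ip x (T y)"
proof -
  define z w where "z = ip (T y) x" and "w = ip (T x) y"
  have "Im (a * z + cnj a * w) = 0" for a
    using pos[of "vadd H x (vscale H a y)"] positive_op_expand[OF T x y, of a] pos[OF x] pos[OF y] x y
    by (simp add: vinner_simps complex_nonneg_Reals_iff z_def w_def)
  from this[of 1] this[of \<i>] have "w = cnj z"
    by (simp add: complex_eq_iff)
  then show ?thesis
    using vinner_commute[of "T y" x] x y bounded_opsD[OF T] by (simp add: z_def w_def)
qed

end

text \<open>The axioms of \<open>hilbert\<close> do not state that bounded operators have adjoints,
  so closure under adjoints is imposed on the generators and inherited by the algebra. The codomain
  \<open>B\<close> is any set of bounded operators; later it is the von Neumann algebra.\<close>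

locale unital_cp = hilbert H for H :: "('h, 'm) ip_space_scheme" +
  fixes A0 B :: "('h \<Rightarrow> 'h) set" and \<theta> :: "('h \<Rightarrow> 'h) \<Rightarrow> ('h \<Rightarrow> 'h)"
  assumes gens_bounded: "A0 \<subseteq> bounded_ops H"
    and gens_adjoint: "T \<in> A0 \<Longrightarrow> \<exists>T'\<in>A0. is_adjoint H T T'"
    and one_gen: "op_one \<in> A0"
    and range_bounded: "B \<subseteq> bounded_ops H"
    and cp: "completely_positive H (cstar_gen H A0) B \<theta>"
    and unital: "\<theta> op_one = op_one"
begin

section \<open>The generated star algebra and its norm closure\<close>

abbreviation "SA \<equiv> star_alg_gen H A0"
abbreviation "CA \<equiv> cstar_gen H A0"

lemmas SA_intros = star_alg_gen.add star_alg_gen.scale star_alg_gen.mult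

lemma SA_bounded: "T \<in> SA \<Longrightarrow> T \<in> bounded_ops H"
proof (induction rule: star_alg_gen.induct)
  case (adj T U)
  then show ?case by (simp add: is_adjoint_def)
qed (use gens_bounded in \<open>auto simp: bounded_simps\<close>)

lemma SA_adjoint: "T \<in> SA \<Longrightarrow> \<exists>T'\<in>SA. is_adjoint H T T'"
proof (induction rule: star_alg_gen.induct)
  case (gen T)
  then show ?case using gens_adjoint star_alg_gen.gen by blast
next
  case (adj T U)
  then show ?case using is_adjoint_sym SA_bounded by blast
qed (blast intro: is_adjoint_add is_adjoint_scale is_adjoint_mult SA_bounded star_alg_gen.intros)+

lemma one_SA: "op_one \<in> SA"
  using one_gen by (rule star_alg_gen.gen)

lemma CA_bounded: "T \<in> CA \<Longrightarrow> T \<in> bounded_ops H"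
  by (simp add: cstar_gen_def)

lemma CA_approx:
  assumes "T \<in> CA" "e > 0"
  obtains U where "U \<in> SA" "op_close e T U"
proof -
  from assms obtain U where U: "U \<in> SA" "op_norm H (op_add H T (op_scale H (-1) U)) < e"
    by (auto simp: cstar_gen_def)
  have "op_add H T (op_scale H (-1) U) \<in> bounded_ops H"
    using U(1) assms by (simp add: bounded_simps SA_bounded CA_bounded)
  then obtain C where C: "C < e" "\<And>x. x \<in> V \<Longrightarrow> vnorm H (op_add H T (op_scale H (-1) U) x) \<le> C * vnorm H x"
    using op_norm_less U(2) by metis
  have "op_close e T U"
    unfolding op_close_def
  proof
    fix x assume x: "x \<in> V"
    have "vnorm H (vsub (T x) (U x)) \<le> C * vnorm H x"
      using C(2)[OF x] x by simp
    also have "\<dots> \<le> e * vnorm H x"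
      using C(1) x by (intro mult_right_mono) auto
    finally show "vnorm H (vsub (T x) (U x)) \<le> e * vnorm H x" .
  qed
  with U(1) show thesis by (rule that)
qed

lemma CA_I:
  assumes T: "T \<in> bounded_ops H" and approx: "\<And>e. e > 0 \<Longrightarrow> \<exists>U\<in>SA. op_close e T U"
  shows "T \<in> CA"
  unfolding cstar_gen_def
proof (intro CollectI conjI allI impI)
  fix e :: real assume "e > 0"
  then obtain U where U: "U \<in> SA" "op_close (e / 2) T U"
    using approx[of "e / 2"] by auto
  have "op_norm H (op_add H T (op_scale H (-1) U)) \<le> e / 2"
    using U \<open>e > 0\<close> by (intro op_norm_le) (auto simp: op_close_def)
  with \<open>e > 0\<close> have "op_norm H (op_add H T (op_scale H (-1) U)) < e" by simp
  then show "\<exists>U\<in>SA. op_norm H (op_add H T (op_scale H (- 1) U)) < e"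
    using U(1) by blast
qed (fact T)

lemma SA_CA: "T \<in> SA \<Longrightarrow> T \<in> CA"
  by (rule CA_I) (auto intro!: bexI[of _ T] op_close_self SA_bounded)

lemma diff_CA:
  assumes "T \<in> CA" "U \<in> SA"
  shows "op_add H T (op_scale H (-1) U) \<in> CA"
proof (rule CA_I)
  show "op_add H T (op_scale H (-1) U) \<in> bounded_ops H"
    using assms by (simp add: bounded_simps SA_bounded CA_bounded)
next
  fix e :: real assume "e > 0"
  with assms(1) obtain W where W: "W \<in> SA" "op_close e T W"
    using CA_approx by metis
  have "vsub (op_add H T (op_scale H (-1) U) x) (op_add H W (op_scale H (-1) U) x) = vsub (T x) (W x)"
    if "x \<in> V" for x
    using that assms W(1)
    by (intro vinner_ext) (auto simp: vinner_simps SA_bounded[THEN bounded_opsD] CA_bounded[THEN bounded_opsD])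
  with W show "\<exists>R\<in>SA. op_close e (op_add H T (op_scale H (-1) U)) R"
    using assms(2) by (intro bexI[of _ "op_add H W (op_scale H (-1) U)"] SA_intros) (auto simp: op_close_def)
qed

text \<open>For approximants with errors \<open>(1/2) ^ n\<close>, the values of their adjoints at a
  fixed vector form a sequence to which \<open>weak_limit\<close> applies, and the limits define the
  adjoint of \<open>T\<close>. It stays in the closure because passing to adjoints preserves norm
  bounds.\<close>

lemma CA_adjoint:
  assumes T: "T \<in> CA"
  shows "\<exists>T'\<in>CA. is_adjoint H T T'"
proof -
  have Tb: "T \<in> bounded_ops H" using T by (rule CA_bounded)
  obtain CT where CT: "\<And>x. x \<in> V \<Longrightarrow> vnorm H (T x) \<le> CT * vnorm H x"
    using bounded_ops_bound[OF Tb] by metis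
  have "\<exists>U. U \<in> SA \<and> op_close ((1/2) ^ n) T U" for n
    using CA_approx[OF T, of "(1/2) ^ n"] by (metis half_gt_zero_iff zero_less_one zero_less_power)
  then obtain U where U: "\<And>n. U n \<in> SA" "\<And>n. op_close ((1/2) ^ n) T (U n)"
    by metis
  obtain U' where U': "\<And>n. U' n \<in> SA" "\<And>n. is_adjoint H (U n) (U' n)"
    using SA_adjoint[OF U(1)] by metis
  note bd = SA_bounded[OF U(1)] SA_bounded[OF U'(1)] Tb
  note bv = bd[THEN bounded_opsD]
  have lim: "(\<lambda>n. ip (U n x) y) \<longlonglongrightarrow> ip (T x) y" if xy: "x \<in> V" "y \<in> V" for x y
  proof (rule Lim_transform2[OF tendsto_const])
    show "(\<lambda>n. ip (T x) y - ip (U n x) y) \<longlonglongrightarrow> 0"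
    proof (rule Lim_null_comparison)
      show "\<forall>\<^sub>F n in sequentially. cmod (ip (T x) y - ip (U n x) y) \<le> (1/2) ^ n * (vnorm H x * vnorm H y)"
        by (intro always_eventually allI op_close_weak U bd xy)
      show "(\<lambda>n. (1 / 2) ^ n * (vnorm H x * vnorm H y)) \<longlonglongrightarrow> 0"
        by (intro tendsto_mult_left_zero LIMSEQ_power_zero) auto
    qed
  qed
  have "\<exists>w\<in>V. \<forall>x\<in>V. ip (T x) y = ip x w" if y: "y \<in> V" for y
  proof -
    have "\<exists>w\<in>V. \<forall>x\<in>V. (\<lambda>n. ip x (U' n y)) \<longlonglongrightarrow> ip x w"
    proof (rule weak_limit)
      show "U' n y \<in> V" for n using bv y by auto
      fix n
      let ?D = "op_add H (U (Suc n)) (op_scale H (-1) (U n))"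
      let ?D' = "op_add H (U' (Suc n)) (op_scale H (cnj (-1)) (U' n))"
      have adj: "is_adjoint H ?D ?D'"
        by (intro is_adjoint_add is_adjoint_scale U' bd bounded_simps)
      \<comment> \<open>The factor 2 covers the two errors \<open>(1/2) ^ n\<close> and
        \<open>(1/2) ^ Suc n\<close>.\<close>
      have "vnorm H (?D' y) \<le> (2 * (1/2) ^ n) * vnorm H y"
      proof (rule adjoint_bound[OF is_adjointD(2)[OF adj _ y] y bounded_opsD[OF is_adjointD(1)[OF adj] y]])
        show "?D \<in> bounded_ops H" by (intro bd bounded_simps)
        fix x assume x: "x \<in> V"
        have "?D x = vsub (vsub (T x) (U n x)) (vsub (T x) (U (Suc n) x))"
          using x bv by (intro vinner_ext) (auto simp: vinner_simps)
        also have "vnorm H \<dots> \<le> vnorm H (vsub (T x) (U n x)) + vnorm H (vscale H (-1) (vsub (T x) (U (Suc n) x)))"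
          using x bv by (intro vnorm_add) (auto simp: vinner_simps)
        also have "\<dots> \<le> (1/2) ^ n * vnorm H x + (1/2) ^ (Suc n) * vnorm H x"
          using U(2)[unfolded op_close_def, rule_format, OF x] x bv
          by (intro add_mono) (auto simp: vnorm_scale vinner_simps simp del: power_Suc)
        also have "\<dots> \<le> (2 * (1/2) ^ n) * vnorm H x"
          using x by (simp add: algebra_simps)
        finally show "vnorm H (?D x) \<le> (2 * (1/2) ^ n) * vnorm H x" .
      qed
      then show "vnorm H (vsub (U' (Suc n) y) (U' n y)) \<le> 2 * vnorm H y * (1/2) ^ n"
        using y by (simp add: algebra_simps)
    qed
    then obtain w where w: "w \<in> V" "\<And>x. x \<in> V \<Longrightarrow> (\<lambda>n. ip x (U' n y)) \<longlonglongrightarrow> ip x w"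
      by blast
    have "ip (T x) y = ip x w" if x: "x \<in> V" for x
      using LIMSEQ_unique[OF lim[OF x y]] w(2)[OF x] is_adjointD(2)[OF U'(2) x y] by simp
    with w(1) show ?thesis by blast
  qed
  then obtain W where W: "\<And>y. y \<in> V \<Longrightarrow> W y \<in> V"
    "\<And>x y. x \<in> V \<Longrightarrow> y \<in> V \<Longrightarrow> ip (T x) y = ip x (W y)"
    by metis
  define T' where "T' = restrict W V"
  have T'v: "y \<in> V \<Longrightarrow> T' y \<in> V" for y using W by (simp add: T'_def)
  have T'i: "ip (T' y) x = cnj (ip (T x) y)" if "x \<in> V" "y \<in> V" for x y
    using W that vinner_commute[of x "W y"] by (simp add: T'_def)
  have T'b: "T' \<in> bounded_ops H"
  proof (rule bounded_opsI[where C = CT])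
    show "vnorm H (T' y) \<le> CT * vnorm H y" if y: "y \<in> V" for y
      using y W CT by (intro adjoint_bound[of T y "T' y"] Tb) (auto simp: T'_def)
  qed (auto simp: T'i T'v vinner_simps bounded_opsD[OF Tb], auto simp: T'_def)
  have adj: "is_adjoint H T T'"
    unfolding is_adjoint_def using T'b W by (auto simp: T'_def)
  have "T' \<in> CA"
  proof (rule CA_I[OF T'b])
    fix e :: real assume "e > 0"
    then obtain Z where Z: "Z \<in> SA" "op_close e T Z"
      using CA_approx[OF T] by metis
    obtain Z' where Z': "Z' \<in> SA" "is_adjoint H Z Z'" using SA_adjoint[OF Z(1)] by blast
    let ?D = "op_add H T (op_scale H (-1) Z)" and ?D' = "op_add H T' (op_scale H (cnj (-1)) Z')"
    have D: "?D \<in> bounded_ops H" by (intro Tb bounded_simps SA_bounded Z)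
    have "is_adjoint H ?D ?D'"
      by (intro is_adjoint_add is_adjoint_scale adj Z' Tb bounded_simps SA_bounded Z)
    note adjD = is_adjointD[OF this]
    have "vnorm H (?D' x) \<le> e * vnorm H x" if x: "x \<in> V" for x
      using Z(2) by (intro adjoint_bound[OF adjD(2)[OF _ x] x bounded_opsD[OF adjD(1) x] D]) (auto simp: op_close_def)
    then show "\<exists>U\<in>SA. op_close e T' U"
      using Z'(1) by (intro bexI[of _ Z']) (auto simp: op_close_def)
  qed
  with adj show ?thesis by blast
qed

section \<open>Consequences of complete positivity\<close>

lemma \<theta>_bounded: "T \<in> CA \<Longrightarrow> \<theta> T \<in> bounded_ops H"
  using cp range_bounded by (auto simp: completely_positive_def)

lemma \<theta>_range: "T \<in> CA \<Longrightarrow> \<theta> T \<in> B"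
  using cp by (auto simp: completely_positive_def)

lemma \<theta>_add: "T \<in> CA \<Longrightarrow> U \<in> CA \<Longrightarrow> \<theta> (op_add H T U) = op_add H (\<theta> T) (\<theta> U)"
  using cp by (auto simp: completely_positive_def)

lemma \<theta>_scale: "T \<in> CA \<Longrightarrow> \<theta> (op_scale H c T) = op_scale H c (\<theta> T)"
  using cp by (auto simp: completely_positive_def)

lemma \<theta>_positive:
  "(\<And>i j. i < n \<Longrightarrow> j < n \<Longrightarrow> a i j \<in> CA) \<Longrightarrow> positive_matrix H n a \<Longrightarrow>
    positive_matrix H n (\<lambda>i j. \<theta> (a i j))"
  using cp by (auto simp: completely_positive_def)

lemma \<theta>_gram:
  assumes "\<And>i. i < n \<Longrightarrow> a i \<in> SA" "\<And>i. i < n \<Longrightarrow> is_adjoint H (a i) (a' i)"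
  shows "positive_matrix H n (\<lambda>i j. \<theta> (op_mult H (a' i) (a j)))"
  using assms by (intro \<theta>_positive positive_matrix_gram SA_CA star_alg_gen.mult)
    (auto intro: star_alg_gen.adj SA_bounded)

lemma \<theta>_positive_op:
  assumes "T \<in> SA" "is_adjoint H T T'" "v \<in> V"
  shows "ip (\<theta> (op_mult H T' T) v) v \<in> \<real>\<^sub>\<ge>\<^sub>0"
  using \<theta>_gram[of 1 "\<lambda>_. T" "\<lambda>_. T'"] assms by (simp add: positive_matrix_1[simplified])

text \<open>The multiplicative domain argument, applied to the Gram matrix of \<open>(a\<^sup>*, 1, x)\<close>:
  the quadratic form of its image vanishes on the vectors \<open>(v, -a\<^sup>* v, 0)\<close>.\<close>

lemma \<theta>_mult_aux:
  assumes a: "a \<in> SA" "is_adjoint H a a'" and x: "x \<in> SA" "is_adjoint H x x'"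
    and fixed: "\<theta> a = a" "\<theta> a' = a'" "\<theta> (op_mult H a a') = op_mult H a a'"
  shows "\<theta> (op_mult H a x) = op_mult H a (\<theta> x)" and "\<theta> (op_mult H x' a') = op_mult H (\<theta> x') a'"
proof -
  have x': "x' \<in> SA" using x by (rule star_alg_gen.adj)
  have a': "a' \<in> SA" using a by (rule star_alg_gen.adj)
  have adj': "is_adjoint H a' a" by (rule is_adjoint_sym[OF a(2) SA_bounded[OF a(1)]])
  note bd = SA_bounded[OF a(1)] SA_bounded[OF a'] SA_bounded[OF x(1)] SA_bounded[OF x']
  note bv = bd[THEN bounded_opsD]
  have one: "op_mult H T op_one = T" "op_mult H op_one T = T" if "T \<in> bounded_ops H" for T
    using that bounded_opsD[OF that] by (auto intro!: op_ext bounded_simps)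
  have th: "\<theta> T \<in> bounded_ops H" if "T \<in> SA" for T using that by (intro \<theta>_bounded SA_CA)
  define b b' where "b = (\<lambda>i::nat. if i = 0 then a' else if i = 1 then op_one else x)"
    and "b' = (\<lambda>i::nat. if i = 0 then a else if i = 1 then op_one else x')"
  have pos: "positive_matrix H 3 (\<lambda>i j. \<theta> (op_mult H (b' i) (b j)))"
    by (rule \<theta>_gram) (auto simp: b_def b'_def a' x one_SA adj' is_adjoint_one)
  have quad: "c * (ip (\<theta> (op_mult H a x) v) w + ip (\<theta> x v) (vscale H (-1) (a' w)))
      + cnj c * (ip (\<theta> (op_mult H x' a') w) v + ip (\<theta> x' (vscale H (-1) (a' w))) v)
      + of_real ((cmod c)\<^sup>2) * ip (\<theta> (op_mult H x' x) v) v \<in> \<real>\<^sub>\<ge>\<^sub>0"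
    if v: "v \<in> V" and w: "w \<in> V" for v w c
  proof -
    \<comment> \<open>The null vector \<open>(w, -a' w, 0)\<close> is displaced by
      \<open>c v\<close> in the last slot. The constant term cancels by the hypotheses
      \<open>fixed\<close>, and the linear coefficients of the remaining quadratic in
      \<open>c\<close> hold the two claims.\<close>
    let ?u = "\<lambda>i::nat. if i = 0 then w else if i = 1 then vscale H (-1) (a' w) else vscale H c v"
    have "(\<Sum>i<3. \<Sum>j<3. ip (\<theta> (op_mult H (b' i) (b j)) (?u j)) (?u i)) \<in> \<real>\<^sub>\<ge>\<^sub>0"
      using pos v w bv unfolding positive_matrix_def by (auto simp: vinner_simps)
    moreover have "(\<Sum>i<3. \<Sum>j<3. ip (\<theta> (op_mult H (b' i) (b j)) (?u j)) (?u i)) =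
      c * (ip (\<theta> (op_mult H a x) v) w + ip (\<theta> x v) (vscale H (-1) (a' w)))
      + cnj c * (ip (\<theta> (op_mult H x' a') w) v + ip (\<theta> x' (vscale H (-1) (a' w))) v)
      + of_real ((cmod c)\<^sup>2) * ip (\<theta> (op_mult H x' x) v) v"
    proof -
      have thb: "\<theta> (op_mult H a x) \<in> bounded_ops H" "\<theta> x \<in> bounded_ops H" "\<theta> (op_mult H x' a') \<in> bounded_ops H"
        "\<theta> x' \<in> bounded_ops H" "\<theta> (op_mult H x' x) \<in> bounded_ops H"
        using a a' x x' by (auto intro!: th star_alg_gen.mult)
      note thl = thb[THEN bounded_opsD] thb[THEN bounded_ops_lin(1)] thb[THEN bounded_ops_lin(2)]
        bd[THEN bounded_ops_lin(1)] bd[THEN bounded_ops_lin(2)]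
      have "ip (a (a' w)) w = ip (a' w) (a' w)"
        using is_adjointD(2)[OF a(2)] w bv by auto
      moreover have "ip (a' w) (a' w) = ip w (a (a' w))"
        using is_adjointD(2)[OF adj'] w bv by auto
      ultimately show ?thesis
        using v w bv by (simp add: numeral_3_eq_3 b_def b'_def one bd fixed unital bounded_simps
          thl vinner_simps complex_norm_square algebra_simps del: of_real_power)
    qed
    ultimately show ?thesis by simp
  qed
  note zero = complex_quadratic_nonneg_imp_zero[OF quad]
  show "\<theta> (op_mult H a x) = op_mult H a (\<theta> x)"
  proof (rule op_ext)
    show "\<theta> (op_mult H a x) \<in> bounded_ops H" "op_mult H a (\<theta> x) \<in> bounded_ops H"
      using a x by (auto intro!: th star_alg_gen.mult bounded_simps bd)
    fix v w assume "v \<in> V" "w \<in> V"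
    then show "ip (\<theta> (op_mult H a x) v) w = ip (op_mult H a (\<theta> x) v) w"
      using zero(1)[of v w] is_adjointD(2)[OF a(2)] bounded_opsD[OF th[OF x(1)]] bv by (simp add: vinner_simps)
  qed
  show "\<theta> (op_mult H x' a') = op_mult H (\<theta> x') a'"
  proof (rule op_ext)
    show "\<theta> (op_mult H x' a') \<in> bounded_ops H" "op_mult H (\<theta> x') a' \<in> bounded_ops H"
      using a' x' by (auto intro!: th star_alg_gen.mult bounded_simps bd)
    fix w v assume "w \<in> V" "v \<in> V"
    then show "ip (\<theta> (op_mult H x' a') w) v = ip (op_mult H (\<theta> x') a' w) v"
      using zero(2)[of v w] bounded_opsD[OF th[OF x']] bounded_ops_lin(2)[OF th[OF x']] bv
      by (simp add: vinner_simps)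
  qed
qed

lemma \<theta>_mult_left:
  assumes "a \<in> SA" "is_adjoint H a a'" "x \<in> SA"
    "\<theta> a = a" "\<theta> a' = a'" "\<theta> (op_mult H a a') = op_mult H a a'"
  shows "\<theta> (op_mult H a x) = op_mult H a (\<theta> x)"
  using SA_adjoint[OF assms(3)] \<theta>_mult_aux(1)[OF assms(1-3) _ assms(4-6)] by blast

text \<open>This is the second conclusion of \<open>\<theta>_mult_aux\<close> after exchanging
  \<open>a\<close> with \<open>a'\<close> and \<open>x\<close> with its adjoint.\<close>

lemma \<theta>_mult_right:
  assumes a: "a \<in> SA" "is_adjoint H a a'" and x: "x \<in> SA"
    and fixed: "\<theta> a = a" "\<theta> a' = a'" "\<theta> (op_mult H a' a) = op_mult H a' a"
  shows "\<theta> (op_mult H x a) = op_mult H (\<theta> x) a"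
proof -
  obtain x' where x': "x' \<in> SA" "is_adjoint H x x'" using SA_adjoint[OF x] by blast
  show ?thesis
    by (rule \<theta>_mult_aux(2)[OF star_alg_gen.adj[OF a] is_adjoint_sym[OF a(2) SA_bounded[OF a(1)]]
          x'(1) is_adjoint_sym[OF x'(2) SA_bounded[OF x]] fixed(2,1,3)])
qed

text \<open>If \<open>D\<close> is bounded by \<open>c\<close>, the 2 by 2 matrix with diagonal
  \<open>c\<close> and off-diagonal entries \<open>D\<close> and its adjoint is positive, hence so
  is its image. This is the source of continuity of \<theta>.\<close>

lemma \<theta>_weakly_bounded:
  assumes D: "D \<in> CA" and bound: "\<And>x. x \<in> V \<Longrightarrow> vnorm H (D x) \<le> c * vnorm H x"
    and c: "c \<ge> 0" and v: "v \<in> V" and w: "w \<in> V"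
  shows "cmod (ip (\<theta> D v) w) \<le> c * ((vnorm H v)\<^sup>2 + (vnorm H w)\<^sup>2)"
proof -
  obtain D' where D': "D' \<in> CA" "is_adjoint H D D'" using CA_adjoint[OF D] by blast
  note bd = CA_bounded[OF D] CA_bounded[OF D'(1)]
  note bv = bd[THEN bounded_opsD]
  define K where "K = op_scale H (of_real c) op_one"
  have K: "K \<in> SA" unfolding K_def by (intro star_alg_gen.scale one_SA)
  have Kx: "K x = vscale H (of_real c) x" if "x \<in> V" for x
    using that by (simp add: K_def)
  have \<theta>K: "\<theta> K = K" unfolding K_def by (simp add: \<theta>_scale one_SA SA_CA unital)
  define a where "a = (\<lambda>i j::nat. if i = j then K else if i = 0 then D else D')"
  have pos: "positive_matrix H 2 a"
    unfolding positive_matrix_def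
  proof (intro allI impI)
    fix u :: "nat \<Rightarrow> 'h" assume u: "\<forall>i<2. u i \<in> V"
    then have u0: "u 0 \<in> V" and u1: "u (Suc 0) \<in> V" by auto
    define p q where "p = vnorm H (u 0)" and "q = vnorm H (u (Suc 0))"
    have "ip (D' (u 0)) (u (Suc 0)) = cnj (ip (u (Suc 0)) (D' (u 0)))"
      using u0 u1 bv by (intro vinner_commute) auto
    then have eq: "(\<Sum>i<2. \<Sum>j<2. ip (a i j (u j)) (u i)) =
      of_real (c * p\<^sup>2 + c * q\<^sup>2 + 2 * Re (ip (D (u (Suc 0))) (u 0)))"
      using u0 u1 bv is_adjointD(2)[OF D'(2), of "u (Suc 0)" "u 0"]
      by (simp add: numeral_2_eq_2 a_def Kx vinner_simps vinner_self p_def q_def complex_eq_iff)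
    have "- Re (ip (D (u (Suc 0))) (u 0)) \<le> cmod (ip (D (u (Suc 0))) (u 0))"
      using abs_Re_le_cmod abs_le_D2 by blast
    also have "\<dots> \<le> vnorm H (D (u (Suc 0))) * p"
      unfolding p_def using u0 u1 bv by (intro Cauchy_Schwarz) auto
    also have "\<dots> \<le> c * q * p"
      unfolding p_def q_def using u0 u1 bound by (intro mult_right_mono) auto
    finally have "c * p\<^sup>2 + c * q\<^sup>2 + 2 * Re (ip (D (u (Suc 0))) (u 0)) \<ge> c * (p - q)\<^sup>2"
      by (simp add: power2_diff algebra_simps)
    moreover have "c * (p - q)\<^sup>2 \<ge> 0" using c by simp
    ultimately show "(\<Sum>i<2. \<Sum>j<2. ip (a i j (u j)) (u i)) \<in> \<real>\<^sub>\<ge>\<^sub>0"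
      unfolding eq nonneg_Reals_of_real_iff by linarith
  qed
  have pos': "positive_matrix H 2 (\<lambda>i j. \<theta> (a i j))"
    using pos D D' K by (intro \<theta>_positive) (auto simp: a_def SA_CA)
  define z z' where "z = ip (\<theta> D v) w" and "z' = ip (\<theta> D' w) v"
  define M where "M = c * ((vnorm H v)\<^sup>2 + (vnorm H w)\<^sup>2)"
  \<comment> \<open>The phase \<open>g\<close> separates the two off-diagonal terms:
    \<open>1\<close> and \<open>-1\<close> together with \<open>\<i>\<close> and
    \<open>-\<i>\<close> determine real and imaginary part of \<open>z\<close> from bounded
    quantities.\<close>
  have q: "of_real M + cnj g * z + g * z' \<in> \<real>\<^sub>\<ge>\<^sub>0" if g: "cmod g = 1" for g
  proof -
    let ?u = "\<lambda>i::nat. if i = 0 then vscale H g w else v"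
    have "g * cnj g = 1"
      using g complex_norm_square[of g] by simp
    then have gg: "g * (cnj g * r) = r" for r by (metis mult.assoc mult_1)
    have "(\<Sum>i<2. \<Sum>j<2. ip (\<theta> (a i j) (?u j)) (?u i)) \<in> \<real>\<^sub>\<ge>\<^sub>0"
      using pos' v w unfolding positive_matrix_def by (auto simp: vinner_simps)
    moreover have "(\<Sum>i<2. \<Sum>j<2. ip (\<theta> (a i j) (?u j)) (?u i)) = of_real M + cnj g * z + g * z'"
      using v w \<theta>_bounded[OF D, THEN bounded_opsD] \<theta>_bounded[OF D'(1), THEN bounded_opsD]
      by (simp add: numeral_2_eq_2 a_def \<theta>K Kx \<theta>_bounded[OF D, THEN bounded_ops_lin(2)]
          \<theta>_bounded[OF D'(1), THEN bounded_ops_lin(2)] vinner_simps vinner_self z_def z'_def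
          M_def algebra_simps gg)
    ultimately show ?thesis by simp
  qed
  have 1: "\<bar>Re (z + z')\<bar> \<le> M" "Im (z + z') = 0"
    using q[of 1] q[of "-1"] by (auto simp: complex_nonneg_Reals_iff)
  have 2: "\<bar>Im (z - z')\<bar> \<le> M" "Re (z - z') = 0"
    using q[of \<i>] q[of "-\<i>"] by (auto simp: complex_nonneg_Reals_iff)
  have "z = (of_real (Re (z + z')) + \<i> * of_real (Im (z - z'))) / 2"
    using 1 2 by (auto simp: complex_eq_iff)
  also have "cmod \<dots> \<le> (\<bar>Re (z + z')\<bar> + \<bar>Im (z - z')\<bar>) / 2"
    unfolding norm_divide using norm_triangle_ineq[of "of_real (Re (z + z'))" "\<i> * complex_of_real (Im (z - z'))"]
    by (intro divide_mono) (simp_all only: norm_mult norm_ii norm_of_real mult_1 norm_numeral, simp_all)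
  also have "\<dots> \<le> (M + M) / 2"
    using 1(1) 2(1) by (intro divide_right_mono add_mono) simp_all
  finally have "cmod z \<le> M" by simp
  then show ?thesis by (simp add: z_def M_def)
qed

text \<open>The operator \<open>T\<close> and its expected value \<open>R\<close> are approximated
  by the same \<open>U\<close> and its image; \<open>\<theta>_weakly_bounded\<close> applied to the
  difference of \<open>T\<close> and \<open>U\<close> closes the gap. The factor \<open>K\<close>
  makes room for the bound of a fixed right factor when products are approximated.\<close>

lemma \<theta>_limit:
  assumes T: "T \<in> CA" and R: "R \<in> bounded_ops H"
    and approx: "\<And>e. e > 0 \<Longrightarrow> \<exists>U\<in>SA. op_close (e * K) T U \<and> op_close (e * K) R (\<theta> U)"
    and K: "0 \<le> K"
  shows "\<theta> T = R"
proof (rule op_ext[OF \<theta>_bounded[OF T] R])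
  fix v w assume vw: "v \<in> V" "w \<in> V"
  define M where "M = K * ((vnorm H v)\<^sup>2 + (vnorm H w)\<^sup>2 + vnorm H v * vnorm H w)"
  have bound: "cmod (ip (\<theta> T v) w - ip (R v) w) \<le> e * M" if e: "e > 0" for e
  proof -
    obtain U where U: "U \<in> SA" "op_close (e * K) T U" "op_close (e * K) R (\<theta> U)"
      using approx[OF e] by blast
    define D where "D = op_add H T (op_scale H (-1) U)"
    have D: "D \<in> CA" unfolding D_def using T U(1) by (rule diff_CA)
    have b1: "cmod (ip (\<theta> D v) w) \<le> e * K * ((vnorm H v)\<^sup>2 + (vnorm H w)\<^sup>2)"
      using D e K vw U(2) by (intro \<theta>_weakly_bounded) (auto simp: D_def op_close_def)
    have b2: "cmod (ip (R v) w - ip (\<theta> U v) w) \<le> e * K * (vnorm H v * vnorm H w)"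
      by (intro op_close_weak U R vw \<theta>_bounded SA_CA)
    have "\<theta> D = op_add H (\<theta> T) (op_scale H (-1) (\<theta> U))"
      using T U(1) unfolding D_def by (simp add: \<theta>_add \<theta>_scale SA_CA SA_intros)
    then have "ip (\<theta> T v) w - ip (R v) w = ip (\<theta> D v) w - (ip (R v) w - ip (\<theta> U v) w)"
      using vw \<theta>_bounded[OF T, THEN bounded_opsD] \<theta>_bounded[OF SA_CA[OF U(1)], THEN bounded_opsD]
      by (simp add: vinner_simps)
    then show ?thesis
      using b1 b2 norm_triangle_ineq4[of "ip (\<theta> D v) w" "ip (R v) w - ip (\<theta> U v) w"]
      by (simp add: M_def algebra_simps)
  qed
  have "0 \<le> M" using K vw by (simp add: M_def)
  have "cmod (ip (\<theta> T v) w - ip (R v) w) \<le> 0 + \<epsilon>" if "\<epsilon> > 0" for \<epsilon>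
  proof -
    \<comment> \<open>Dividing by \<open>M + 1\<close> avoids a case distinction on
      \<open>M = 0\<close>.\<close>
    have "\<epsilon> / (M + 1) * M \<le> \<epsilon>"
      using \<open>0 \<le> M\<close> that by (simp add: field_simps)
    then show ?thesis
      using bound[of "\<epsilon> / (M + 1)"] \<open>0 \<le> M\<close> that by auto
  qed
  then have "cmod (ip (\<theta> T v) w - ip (R v) w) \<le> 0"
    by (rule field_le_epsilon)
  then show "ip (\<theta> T v) w = ip (R v) w" by simp
qed

text \<open>Fixed points of \<theta> are not visibly closed under products, whereas operators that
  can be pulled out of \<theta> on the left are; applied to the unit, this property shows that they
  are fixed. The multiplicative domain argument puts the group unitaries and the first-letter
  projections into this set.\<close>

definition fixed_left :: "('h \<Rightarrow> 'h) set" where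
  "fixed_left = {T \<in> SA. \<forall>x\<in>SA. \<theta> (op_mult H T x) = op_mult H T (\<theta> x)}"

lemma fixed_left_SA: "T \<in> fixed_left \<Longrightarrow> T \<in> SA"
  by (simp add: fixed_left_def)

lemma \<theta>_SA_bounded: "T \<in> SA \<Longrightarrow> \<theta> T \<in> bounded_ops H"
  by (intro \<theta>_bounded SA_CA)

lemma fixed_left_\<theta>: "T \<in> fixed_left \<Longrightarrow> \<theta> T = T"
proof -
  assume T: "T \<in> fixed_left"
  have "op_mult H T op_one = T"
    using SA_bounded[OF fixed_left_SA[OF T]] by (intro op_ext bounded_simps) simp_all
  then show ?thesis using T one_SA unital unfolding fixed_left_def by auto
qed

lemma fixed_left_add:
  assumes "T \<in> fixed_left" "U \<in> fixed_left"
  shows "op_add H T U \<in> fixed_left"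
  unfolding fixed_left_def
proof (intro CollectI conjI ballI)
  note SA = fixed_left_SA[OF assms(1)] fixed_left_SA[OF assms(2)]
  show "op_add H T U \<in> SA" using SA by (rule star_alg_gen.add)
  fix x assume x: "x \<in> SA"
  note bd = SA_bounded[OF SA(1)] SA_bounded[OF SA(2)] SA_bounded[OF x] \<theta>_SA_bounded[OF x]
  note bv = bd[THEN bounded_opsD]
  have "op_mult H (op_add H T U) x = op_add H (op_mult H T x) (op_mult H U x)"
    using bd by (intro op_ext bounded_simps) (simp_all add: bv)
  then have "\<theta> (op_mult H (op_add H T U) x) = op_add H (op_mult H T (\<theta> x)) (op_mult H U (\<theta> x))"
    using assms x SA by (simp add: \<theta>_add star_alg_gen.mult SA_CA fixed_left_def)
  also have "\<dots> = op_mult H (op_add H T U) (\<theta> x)"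
    using bd by (intro op_ext bounded_simps) (simp_all add: bv)
  finally show "\<theta> (op_mult H (op_add H T U) x) = op_mult H (op_add H T U) (\<theta> x)" .
qed

lemma fixed_left_scale:
  assumes "T \<in> fixed_left"
  shows "op_scale H c T \<in> fixed_left"
  unfolding fixed_left_def
proof (intro CollectI conjI ballI)
  note SA = fixed_left_SA[OF assms(1)]
  show "op_scale H c T \<in> SA" using SA by (rule star_alg_gen.scale)
  fix x assume x: "x \<in> SA"
  note bd = SA_bounded[OF SA(1)] SA_bounded[OF x] \<theta>_SA_bounded[OF x]
  note bv = bd[THEN bounded_opsD]
  have "op_mult H (op_scale H c T) x = op_scale H c (op_mult H T x)"
    using bd by (intro op_ext bounded_simps) (simp_all add: bv)
  then have "\<theta> (op_mult H (op_scale H c T) x) = op_scale H c (op_mult H T (\<theta> x))"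
    using assms x SA by (simp add: \<theta>_scale star_alg_gen.mult SA_CA fixed_left_def)
  also have "\<dots> = op_mult H (op_scale H c T) (\<theta> x)"
    using bd by (intro op_ext bounded_simps) (simp_all add: bv)
  finally show "\<theta> (op_mult H (op_scale H c T) x) = op_mult H (op_scale H c T) (\<theta> x)" .
qed

lemma fixed_left_mult:
  assumes "T \<in> fixed_left" "U \<in> fixed_left"
  shows "op_mult H T U \<in> fixed_left"
  unfolding fixed_left_def
proof (intro CollectI conjI ballI)
  note SA = fixed_left_SA[OF assms(1)] fixed_left_SA[OF assms(2)]
  show "op_mult H T U \<in> SA" using SA by (rule star_alg_gen.mult)
  fix x assume x: "x \<in> SA"
  note bd = SA_bounded[OF SA(1)] SA_bounded[OF SA(2)] SA_bounded[OF x] \<theta>_SA_bounded[OF x]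
  note bv = bd[THEN bounded_opsD]
  have "op_mult H (op_mult H T U) x = op_mult H T (op_mult H U x)"
    using bd by (intro op_ext bounded_simps) (simp_all add: bv)
  then have "\<theta> (op_mult H (op_mult H T U) x) = op_mult H T (op_mult H U (\<theta> x))"
    using assms x SA by (simp add: star_alg_gen.mult SA_CA fixed_left_def)
  also have "\<dots> = op_mult H (op_mult H T U) (\<theta> x)"
    using bd by (intro op_ext bounded_simps) (simp_all add: bv)
  finally show "\<theta> (op_mult H (op_mult H T U) x) = op_mult H (op_mult H T U) (\<theta> x)" .
qed

lemma fixed_left_limit:
  assumes T: "T \<in> SA" and approx: "\<And>e. e > 0 \<Longrightarrow> \<exists>U\<in>fixed_left. op_close e T U"
  shows "T \<in> fixed_left"
  unfolding fixed_left_def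
proof (intro CollectI conjI ballI T)
  fix x assume x: "x \<in> SA"
  note bd = SA_bounded[OF T] SA_bounded[OF x] \<theta>_SA_bounded[OF x]
  obtain C where C: "C > 0" "\<And>v. v \<in> V \<Longrightarrow> vnorm H (x v) \<le> C * vnorm H v"
    using bounded_ops_bound[OF bd(2)] by metis
  obtain D where D: "D > 0" "\<And>v. v \<in> V \<Longrightarrow> vnorm H (\<theta> x v) \<le> D * vnorm H v"
    using bounded_ops_bound[OF bd(3)] by metis
  have max: "vnorm H (x v) \<le> max C D * vnorm H v" "vnorm H (\<theta> x v) \<le> max C D * vnorm H v" if "v \<in> V" for v
    using C(2)[OF that] D(2)[OF that] mult_right_mono[of C "max C D" "vnorm H v"]
      mult_right_mono[of D "max C D" "vnorm H v"] that by auto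
  show "\<theta> (op_mult H T x) = op_mult H T (\<theta> x)"
  \<comment> \<open>One constant has to serve for both right factors, \<open>x\<close> and its
    image.\<close>
  proof (rule \<theta>_limit[where K = "max C D"])
    show "op_mult H T x \<in> CA" using T x by (intro SA_CA SA_intros)
    show "op_mult H T (\<theta> x) \<in> bounded_ops H" by (intro bounded_simps bd)
    fix e :: real assume e: "e > 0"
    then obtain U where U: "U \<in> fixed_left" "op_close e T U" using approx by blast
    have "op_close (e * max C D) (op_mult H T x) (op_mult H U x)"
      "op_close (e * max C D) (op_mult H T (\<theta> x)) (op_mult H U (\<theta> x))"
      using e max by (auto intro!: op_close_mult U(2) bd)
    then show "\<exists>U\<in>SA. op_close (e * max C D) (op_mult H T x) U \<and> op_close (e * max C D) (op_mult H T (\<theta> x)) (\<theta> U)"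
      using U(1) x by (intro bexI[of _ "op_mult H U x"]) (auto simp: fixed_left_def intro: SA_intros)
  qed (use C in simp)
qed

lemma fixes_cstar_gen:
  assumes gens: "A0 \<subseteq> fixed_left" and T: "T \<in> CA"
  shows "\<theta> T = T"
proof -
  \<comment> \<open>The induction carries adjoints along: \<open>star_alg_gen\<close> is closed
    under them, and \<open>fixed_left\<close> is not obviously so.\<close>
  have SA: "U \<in> fixed_left \<and> (\<forall>U'. is_adjoint H U U' \<longrightarrow> U' \<in> fixed_left)" if "U \<in> SA" for U
    using that
  proof (induction rule: star_alg_gen.induct)
    case (gen T)
    then show ?case
      using gens gens_adjoint gens_bounded is_adjoint_unique by blast
  next
    case (add T U)
    moreover obtain T' U' where "is_adjoint H T T'" "is_adjoint H U U'" "T' \<in> SA" "U' \<in> SA"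
      using add SA_adjoint by metis
    ultimately show ?case
      using is_adjoint_add is_adjoint_unique SA_bounded bounded_op_add fixed_left_add
      by metis
  next
    case (scale T c)
    moreover obtain T' where "is_adjoint H T T'" "T' \<in> SA"
      using scale SA_adjoint by metis
    ultimately show ?case
      using is_adjoint_scale is_adjoint_unique SA_bounded bounded_op_scale fixed_left_scale
      by metis
  next
    case (mult T U)
    moreover obtain T' U' where "is_adjoint H T T'" "is_adjoint H U U'" "T' \<in> SA" "U' \<in> SA"
      using mult SA_adjoint by metis
    ultimately show ?case
      using is_adjoint_mult is_adjoint_unique SA_bounded bounded_op_mult fixed_left_mult
      by metis
  next
    case (adj T U)
    then show ?case
      using is_adjoint_sym is_adjoint_unique SA_bounded star_alg_gen.adj by metis
  qed
  show ?thesis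
  proof (rule \<theta>_limit[OF T CA_bounded[OF T], where K = 1])
    fix e :: real assume "e > 0"
    then obtain U where U: "U \<in> SA" "op_close e T U" using CA_approx[OF T] by metis
    then have "\<theta> U = U" using SA fixed_left_\<theta> by blast
    with U show "\<exists>U\<in>SA. op_close (e * 1) T U \<and> op_close (e * 1) T (\<theta> U)" by auto
  qed simp
qed

end

section \<open>Square-integrable functions\<close>

lemma borel_measurable_cnj [measurable (raw)]:
  assumes "f \<in> borel_measurable M"
  shows "(\<lambda>x. cnj (f x)) \<in> borel_measurable M"
proof -
  have "cnj \<in> borel_measurable borel"
    by (intro borel_measurable_continuous_onI continuous_intros)
  from measurable_compose[OF assms this] show ?thesis .
qed

lemma square_integrableD:
  assumes "f \<in> square_integrable M"
  shows "f \<in> borel_measurable M" "integrable M (\<lambda>x. (cmod (f x))\<^sup>2)"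
  using assms by (auto simp: square_integrable_def)

lemma square_integrable_bound:
  assumes g: "integrable M g" and f: "f \<in> borel_measurable M"
    and le: "AE x in M. (cmod (f x))\<^sup>2 \<le> g x"
  shows "f \<in> square_integrable M"
  unfolding square_integrable_def
proof (intro CollectI conjI f)
  show "integrable M (\<lambda>x. (cmod (f x))\<^sup>2)"
  proof (rule Bochner_Integration.integrable_bound[OF g])
    show "AE x in M. norm ((cmod (f x))\<^sup>2) \<le> norm (g x)"
      using le by eventually_elim auto
  qed (use f in measurable)
qed

lemma cmod_add_square_le: "(cmod (a + b))\<^sup>2 \<le> 2 * (cmod a)\<^sup>2 + 2 * (cmod b)\<^sup>2"
proof -
  have "(cmod (a + b))\<^sup>2 \<le> (cmod a + cmod b)\<^sup>2"
    by (intro power_mono norm_triangle_ineq) auto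
  also have "\<dots> \<le> 2 * (cmod a)\<^sup>2 + 2 * (cmod b)\<^sup>2"
    using sum_squares_bound[of "cmod a" "cmod b"] by (simp add: power2_sum)
  finally show ?thesis .
qed

lemma square_integrable_add:
  assumes "f \<in> square_integrable M" "g \<in> square_integrable M"
  shows "(\<lambda>x. f x + g x) \<in> square_integrable M"
proof (rule square_integrable_bound)
  show "integrable M (\<lambda>x. 2 * (cmod (f x))\<^sup>2 + 2 * (cmod (g x))\<^sup>2)"
    using assms by (auto simp: square_integrable_def)
  show "(\<lambda>x. f x + g x) \<in> borel_measurable M"
    using assms by (auto simp: square_integrable_def)
  show "AE x in M. (cmod (f x + g x))\<^sup>2 \<le> 2 * (cmod (f x))\<^sup>2 + 2 * (cmod (g x))\<^sup>2"
    by (intro always_eventually allI cmod_add_square_le)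
qed

lemma square_integrable_scale:
  "f \<in> square_integrable M \<Longrightarrow> (\<lambda>x. c * f x) \<in> square_integrable M"
  by (auto simp: square_integrable_def norm_mult power_mult_distrib)

lemma square_integrable_inner:
  assumes "f \<in> square_integrable M" "g \<in> square_integrable M"
  shows "integrable M (\<lambda>x. f x * cnj (g x))"
proof (rule Bochner_Integration.integrable_bound)
  show "integrable M (\<lambda>x. (cmod (f x))\<^sup>2 + (cmod (g x))\<^sup>2)"
    using assms by (auto simp: square_integrable_def)
  show "(\<lambda>x. f x * cnj (g x)) \<in> borel_measurable M"
    using assms by (auto simp: square_integrable_def)
  have "a * b \<le> a\<^sup>2 + b\<^sup>2" for a b :: real
    using sum_squares_bound[of a b] zero_le_power2[of a] zero_le_power2[of b] by linarith
  then show "AE x in M. norm (f x * cnj (g x)) \<le> norm ((cmod (f x))\<^sup>2 + (cmod (g x))\<^sup>2)"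
    by (simp add: norm_mult)
qed

lemma L2_class_cong:
  assumes "AE x in M. f x = g x"
  shows "L2_class M f = L2_class M g"
proof -
  have "(AE x in M. h x = f x) \<longleftrightarrow> (AE x in M. h x = g x)" for h
  proof
    assume "AE x in M. h x = f x"
    with assms show "AE x in M. h x = g x" by eventually_elim simp
  next
    assume "AE x in M. h x = g x"
    with assms show "AE x in M. h x = f x" by eventually_elim simp
  qed
  then show ?thesis by (simp add: L2_class_def)
qed

lemma L2_rep_class:
  assumes "f \<in> square_integrable M"
  shows "L2_rep (L2_class M f) \<in> square_integrable M" "AE x in M. L2_rep (L2_class M f) x = f x"
proof -
  have "f \<in> L2_class M f" using assms by (simp add: L2_class_def)
  then have "L2_rep (L2_class M f) \<in> L2_class M f"
    unfolding L2_rep_def by (rule someI[where P = "\<lambda>h. h \<in> L2_class M f"])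
  then show "L2_rep (L2_class M f) \<in> square_integrable M" "AE x in M. L2_rep (L2_class M f) x = f x"
    by (auto simp: L2_class_def)
qed

lemma vecs_L2: "vecs (L2 M) = L2_class M ` square_integrable M"
  by (simp add: L2_def)

lemma L2_class_vecs: "f \<in> square_integrable M \<Longrightarrow> L2_class M f \<in> vecs (L2 M)"
  by (simp add: vecs_L2)

lemma L2_rep_vecs:
  assumes "u \<in> vecs (L2 M)"
  shows "L2_rep u \<in> square_integrable M" "L2_class M (L2_rep u) = u"
proof -
  obtain f where f: "f \<in> square_integrable M" "u = L2_class M f"
    using assms by (auto simp: vecs_L2)
  show "L2_rep u \<in> square_integrable M" using L2_rep_class(1)[OF f(1)] f(2) by simp
  show "L2_class M (L2_rep u) = u"
    using L2_class_cong[OF L2_rep_class(2)[OF f(1)]] f(2) by simp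
qed

lemma vadd_class:
  assumes f: "f \<in> square_integrable M" and g: "g \<in> square_integrable M"
  shows "vadd (L2 M) (L2_class M f) (L2_class M g) = L2_class M (\<lambda>x. f x + g x)"
proof -
  have "AE x in M. L2_rep (L2_class M f) x + L2_rep (L2_class M g) x = f x + g x"
    using L2_rep_class(2)[OF f] L2_rep_class(2)[OF g] by eventually_elim simp
  then show ?thesis by (simp add: L2_def L2_class_cong)
qed

lemma vscale_class:
  assumes f: "f \<in> square_integrable M"
  shows "vscale (L2 M) c (L2_class M f) = L2_class M (\<lambda>x. c * f x)"
proof -
  have "AE x in M. c * L2_rep (L2_class M f) x = c * f x"
    using L2_rep_class(2)[OF f] by eventually_elim simp
  then show ?thesis by (simp add: L2_def L2_class_cong)
qed

lemma vinner_class: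
  assumes f: "f \<in> square_integrable M" and g: "g \<in> square_integrable M"
  shows "vinner (L2 M) (L2_class M f) (L2_class M g) = (\<integral>x. f x * cnj (g x) \<partial>M)"
proof -
  note [measurable] = square_integrableD(1)[OF f] square_integrableD(1)[OF g]
    square_integrableD(1)[OF L2_rep_class(1)[OF f]] square_integrableD(1)[OF L2_rep_class(1)[OF g]]
  have "AE x in M. L2_rep (L2_class M f) x * cnj (L2_rep (L2_class M g) x) = f x * cnj (g x)"
    using L2_rep_class(2)[OF f] L2_rep_class(2)[OF g] by eventually_elim simp
  then have "(\<integral>x. L2_rep (L2_class M f) x * cnj (L2_rep (L2_class M g) x) \<partial>M) = (\<integral>x. f x * cnj (g x) \<partial>M)"
    by (intro integral_cong_AE) auto
  then show ?thesis by (simp add: L2_def)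
qed

lemma vinner_self_class:
  assumes f: "f \<in> square_integrable M"
  shows "vinner (L2 M) (L2_class M f) (L2_class M f) = of_real (\<integral>x. (cmod (f x))\<^sup>2 \<partial>M)"
proof -
  have "f x * cnj (f x) = of_real ((cmod (f x))\<^sup>2)" for x
    using complex_norm_square[of "f x"] by simp
  then show ?thesis
    using vinner_class[OF f f] by (simp del: of_real_power)
qed

lemma vnorm_class:
  assumes f: "f \<in> square_integrable M"
  shows "(vnorm (L2 M) (L2_class M f))\<^sup>2 = (\<integral>x. (cmod (f x))\<^sup>2 \<partial>M)"
  unfolding vnorm_def vinner_self_class[OF f] by simp

lemma nn_integral_vnorm:
  assumes f: "f \<in> square_integrable M"
  shows "(\<integral>\<^sup>+x. ennreal ((cmod (f x))\<^sup>2) \<partial>M) = ennreal ((vnorm (L2 M) (L2_class M f))\<^sup>2)"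
  unfolding vnorm_class[OF f] using square_integrableD(2)[OF f] by (intro nn_integral_eq_integral) auto

text \<open>With \<open>d\<^sub>n = |f\<^sub>n\<^sub>+\<^sub>1 - f\<^sub>n|\<close>, the function \<open>K = \<Sum>n. 2\<^sup>n d\<^sub>n\<^sup>2\<close> is integrable, and
  \<open>d\<^sub>n \<le> \<surd>K 2\<^sup>-\<^sup>n\<^sup>/\<^sup>2\<close> makes the sequence converge almost everywhere, dominated by \<open>|f\<^sub>0| + c \<surd>K\<close>.\<close>

lemma L2_rapid_limit:
  fixes f :: "nat \<Rightarrow> 'x \<Rightarrow> complex"
  assumes f: "\<And>n. f n \<in> square_integrable M"
    and rapid: "\<And>n. (\<integral>x. (cmod (f (Suc n) x - f n x))\<^sup>2 \<partial>M) \<le> C * (1/4) ^ n"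
  shows "\<exists>F\<in>square_integrable M. \<forall>g\<in>square_integrable M.
    (\<lambda>n. \<integral>x. g x * cnj (f n x) \<partial>M) \<longlonglongrightarrow> (\<integral>x. g x * cnj (F x) \<partial>M)"
proof -
  have fm [measurable]: "f n \<in> borel_measurable M" for n using f by (rule square_integrableD)
  define d where "d = (\<lambda>n x. cmod (f (Suc n) x - f n x))"
  have dm [measurable]: "d n \<in> borel_measurable M" for n unfolding d_def by measurable
  have d_nonneg: "0 \<le> d n x" for n x by (simp add: d_def)
  have diff: "(\<lambda>x. f (Suc n) x - f n x) \<in> square_integrable M" for n
    using square_integrable_add[OF f[of "Suc n"] square_integrable_scale[OF f[of n], of "-1"]] by simp
  have dint: "integrable M (\<lambda>x. 2 ^ n * (d n x)\<^sup>2)" for n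
    using square_integrableD(2)[OF diff[of n]] by (auto simp: d_def)
  have C: "C \<ge> 0"
  proof -
    have "0 \<le> (\<integral>x. (cmod (f (Suc 0) x - f 0 x))\<^sup>2 \<partial>M)"
      by (rule Bochner_Integration.integral_nonneg) simp
    also have "\<dots> \<le> C" using rapid[of 0] by simp
    finally show ?thesis .
  qed
  \<comment> \<open>The weight \<open>2 ^ n\<close> spends half of the decay
    \<open>(1/4) ^ n\<close>. What remains makes the integrals summable, and the weight itself
    yields the pointwise decay of \<open>d n\<close>.\<close>
  have dbound: "(\<integral>x. 2 ^ n * (d n x)\<^sup>2 \<partial>M) \<le> C * (1/2) ^ n" for n
  proof -
    have "(\<integral>x. 2 ^ n * (d n x)\<^sup>2 \<partial>M) = 2 ^ n * (\<integral>x. (d n x)\<^sup>2 \<partial>M)"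
      by (rule integral_mult_right_zero)
    also have "\<dots> \<le> 2 ^ n * (C * (1/4) ^ n)"
      using rapid[of n] unfolding d_def by (rule mult_left_mono) simp
    also have "\<dots> = C * (2 ^ n * (1/4) ^ n)"
      by (rule mult.left_commute)
    also have "(2::real) ^ n * (1/4) ^ n = (2 * (1/4)) ^ n"
      by (rule power_mult_distrib[symmetric])
    finally show ?thesis by simp
  qed
  have "(\<integral>\<^sup>+x. (\<Sum>n. ennreal (2 ^ n * (d n x)\<^sup>2)) \<partial>M) = (\<Sum>n. \<integral>\<^sup>+x. ennreal (2 ^ n * (d n x)\<^sup>2) \<partial>M)"
    by (intro nn_integral_suminf) measurable
  also have "\<dots> \<le> (\<Sum>n. ennreal (C * (1/2) ^ n))"
  proof (intro suminf_le allI summableI)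
    fix n
    have "(\<integral>\<^sup>+x. ennreal (2 ^ n * (d n x)\<^sup>2) \<partial>M) = ennreal (\<integral>x. 2 ^ n * (d n x)\<^sup>2 \<partial>M)"
      by (intro nn_integral_eq_integral dint) auto
    then show "(\<integral>\<^sup>+x. ennreal (2 ^ n * (d n x)\<^sup>2) \<partial>M) \<le> ennreal (C * (1/2) ^ n)"
      using dbound[of n] by (simp add: ennreal_leI)
  qed
  also have "\<dots> = ennreal (\<Sum>n. C * (1/2) ^ n)"
    using C by (intro suminf_ennreal2 summable_mult summable_geometric) auto
  also have "\<dots> < \<infinity>" by simp
  finally have "AE x in M. (\<Sum>n. ennreal (2 ^ n * (d n x)\<^sup>2)) \<noteq> \<infinity>"
    by (intro nn_integral_PInf_AE) auto
  then have summ: "AE x in M. summable (\<lambda>n. 2 ^ n * (d n x)\<^sup>2)"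
    by eventually_elim (intro summable_suminf_not_top, auto)
  define K where "K = (\<lambda>x. \<Sum>n. 2 ^ n * (d n x)\<^sup>2)"
  have K: "integrable M K"
    unfolding K_def
  proof (rule integrable_suminf)
    show "AE x in M. summable (\<lambda>n. norm (2 ^ n * (d n x)\<^sup>2))"
      using summ by eventually_elim simp
    show "summable (\<lambda>n. \<integral>x. norm (2 ^ n * (d n x)\<^sup>2) \<partial>M)"
    proof (rule summable_comparison_test')
      show "summable (\<lambda>n. C * (1/2) ^ n)" by (intro summable_mult summable_geometric) auto
      show "norm (\<integral>x. norm (2 ^ n * (d n x)\<^sup>2) \<partial>M) \<le> C * (1/2) ^ n" for n
        using dbound[of n] by (simp add: abs_mult)
    qed
  qed (fact dint)
  define \<rho> :: real where "\<rho> = sqrt (1/2)"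
  have \<rho>: "0 < \<rho>" "\<rho> < 1" "\<rho>\<^sup>2 = 1/2" by (auto simp: \<rho>_def real_sqrt_lt_1_iff)
  \<comment> \<open>This is the sum of the geometric series with ratio \<rho>, which bounds the
    total variation of the sequence in terms of \<open>sqrt (K x)\<close>.\<close>
  define c where "c = 1 / (1 - \<rho>)"
  have dle: "AE x in M. \<forall>n. d n x \<le> sqrt (K x) * \<rho> ^ n"
    using summ
  proof eventually_elim
    case (elim x)
    show ?case
    proof
      fix n
      have "2 ^ n * (d n x)\<^sup>2 \<le> K x"
        unfolding K_def using elim sum_le_suminf[of "\<lambda>n. 2 ^ n * (d n x)\<^sup>2" "{n}"] by simp
      then have "(d n x)\<^sup>2 \<le> K x * (1/2) ^ n"
        by (simp add: power_one_over field_simps)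
      also have "\<dots> = K x * (\<rho> ^ n)\<^sup>2"
        using \<rho>(3) by (metis power_commutes power_mult mult.commute)
      finally have "sqrt ((d n x)\<^sup>2) \<le> sqrt (K x * (\<rho> ^ n)\<^sup>2)" by (rule real_sqrt_le_mono)
      then show "d n x \<le> sqrt (K x) * \<rho> ^ n"
        using d_nonneg[of n x] \<rho>(1) by (simp add: real_sqrt_mult)
    qed
  qed
  have K_nonneg: "AE x in M. K x \<ge> 0"
    using summ unfolding K_def by eventually_elim (intro suminf_nonneg, auto)
  have conv: "AE x in M. convergent (\<lambda>n. f n x)"
    using dle
  proof eventually_elim
    case (elim x)
    have "summable (\<lambda>n. f (Suc n) x - f n x)"
    proof (rule summable_comparison_test')
      show "summable (\<lambda>n. sqrt (K x) * \<rho> ^ n)" using \<rho> by (intro summable_mult summable_geometric) auto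
      show "norm (f (Suc n) x - f n x) \<le> sqrt (K x) * \<rho> ^ n" for n
        using elim by (simp add: d_def)
    qed
    then have "convergent (\<lambda>n. \<Sum>k<n. f (Suc k) x - f k x)"
      by (simp add: summable_iff_convergent)
    then have "convergent (\<lambda>n. f n x - f 0 x)"
      unfolding sum_lessThan_telescope[of "\<lambda>k. f k x"] .
    then have "convergent (\<lambda>n. (f n x - f 0 x) + f 0 x)"
      by (intro convergent_add convergent_const)
    then show ?case by simp
  qed
  define F where "F = (\<lambda>x. lim (\<lambda>n. f n x))"
  have Fm [measurable]: "F \<in> borel_measurable M" unfolding F_def by measurable
  have lim: "AE x in M. (\<lambda>n. f n x) \<longlonglongrightarrow> F x"
    using conv unfolding F_def by eventually_elim (simp add: convergent_LIMSEQ_iff)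
  define G where "G = (\<lambda>x. cmod (f 0 x) + c * sqrt (K x))"
  have Km [measurable]: "K \<in> borel_measurable M" using K by (rule borel_measurable_integrable)
  have Gm [measurable]: "G \<in> borel_measurable M" unfolding G_def by measurable
  have fG: "AE x in M. \<forall>n. cmod (f n x) \<le> G x"
    using dle K_nonneg
  proof eventually_elim
    case (elim x)
    show ?case
    proof
      fix n
      have "cmod (f n x - f 0 x) = cmod (\<Sum>k<n. f (Suc k) x - f k x)"
        unfolding sum_lessThan_telescope[of "\<lambda>k. f k x"] ..
      also have "\<dots> \<le> (\<Sum>k<n. d k x)" unfolding d_def by (rule norm_sum)
      also have "\<dots> \<le> (\<Sum>k<n. sqrt (K x) * \<rho> ^ k)" using elim by (intro sum_mono) auto
      also have "\<dots> = sqrt (K x) * (\<Sum>k<n. \<rho> ^ k)" by (simp add: sum_distrib_left)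
      also have "\<dots> \<le> sqrt (K x) * c"
      proof (rule mult_left_mono)
        show "(\<Sum>k<n. \<rho> ^ k) \<le> c"
          using \<rho> sum_le_suminf[of "\<lambda>k. \<rho> ^ k" "{..<n}"] suminf_geometric[of \<rho>]
          by (simp add: c_def summable_geometric)
        show "0 \<le> sqrt (K x)" using elim(2) by simp
      qed
      finally have "cmod (f n x - f 0 x) \<le> c * sqrt (K x)"
        by (simp only: mult.commute)
      then show "cmod (f n x) \<le> G x"
        unfolding G_def using norm_triangle_ineq2[of "f n x" "f 0 x"] by linarith
    qed
  qed
  have Gint: "integrable M (\<lambda>x. (G x)\<^sup>2)"
  proof (rule Bochner_Integration.integrable_bound)
    show "integrable M (\<lambda>x. 2 * (cmod (f 0 x))\<^sup>2 + 2 * (c\<^sup>2 * K x))"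
      by (intro Bochner_Integration.integrable_add integrable_mult_right K square_integrableD(2)[OF f])
    show "AE x in M. norm ((G x)\<^sup>2) \<le> norm (2 * (cmod (f 0 x))\<^sup>2 + 2 * (c\<^sup>2 * K x))"
      using K_nonneg
    proof eventually_elim
      case (elim x)
      have "(G x)\<^sup>2 \<le> 2 * (cmod (f 0 x))\<^sup>2 + 2 * (c * sqrt (K x))\<^sup>2"
        unfolding G_def using sum_squares_bound[of "cmod (f 0 x)" "c * sqrt (K x)"] by (simp add: power2_sum)
      then show ?case using elim by (simp add: power_mult_distrib)
    qed
  qed measurable
  have F: "F \<in> square_integrable M"
  proof (rule square_integrable_bound[OF Gint Fm])
    show "AE x in M. (cmod (F x))\<^sup>2 \<le> (G x)\<^sup>2"
      using lim fG
    proof eventually_elim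
      case (elim x)
      then have "(\<lambda>n. cmod (f n x)) \<longlonglongrightarrow> cmod (F x)" by (intro tendsto_norm)
      then have "cmod (F x) \<le> G x" using elim(2) by (intro LIMSEQ_le_const2) auto
      then show ?case by (intro power_mono) auto
    qed
  qed
  have "(\<lambda>n. \<integral>x. g x * cnj (f n x) \<partial>M) \<longlonglongrightarrow> (\<integral>x. g x * cnj (F x) \<partial>M)"
    if g: "g \<in> square_integrable M" for g
  proof (rule integral_dominated_convergence)
    have [measurable]: "g \<in> borel_measurable M" using g by (rule square_integrableD)
    show "(\<lambda>x. g x * cnj (F x)) \<in> borel_measurable M" "\<And>i. (\<lambda>x. g x * cnj (f i x)) \<in> borel_measurable M"
      by auto
    show "integrable M (\<lambda>x. (cmod (g x))\<^sup>2 + (G x)\<^sup>2)"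
      by (intro Bochner_Integration.integrable_add Gint square_integrableD(2)[OF g])
    show "AE x in M. (\<lambda>i. g x * cnj (f i x)) \<longlonglongrightarrow> g x * cnj (F x)"
      using lim by eventually_elim (intro tendsto_intros)
    fix n
    have ab: "a * b \<le> a\<^sup>2 + b\<^sup>2" for a b :: real
      using sum_squares_bound[of a b] zero_le_power2[of a] zero_le_power2[of b] by linarith
    show "AE x in M. norm (g x * cnj (f n x)) \<le> (cmod (g x))\<^sup>2 + (G x)\<^sup>2"
      using fG
    proof eventually_elim
      case (elim x)
      have "norm (g x * cnj (f n x)) \<le> cmod (g x) * G x"
        using elim by (simp add: norm_mult mult_left_mono)
      also have "\<dots> \<le> (cmod (g x))\<^sup>2 + (G x)\<^sup>2" by (rule ab)
      finally show ?case .
    qed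
  qed
  with F show ?thesis by blast
qed

lemma hilbert_L2: "hilbert (L2 M)"
proof
  fix x y z assume x: "x \<in> vecs (L2 M)" and y: "y \<in> vecs (L2 M)"
  obtain f where f: "f \<in> square_integrable M" "x = L2_class M f" using x by (auto simp: vecs_L2)
  obtain g where g: "g \<in> square_integrable M" "y = L2_class M g" using y by (auto simp: vecs_L2)
  show "vadd (L2 M) x y \<in> vecs (L2 M)"
    using f g by (simp add: vadd_class L2_class_vecs square_integrable_add)
  show "vinner (L2 M) y x = cnj (vinner (L2 M) x y)"
  proof -
    have "cnj (\<integral>x. f x * cnj (g x) \<partial>M) = (\<integral>x. cnj (f x * cnj (g x)) \<partial>M)"
      by (rule Bochner_Integration.integral_cnj[symmetric])
    then show ?thesis using f g by (simp add: vinner_class mult.commute)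
  qed
  show "vinner (L2 M) (vadd (L2 M) x y) z = vinner (L2 M) x z + vinner (L2 M) y z"
    if z: "z \<in> vecs (L2 M)"
  proof -
    obtain h where h: "h \<in> square_integrable M" "z = L2_class M h" using z by (auto simp: vecs_L2)
    show ?thesis using f g h
      by (simp add: vadd_class vinner_class square_integrable_add distrib_right square_integrable_inner)
  qed
next
  fix x z c assume x: "x \<in> vecs (L2 M)"
  obtain f where f: "f \<in> square_integrable M" "x = L2_class M f" using x by (auto simp: vecs_L2)
  show "vscale (L2 M) c x \<in> vecs (L2 M)"
    using f by (simp add: vscale_class L2_class_vecs square_integrable_scale)
  show "0 \<le> Re (vinner (L2 M) x x)"
    using f by (simp add: vinner_self_class)
  show "vinner (L2 M) (vscale (L2 M) c x) z = c * vinner (L2 M) x z"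
    if z: "z \<in> vecs (L2 M)"
  proof -
    obtain h where h: "h \<in> square_integrable M" "z = L2_class M h" using z by (auto simp: vecs_L2)
    show ?thesis using f h
      by (simp add: vscale_class vinner_class square_integrable_scale mult.assoc square_integrable_inner)
  qed
next
  fix x y assume x: "x \<in> vecs (L2 M)" and y: "y \<in> vecs (L2 M)"
    and eq: "\<And>z. z \<in> vecs (L2 M) \<Longrightarrow> vinner (L2 M) x z = vinner (L2 M) y z"
  obtain f where f: "f \<in> square_integrable M" "x = L2_class M f" using x by (auto simp: vecs_L2)
  obtain g where g: "g \<in> square_integrable M" "y = L2_class M g" using y by (auto simp: vecs_L2)
  \<comment> \<open>The difference is tested against itself.\<close>
  define h where "h = (\<lambda>x. f x - g x)"
  have h: "h \<in> square_integrable M"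
    using square_integrable_add[OF f(1) square_integrable_scale[OF g(1), of "-1"]] by (simp add: h_def)
  have "(\<integral>x. h x * cnj (h x) \<partial>M) = (\<integral>x. f x * cnj (h x) \<partial>M) - (\<integral>x. g x * cnj (h x) \<partial>M)"
    unfolding Bochner_Integration.integral_diff[OF square_integrable_inner[OF f(1) h] square_integrable_inner[OF g(1) h], symmetric]
    by (intro Bochner_Integration.integral_cong refl) (simp add: h_def left_diff_distrib)
  also have "\<dots> = 0"
    using eq[OF L2_class_vecs[OF h]] f g h by (simp add: vinner_class)
  finally have "(\<integral>x. (cmod (h x))\<^sup>2 \<partial>M) = 0"
    using vinner_self_class[OF h] vinner_class[OF h h] by simp
  then have "AE x in M. (cmod (h x))\<^sup>2 = 0"
    using integral_nonneg_eq_0_iff_AE[OF square_integrableD(2)[OF h]] by simp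
  then have "AE x in M. f x = g x"
    by eventually_elim (simp add: h_def)
  then show "x = y" using f g by (simp add: L2_class_cong)
next
  fix v :: "nat \<Rightarrow> ('a \<Rightarrow> complex) set" and C
  assume v: "\<And>n. v n \<in> vecs (L2 M)"
    and rapid: "\<And>n. vnorm (L2 M) (vadd (L2 M) (v (Suc n)) (vscale (L2 M) (-1) (v n))) \<le> C * (1/2) ^ n"
  define f where "f = (\<lambda>n. L2_rep (v n))"
  have f: "f n \<in> square_integrable M" "v n = L2_class M (f n)" for n
    using L2_rep_vecs[OF v] by (auto simp: f_def)
  have diff: "(\<lambda>x. f (Suc n) x - f n x) \<in> square_integrable M" for n
    using square_integrable_add[OF f(1)[of "Suc n"] square_integrable_scale[OF f(1)[of n], of "-1"]] by simp
  have "\<exists>F\<in>square_integrable M. \<forall>g\<in>square_integrable M.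
    (\<lambda>n. \<integral>x. g x * cnj (f n x) \<partial>M) \<longlonglongrightarrow> (\<integral>x. g x * cnj (F x) \<partial>M)"
  proof (rule L2_rapid_limit[OF f(1)])
    fix n
    have "vadd (L2 M) (v (Suc n)) (vscale (L2 M) (-1) (v n)) = L2_class M (\<lambda>x. f (Suc n) x - f n x)"
      using f(1)[of n] f(1)[of "Suc n"] square_integrable_scale[OF f(1)[of n], of "-1"]
      unfolding f(2)[of n] f(2)[of "Suc n"] by (simp add: vadd_class vscale_class)
    then have "vnorm (L2 M) (L2_class M (\<lambda>x. f (Suc n) x - f n x)) \<le> C * (1/2) ^ n"
      using rapid[of n] by simp
    moreover have "0 \<le> vnorm (L2 M) (L2_class M (\<lambda>x. f (Suc n) x - f n x))"
      using vinner_self_class[OF diff[of n]] by (simp add: vnorm_def)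
    ultimately have "(vnorm (L2 M) (L2_class M (\<lambda>x. f (Suc n) x - f n x)))\<^sup>2 \<le> (C * (1/2) ^ n)\<^sup>2"
      by (intro power_mono)
    \<comment> \<open>Squaring turns the rate \<open>1/2\<close> for norms into the rate
      \<open>1/4\<close> for integrals.\<close>
    also have "\<dots> = C\<^sup>2 * (1/4) ^ n"
    proof -
      have "((1/2 :: real) ^ n)\<^sup>2 = ((1/2)\<^sup>2) ^ n"
        by (simp only: power_mult[symmetric] mult.commute)
      also have "(1/2 :: real)\<^sup>2 = 1/4"
        by (simp add: power2_eq_square)
      finally show ?thesis by (simp only: power_mult_distrib)
    qed
    finally show "(\<integral>x. (cmod (f (Suc n) x - f n x))\<^sup>2 \<partial>M) \<le> C\<^sup>2 * (1/4) ^ n"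
      using vnorm_class[OF diff[of n]] by simp
  qed
  then obtain F where F: "F \<in> square_integrable M" "\<And>g. g \<in> square_integrable M \<Longrightarrow>
    (\<lambda>n. \<integral>x. g x * cnj (f n x) \<partial>M) \<longlonglongrightarrow> (\<integral>x. g x * cnj (F x) \<partial>M)" by blast
  show "\<exists>w\<in>vecs (L2 M). \<forall>x\<in>vecs (L2 M). (\<lambda>n. vinner (L2 M) x (v n)) \<longlonglongrightarrow> vinner (L2 M) x w"
  proof (intro bexI ballI)
    show "L2_class M F \<in> vecs (L2 M)" using F(1) by (rule L2_class_vecs)
    fix x assume "x \<in> vecs (L2 M)"
    then obtain g where "g \<in> square_integrable M" "x = L2_class M g" by (auto simp: vecs_L2)
    then show "(\<lambda>n. vinner (L2 M) x (v n)) \<longlonglongrightarrow> vinner (L2 M) x (L2_class M F)"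
      using F f by (simp add: vinner_class)
  qed
qed

section \<open>Weighted composition operators\<close>

text \<open>Both families of generators of a crossed product, and the relevant elements of its
  commutant, have the form \<open>\<xi> \<mapsto> b \<cdot> (\<xi> \<circ> \<tau>)\<close>.\<close>

definition wcomp :: "'x measure \<Rightarrow> ('x \<Rightarrow> complex) \<Rightarrow> ('x \<Rightarrow> 'x) \<Rightarrow> ('x \<Rightarrow> complex) set \<Rightarrow> ('x \<Rightarrow> complex) set"
  where "wcomp M b \<tau> = (\<lambda>u\<in>vecs (L2 M). L2_class M (\<lambda>x. b x * L2_rep u (\<tau> x)))"

text \<open>The inequality ranges over all nonnegative measurable \<open>F\<close>: the indicator of
  a null set shows that the operator respects almost everywhere equality, and the squared modulus of
  a function gives the norm bound \<open>C\<close>. Preimages of null sets under \<tau> have to be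
  null only where \<open>b\<close> is nonzero.\<close>

definition admissible :: "'x measure \<Rightarrow> ('x \<Rightarrow> complex) \<Rightarrow> ('x \<Rightarrow> 'x) \<Rightarrow> real \<Rightarrow> bool" where
  "admissible M b \<tau> C \<longleftrightarrow> b \<in> borel_measurable M \<and> \<tau> \<in> measurable M M \<and> 0 \<le> C \<and>
     (\<forall>F\<in>borel_measurable M. (\<integral>\<^sup>+x. ennreal ((cmod (b x))\<^sup>2) * F (\<tau> x) \<partial>M) \<le> ennreal (C\<^sup>2) * (\<integral>\<^sup>+x. F x \<partial>M))"

text \<open>The defining inequality is applied to the indicator of an exceptional null set.\<close>

lemma admissible_AE:
  assumes adm: "admissible M b \<tau> C" and P: "AE x in M. P x"
  shows "AE x in M. b x \<noteq> 0 \<longrightarrow> P (\<tau> x)"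
proof -
  from P obtain N where N: "{x \<in> space M. \<not> P x} \<subseteq> N" "emeasure M N = 0" "N \<in> sets M"
    by (rule AE_E)
  have [measurable]: "b \<in> borel_measurable M" "\<tau> \<in> measurable M M" "N \<in> sets M"
    using adm N by (auto simp: admissible_def)
  have "(\<integral>\<^sup>+x. ennreal ((cmod (b x))\<^sup>2) * indicator N (\<tau> x) \<partial>M) \<le> ennreal (C\<^sup>2) * (\<integral>\<^sup>+x. indicator N x \<partial>M)"
  proof -
    have "\<forall>F\<in>borel_measurable M. (\<integral>\<^sup>+x. ennreal ((cmod (b x))\<^sup>2) * F (\<tau> x) \<partial>M) \<le> ennreal (C\<^sup>2) * (\<integral>\<^sup>+x. F x \<partial>M)"
      using adm by (simp add: admissible_def)
    moreover have "indicator N \<in> borel_measurable M" by measurable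
    ultimately show ?thesis by (rule bspec)
  qed
  also have "\<dots> = 0" using N by simp
  finally have "AE x in M. ennreal ((cmod (b x))\<^sup>2) * indicator N (\<tau> x) = 0"
    by (subst (asm) le_zero_eq, subst (asm) nn_integral_0_iff_AE) measurable
  moreover have "AE x in M. \<tau> x \<in> space M"
    using measurable_space[of \<tau> M M] by (intro AE_I2) auto
  ultimately show ?thesis
  proof eventually_elim
    case (elim x)
    then show ?case using N(1) by (auto simp: indicator_def split: if_splits)
  qed
qed

lemma admissible_square_integrable:
  assumes adm: "admissible M b \<tau> C" and f: "f \<in> square_integrable M"
  shows "(\<lambda>x. b x * f (\<tau> x)) \<in> square_integrable M"
    and "vnorm (L2 M) (L2_class M (\<lambda>x. b x * f (\<tau> x))) \<le> C * vnorm (L2 M) (L2_class M f)"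
proof -
  interpret hilbert "L2 M" by (rule hilbert_L2)
  have [measurable]: "b \<in> borel_measurable M" "\<tau> \<in> measurable M M" "f \<in> borel_measurable M"
    using adm f by (auto simp: admissible_def square_integrable_def)
  have eq: "ennreal ((cmod (b x * f (\<tau> x)))\<^sup>2) = ennreal ((cmod (b x))\<^sup>2) * ennreal ((cmod (f (\<tau> x)))\<^sup>2)" for x
    by (simp add: norm_mult power_mult_distrib ennreal_mult)
  have "(\<lambda>x. ennreal ((cmod (f x))\<^sup>2)) \<in> borel_measurable M" by measurable
  moreover have "\<forall>F\<in>borel_measurable M. (\<integral>\<^sup>+x. ennreal ((cmod (b x))\<^sup>2) * F (\<tau> x) \<partial>M) \<le> ennreal (C\<^sup>2) * (\<integral>\<^sup>+x. F x \<partial>M)"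
    using adm by (simp add: admissible_def)
  ultimately have le: "(\<integral>\<^sup>+x. ennreal ((cmod (b x * f (\<tau> x)))\<^sup>2) \<partial>M) \<le> ennreal (C\<^sup>2) * (\<integral>\<^sup>+x. ennreal ((cmod (f x))\<^sup>2) \<partial>M)"
    unfolding eq by (rule bspec[rotated])
  also have fin: "\<dots> = ennreal ((C * vnorm (L2 M) (L2_class M f))\<^sup>2)"
    by (simp add: nn_integral_vnorm[OF f] power_mult_distrib ennreal_mult)
  finally have le': "(\<integral>\<^sup>+x. ennreal ((cmod (b x * f (\<tau> x)))\<^sup>2) \<partial>M) \<le> ennreal ((C * vnorm (L2 M) (L2_class M f))\<^sup>2)" .
  show sq: "(\<lambda>x. b x * f (\<tau> x)) \<in> square_integrable M"
    unfolding square_integrable_def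
  proof (intro CollectI conjI)
    show "integrable M (\<lambda>x. (cmod (b x * f (\<tau> x)))\<^sup>2)"
      using le' by (intro integrableI_bounded) (auto simp: le_less_trans ennreal_less_top)
  qed measurable
  have "(vnorm (L2 M) (L2_class M (\<lambda>x. b x * f (\<tau> x))))\<^sup>2 \<le> (C * vnorm (L2 M) (L2_class M f))\<^sup>2"
    using le' unfolding nn_integral_vnorm[OF sq] by (simp add: ennreal_le_iff)
  then show "vnorm (L2 M) (L2_class M (\<lambda>x. b x * f (\<tau> x))) \<le> C * vnorm (L2 M) (L2_class M f)"
  proof (rule power2_le_imp_le)
    show "0 \<le> C * vnorm (L2 M) (L2_class M f)"
      using adm vnorm_nonneg[OF L2_class_vecs[OF f]] by (simp add: admissible_def)
  qed
qed

lemma wcomp_class: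
  assumes adm: "admissible M b \<tau> C" and f: "f \<in> square_integrable M"
  shows "wcomp M b \<tau> (L2_class M f) = L2_class M (\<lambda>x. b x * f (\<tau> x))"
proof -
  have "AE x in M. b x \<noteq> 0 \<longrightarrow> L2_rep (L2_class M f) (\<tau> x) = f (\<tau> x)"
    using L2_rep_class(2)[OF f] by (rule admissible_AE[OF adm])
  then have "AE x in M. b x * L2_rep (L2_class M f) (\<tau> x) = b x * f (\<tau> x)"
    by eventually_elim auto
  then show ?thesis
    using L2_class_vecs[OF f] by (simp add: wcomp_def L2_class_cong)
qed

lemma L2_vecsE:
  assumes "u \<in> vecs (L2 M)"
  obtains f where "f \<in> square_integrable M" "u = L2_class M f"
  using assms by (auto simp: vecs_L2)

lemma wcomp_bounded:
  assumes adm: "admissible M b \<tau> C"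
  shows "wcomp M b \<tau> \<in> bounded_ops (L2 M)"
proof -
  note sq = admissible_square_integrable(1)[OF adm]
  have v: "wcomp M b \<tau> x \<in> vecs (L2 M)" if "x \<in> vecs (L2 M)" for x
    using that by (auto elim!: L2_vecsE simp: wcomp_class[OF adm] L2_class_vecs sq)
  have a: "wcomp M b \<tau> (vadd (L2 M) x y) = vadd (L2 M) (wcomp M b \<tau> x) (wcomp M b \<tau> y)"
    if xy: "x \<in> vecs (L2 M)" "y \<in> vecs (L2 M)" for x y
  proof -
    obtain f g where f: "f \<in> square_integrable M" "x = L2_class M f"
      and g: "g \<in> square_integrable M" "y = L2_class M g"
      using xy L2_vecsE by metis
    show ?thesis
      unfolding f(2) g(2) vadd_class[OF f(1) g(1)] wcomp_class[OF adm f(1)] wcomp_class[OF adm g(1)]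
        wcomp_class[OF adm square_integrable_add[OF f(1) g(1)]] vadd_class[OF sq[OF f(1)] sq[OF g(1)]]
      by (simp add: distrib_left)
  qed
  have s: "wcomp M b \<tau> (vscale (L2 M) c x) = vscale (L2 M) c (wcomp M b \<tau> x)"
    if x: "x \<in> vecs (L2 M)" for x c
  proof -
    obtain f where f: "f \<in> square_integrable M" "x = L2_class M f"
      by (rule L2_vecsE[OF x])
    show ?thesis
      unfolding f(2) vscale_class[OF f(1)] wcomp_class[OF adm f(1)]
        wcomp_class[OF adm square_integrable_scale[OF f(1), of c]] vscale_class[OF sq[OF f(1)]]
      by (simp only: mult.left_commute[of c])
  qed
  have b: "vnorm (L2 M) (wcomp M b \<tau> x) \<le> C * vnorm (L2 M) x" if x: "x \<in> vecs (L2 M)" for x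
  proof -
    obtain f where f: "f \<in> square_integrable M" "x = L2_class M f"
      by (rule L2_vecsE[OF x])
    show ?thesis
      unfolding f(2) wcomp_class[OF adm f(1)] by (rule admissible_square_integrable(2)[OF adm f(1)])
  qed
  have "wcomp M b \<tau> \<in> vecs (L2 M) \<rightarrow>\<^sub>E vecs (L2 M)"
    using v by (auto simp: wcomp_def PiE_def)
  with a s b show ?thesis unfolding bounded_ops_def by blast
qed

lemma op_eq_L2:
  assumes "T \<in> bounded_ops (L2 M)" "U \<in> bounded_ops (L2 M)"
    "\<And>f. f \<in> square_integrable M \<Longrightarrow> T (L2_class M f) = U (L2_class M f)"
  shows "T = U"
proof (rule extensionalityI)
  show "T \<in> extensional (vecs (L2 M))" "U \<in> extensional (vecs (L2 M))"
    using assms(1,2) by (auto simp: bounded_ops_def PiE_def)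
qed (use assms(3) in \<open>auto elim!: L2_vecsE\<close>)

text \<open>Both composites multiply \<open>f\<close>, composed with a map, by a weight;
  \<open>e\<close> equates the weights and the last hypothesis the maps. Commutation with the
  generators of the crossed product is always reduced to this.\<close>

lemma wcomp_commute:
  assumes b: "admissible M b \<tau> C" and c: "admissible M c \<sigma> D"
    and e: "AE x in M. b x * c (\<tau> x) = c x * b (\<sigma> x)" and \<upsilon>: "\<And>x. x \<in> space M \<Longrightarrow> \<sigma> (\<tau> x) = \<tau> (\<sigma> x)"
  shows "op_mult (L2 M) (wcomp M b \<tau>) (wcomp M c \<sigma>) = op_mult (L2 M) (wcomp M c \<sigma>) (wcomp M b \<tau>)"
proof -
  interpret hilbert "L2 M" by (rule hilbert_L2)
  show ?thesis
  proof (rule op_eq_L2)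
    show "op_mult (L2 M) (wcomp M b \<tau>) (wcomp M c \<sigma>) \<in> bounded_ops (L2 M)"
      "op_mult (L2 M) (wcomp M c \<sigma>) (wcomp M b \<tau>) \<in> bounded_ops (L2 M)"
      using b c by (auto intro!: bounded_op_mult wcomp_bounded)
    fix f assume f: "f \<in> square_integrable M"
    have "AE x in M. b x * (c (\<tau> x) * f (\<sigma> (\<tau> x))) = c x * (b (\<sigma> x) * f (\<tau> (\<sigma> x)))"
      using e AE_space by eventually_elim (simp add: \<upsilon> flip: mult.assoc)
    then show "op_mult (L2 M) (wcomp M b \<tau>) (wcomp M c \<sigma>) (L2_class M f) =
      op_mult (L2 M) (wcomp M c \<sigma>) (wcomp M b \<tau>) (L2_class M f)"
      using f L2_class_vecs[OF f] admissible_square_integrable(1)[OF c f] admissible_square_integrable(1)[OF b f]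
      by (simp add: wcomp_class[OF b] wcomp_class[OF c] L2_class_cong)
  qed
qed

lemma admissible_multiplication:
  assumes b: "b \<in> borel_measurable M" and C: "0 \<le> C" "AE x in M. cmod (b x) \<le> C"
  shows "admissible M b (\<lambda>x. x) C"
  unfolding admissible_def
proof (intro conjI ballI b C)
  fix F :: "'a \<Rightarrow> ennreal" assume [measurable]: "F \<in> borel_measurable M"
  have "(\<integral>\<^sup>+x. ennreal ((cmod (b x))\<^sup>2) * F x \<partial>M) \<le> (\<integral>\<^sup>+x. ennreal (C\<^sup>2) * F x \<partial>M)"
    using C(2) by (intro nn_integral_mono_AE) (auto elim!: eventually_mono intro!: mult_right_mono ennreal_leI power_mono)
  also have "\<dots> = ennreal (C\<^sup>2) * (\<integral>\<^sup>+x. F x \<partial>M)" by (intro nn_integral_cmult) auto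
  finally show "(\<integral>\<^sup>+x. ennreal ((cmod (b x))\<^sup>2) * F x \<partial>M) \<le> ennreal (C\<^sup>2) * (\<integral>\<^sup>+x. F x \<partial>M)" .
qed measurable

lemma admissible_measure_preserving:
  assumes \<tau>: "\<tau> \<in> measurable M M" and "distr M M \<tau> = M"
  shows "admissible M (\<lambda>_. 1) \<tau> 1"
  unfolding admissible_def
proof (intro conjI ballI \<tau>)
  fix F :: "'a \<Rightarrow> ennreal" assume [measurable]: "F \<in> borel_measurable M"
  have "(\<integral>\<^sup>+x. F x \<partial>distr M M \<tau>) = (\<integral>\<^sup>+x. F (\<tau> x) \<partial>M)"
    using \<tau> by (intro nn_integral_distr) auto
  then show "(\<integral>\<^sup>+x. ennreal ((cmod 1)\<^sup>2) * F (\<tau> x) \<partial>M) \<le> ennreal (1\<^sup>2) * (\<integral>\<^sup>+x. F x \<partial>M)"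
    using assms(2) by simp
qed auto

lemma is_adjoint_multiplication:
  assumes b: "b \<in> borel_measurable M" and C: "0 \<le> C" "AE x in M. cmod (b x) \<le> C"
  shows "is_adjoint (L2 M) (wcomp M b (\<lambda>x. x)) (wcomp M (\<lambda>x. cnj (b x)) (\<lambda>x. x))"
proof -
  have 1: "admissible M b (\<lambda>x. x) C" using assms by (rule admissible_multiplication)
  have 2: "admissible M (\<lambda>x. cnj (b x)) (\<lambda>x. x) C" using assms by (intro admissible_multiplication) auto
  show ?thesis
    unfolding is_adjoint_def
  proof (intro conjI ballI)
    show "wcomp M (\<lambda>x. cnj (b x)) (\<lambda>x. x) \<in> bounded_ops (L2 M)" using 2 by (rule wcomp_bounded)
    fix x y assume "x \<in> vecs (L2 M)" "y \<in> vecs (L2 M)"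
    then obtain f g where f: "f \<in> square_integrable M" "x = L2_class M f"
      and g: "g \<in> square_integrable M" "y = L2_class M g" using L2_vecsE by metis
    show "vinner (L2 M) (wcomp M b (\<lambda>x. x) x) y = vinner (L2 M) x (wcomp M (\<lambda>x. cnj (b x)) (\<lambda>x. x) y)"
      unfolding f(2) g(2) wcomp_class[OF 1 f(1)] wcomp_class[OF 2 g(1)]
        vinner_class[OF admissible_square_integrable(1)[OF 1 f(1)] g(1)]
        vinner_class[OF f(1) admissible_square_integrable(1)[OF 2 g(1)]]
      by (simp add: mult_ac)
  qed
qed

lemma is_adjoint_measure_preserving:
  assumes \<tau>: "\<tau> \<in> measurable M M" "distr M M \<tau> = M" and \<sigma>: "\<sigma> \<in> measurable M M" "distr M M \<sigma> = M"
    and inv: "\<And>x. x \<in> space M \<Longrightarrow> \<tau> (\<sigma> x) = x"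
  shows "is_adjoint (L2 M) (wcomp M (\<lambda>_. 1) \<tau>) (wcomp M (\<lambda>_. 1) \<sigma>)"
proof -
  note 1 = admissible_measure_preserving[OF \<tau>] and 2 = admissible_measure_preserving[OF \<sigma>]
  show ?thesis
    unfolding is_adjoint_def
  proof (intro conjI ballI)
    show "wcomp M (\<lambda>_. 1) \<sigma> \<in> bounded_ops (L2 M)" using 2 by (rule wcomp_bounded)
    fix x y assume "x \<in> vecs (L2 M)" "y \<in> vecs (L2 M)"
    then obtain f g where f: "f \<in> square_integrable M" "x = L2_class M f"
      and g: "g \<in> square_integrable M" "y = L2_class M g" using L2_vecsE by metis
    have [measurable]: "f \<in> borel_measurable M" "g \<in> borel_measurable M" "\<tau> \<in> measurable M M" "\<sigma> \<in> measurable M M"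
      using f g \<tau> \<sigma> by (auto simp: square_integrable_def)
    have "(\<integral>x. f (\<tau> x) * cnj (g x) \<partial>M) = (\<integral>x. f (\<tau> x) * cnj (g x) \<partial>distr M M \<sigma>)"
      using \<sigma> by simp
    also have "\<dots> = (\<integral>x. f (\<tau> (\<sigma> x)) * cnj (g (\<sigma> x)) \<partial>M)"
      by (intro integral_distr) measurable
    also have "\<dots> = (\<integral>x. f x * cnj (g (\<sigma> x)) \<partial>M)"
      using inv by (intro Bochner_Integration.integral_cong) auto
    finally show "vinner (L2 M) (wcomp M (\<lambda>_. 1) \<tau> x) y = vinner (L2 M) x (wcomp M (\<lambda>_. 1) \<sigma> y)"
      using f g admissible_square_integrable(1)[OF 1 f(1)] admissible_square_integrable(1)[OF 2 g(1)]
      by (simp add: wcomp_class[OF 1] wcomp_class[OF 2] vinner_class)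
  qed
qed

section \<open>Cylinder sets and the action on the boundary\<close>

locale free_boundary =
  fixes S :: "'a set"
  assumes finite_S: "finite S" and card_S: "2 \<le> card S"
begin

abbreviation "X \<equiv> boundary S"
abbreviation "W \<equiv> reduced_words S"
abbreviation "winv w \<equiv> inv\<^bsub>free_group S\<^esub> w"

definition cyl :: "'a bpoint \<Rightarrow> nat \<Rightarrow> 'a bpoint set" where
  "cyl x n = {y \<in> X. \<forall>i<n. y i = x i}"

definition first_letter :: "'a letter \<Rightarrow> 'a bpoint set" where
  "first_letter a = {x \<in> X. x 0 = a}"

lemma finite_letters: "finite (letters S)"
  using finite_S by (simp add: letters_def)

lemma carrier_free_group: "carrier (free_group S) = W"
  by (simp add: free_group_def)

lemma countable_W: "countable W"
proof (rule countable_subset)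
  show "countable (lists (letters S))"
    using finite_letters by (simp add: countable_finite)
qed (auto simp: reduced_words_def)

lemma Nil_W [simp]: "[] \<in> W"
  by (simp add: reduced_words_def)

lemma word_act_Nil [simp]: "word_act [] x = x"
  by (simp add: word_act_def)

lemma winv_W: "w \<in> W \<Longrightarrow> winv w \<in> W"
  using group.inv_closed[OF group_free_group, of w S] by (simp add: carrier_free_group)

lemma winv_winv: "w \<in> W \<Longrightarrow> winv (winv w) = w"
  using group.inv_inv[OF group_free_group, of w S] by (simp add: carrier_free_group)

lemma mult_W: "v \<in> W \<Longrightarrow> w \<in> W \<Longrightarrow> v \<otimes>\<^bsub>free_group S\<^esub> w \<in> W"
  using monoid.m_closed[OF group.is_monoid[OF group_free_group], of v S w] by (simp add: carrier_free_group)

lemma act_X: "w \<in> W \<Longrightarrow> x \<in> X \<Longrightarrow> word_act w x \<in> X"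
  by (rule word_act_boundary)

lemma act_inv:
  assumes "w \<in> W" "x \<in> X"
  shows "word_act (winv w) (word_act w x) = x" "word_act w (word_act (winv w) x) = x"
proof -
  have one: "\<one>\<^bsub>free_group S\<^esub> = []" by (simp add: free_group_def)
  show "word_act (winv w) (word_act w x) = x"
    using word_act_mult[OF winv_W[OF assms(1)] assms] group.l_inv[OF group_free_group, of w S] assms(1)
    by (simp add: carrier_free_group one)
  show "word_act w (word_act (winv w) x) = x"
    using word_act_mult[OF assms(1) winv_W[OF assms(1)] assms(2)] group.r_inv[OF group_free_group, of w S] assms(1)
    by (simp add: carrier_free_group one)
qed

lemma act_image:
  assumes w: "w \<in> W" and C: "C \<subseteq> X"
  shows "word_act w ` C = {x \<in> X. word_act (winv w) x \<in> C}"
proof (intro equalityI subsetI)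
  fix x assume "x \<in> word_act w ` C"
  then show "x \<in> {x \<in> X. word_act (winv w) x \<in> C}"
    using w C by (auto simp: act_X act_inv subset_iff)
next
  fix x assume "x \<in> {x \<in> X. word_act (winv w) x \<in> C}"
  then have "x = word_act w (word_act (winv w) x)" "word_act (winv w) x \<in> C"
    using w by (auto simp: act_inv)
  then show "x \<in> word_act w ` C" by (rule image_eqI)
qed

lemma cyl_self: "x \<in> X \<Longrightarrow> x \<in> cyl x n"
  by (simp add: cyl_def)

lemma cyl_antimono: "m \<le> n \<Longrightarrow> cyl x n \<subseteq> cyl x m"
  by (auto simp: cyl_def)

lemma cyl_eq: "y \<in> cyl x n \<Longrightarrow> cyl y n = cyl x n"
  by (auto simp: cyl_def)

lemma topspace_boundary [simp]: "topspace (boundary_topology S) = X"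
  by (auto simp: boundary_topology_def boundary_def)

lemma openin_cyl: "openin (boundary_topology S) (cyl x n)"
\<comment> \<open>The base point is an arbitrary sequence; nonemptiness is what makes its first
  \<open>n\<close> entries letters.\<close>
proof (cases "cyl x n = {}")
  case False
  then obtain z where "z \<in> cyl x n" by blast
  then have x: "x i \<in> letters S" if "i < n" for i
    using that by (auto simp: cyl_def boundary_def) metis
  let ?U = "\<lambda>i. if i < n then {x i} else letters S"
  have "{i \<in> UNIV. ?U i \<noteq> letters S} \<subseteq> {..<n}" by auto
  then have fin: "finite {i \<in> UNIV. ?U i \<noteq> topspace (discrete_topology (letters S))}"
    unfolding topspace_discrete_topology by (rule finite_subset) simp
  have "openin (product_topology (\<lambda>_. discrete_topology (letters S)) UNIV) (PiE UNIV ?U)"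
    unfolding openin_PiE_gen using fin x by (intro disjI2 conjI ballI) auto
  moreover have "cyl x n = PiE UNIV ?U \<inter> X"
  proof (intro equalityI subsetI)
    fix y assume "y \<in> cyl x n"
    then show "y \<in> PiE UNIV ?U \<inter> X"
      by (auto simp: cyl_def boundary_def PiE_UNIV_domain)
  next
    fix y assume y: "y \<in> PiE UNIV ?U \<inter> X"
    then have "y i \<in> ?U i" for i by blast
    then show "y \<in> cyl x n"
      using y by (auto simp: cyl_def) (metis singletonD)
  qed
  ultimately show ?thesis
    unfolding boundary_topology_def openin_subtopology by blast
qed simp

text \<open>A basic open set of the product constrains finitely many coordinates, so cylinders form
  a base. Afterwards the product topology itself reappears only in the proof of compactness.\<close>

lemma openin_boundary_iff:
  "openin (boundary_topology S) U \<longleftrightarrow> U \<subseteq> X \<and> (\<forall>x\<in>U. \<exists>n. cyl x n \<subseteq> U)"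
proof
  assume U: "openin (boundary_topology S) U"
  then have UX: "U \<subseteq> X" using openin_subset by fastforce
  obtain V where V: "openin (product_topology (\<lambda>_. discrete_topology (letters S)) UNIV) V" "U = V \<inter> X"
    using U by (auto simp: boundary_topology_def openin_subtopology)
  have "\<exists>n. cyl x n \<subseteq> U" if x: "x \<in> U" for x
  proof -
    have "\<exists>F. finite {i \<in> UNIV. F i \<noteq> letters S} \<and> x \<in> PiE UNIV F \<and> PiE UNIV F \<subseteq> V"
      using V x unfolding openin_product_topology_alt by fastforce
    then obtain F where F: "finite {i. F i \<noteq> letters S}" "x \<in> PiE UNIV F" "PiE UNIV F \<subseteq> V"
      by auto
    obtain n where n: "\<forall>i\<in>{i. F i \<noteq> letters S}. i < n"
      using F(1) finite_nat_set_iff_bounded by blast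
    have "cyl x n \<subseteq> U"
    proof
      fix y assume y: "y \<in> cyl x n"
      have "y i \<in> F i" for i
      proof (cases "i < n")
        case True
        then show ?thesis using y F(2) by (auto simp: cyl_def PiE_def)
      next
        case False
        then have "F i = letters S" using n by auto
        then show ?thesis using y by (auto simp: cyl_def boundary_def)
      qed
      then show "y \<in> U" using F(3) V(2) y by (auto simp: cyl_def)
    qed
    then show ?thesis by blast
  qed
  with UX show "U \<subseteq> X \<and> (\<forall>x\<in>U. \<exists>n. cyl x n \<subseteq> U)" by blast
next
  assume U: "U \<subseteq> X \<and> (\<forall>x\<in>U. \<exists>n. cyl x n \<subseteq> U)"
  show "openin (boundary_topology S) U"
  proof (subst openin_subopen, intro ballI)
    fix x assume "x \<in> U"
    then show "\<exists>T. openin (boundary_topology S) T \<and> x \<in> T \<and> T \<subseteq> U"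
      using U openin_cyl cyl_self by blast
  qed
qed

section \<open>Clopen sets\<close>

definition clopen :: "'a bpoint set \<Rightarrow> bool" where
  "clopen C \<longleftrightarrow> openin (boundary_topology S) C \<and> openin (boundary_topology S) (X - C)"

lemma clopen_iff:
  "clopen C \<longleftrightarrow> C \<subseteq> X \<and> (\<forall>x\<in>X. \<exists>n. cyl x n \<subseteq> C \<or> cyl x n \<subseteq> X - C)"
proof
  show "clopen C \<Longrightarrow> C \<subseteq> X \<and> (\<forall>x\<in>X. \<exists>n. cyl x n \<subseteq> C \<or> cyl x n \<subseteq> X - C)"
    unfolding clopen_def openin_boundary_iff by blast
  assume *: "C \<subseteq> X \<and> (\<forall>x\<in>X. \<exists>n. cyl x n \<subseteq> C \<or> cyl x n \<subseteq> X - C)"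
  have "\<exists>n. cyl x n \<subseteq> C" if "x \<in> C" for x
    using * that cyl_self by blast
  moreover have "\<exists>n. cyl x n \<subseteq> X - C" if "x \<in> X - C" for x
    using * that cyl_self by blast
  ultimately show "clopen C"
    unfolding clopen_def openin_boundary_iff using * by blast
qed

lemma clopen_subset: "clopen C \<Longrightarrow> C \<subseteq> X"
  by (simp add: clopen_iff)

lemma clopen_X: "clopen X"
  by (auto simp: clopen_iff cyl_def)

lemma clopen_empty: "clopen {}"
  by (auto simp: clopen_iff cyl_def)

lemma clopen_diff: "clopen C \<Longrightarrow> clopen (X - C)"
  by (simp add: clopen_def double_diff openin_subset)
    (metis Diff_Diff_Int inf.absorb2 openin_subset topspace_boundary)

lemma clopen_Un: "clopen C \<Longrightarrow> clopen D \<Longrightarrow> clopen (C \<union> D)"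
  unfolding clopen_def by (auto simp: Diff_Un)

lemma clopen_UN: "finite I \<Longrightarrow> (\<And>i. i \<in> I \<Longrightarrow> clopen (C i)) \<Longrightarrow> clopen (\<Union>i\<in>I. C i)"
  by (induction rule: finite_induct) (auto simp: clopen_empty clopen_Un)

lemma clopen_cyl: "clopen (cyl x n)"
proof -
  have "cyl y n \<subseteq> cyl x n \<or> cyl y n \<subseteq> X - cyl x n" for y
    by (auto simp: cyl_def)
  moreover have "cyl x n \<subseteq> X" by (auto simp: cyl_def)
  ultimately show ?thesis
    unfolding clopen_iff by blast
qed

lemma clopen_first_letter: "clopen (first_letter a)"
proof (cases "first_letter a = {}")
  case False
  then obtain x where "x \<in> first_letter a" by blast
  then have "first_letter a = cyl x 1" by (auto simp: first_letter_def cyl_def)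
  then show ?thesis by (simp add: clopen_cyl)
qed (simp add: clopen_empty)

text \<open>Acting by a letter may delete one, so a prefix of the image is determined by a slightly
  longer prefix of the point; two extra letters are ample.\<close>

lemma letter_act_cyl:
  assumes a: "a \<in> letters S" and x: "x \<in> X" and y: "y \<in> cyl x (n + 2)"
  shows "letter_act a y \<in> cyl (letter_act a x) n"
proof -
  have "letter_act a y \<in> X" using a y by (auto simp: cyl_def intro: letter_act_boundary)
  moreover have "letter_act a y i = letter_act a x i" if "i < n" for i
    using y that by (auto simp: cyl_def letter_act_def split: nat.split)
  ultimately show ?thesis by (simp add: cyl_def)
qed

lemma word_act_cyl:
  assumes w: "w \<in> lists (letters S)" and x: "x \<in> X" and y: "y \<in> cyl x (n + 2 * length w)"
  shows "word_act w x \<in> X \<and> word_act w y \<in> cyl (word_act w x) n"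
  using w y
proof (induction w arbitrary: n)
  case Nil
  then show ?case using x by simp
next
  case (Cons a w)
  have "word_act w x \<in> X \<and> word_act w y \<in> cyl (word_act w x) (n + 2)"
    using Cons.prems by (intro Cons.IH) (simp add: algebra_simps)
  then show ?case
    using Cons letter_act_cyl[of a "word_act w x" "word_act w y" n]
    by (simp add: word_act_def letter_act_boundary)
qed

lemma openin_act_vimage:
  assumes w: "w \<in> W" and U: "openin (boundary_topology S) U"
  shows "openin (boundary_topology S) {x \<in> X. word_act w x \<in> U}"
  unfolding openin_boundary_iff
proof (intro conjI ballI)
  fix x assume "x \<in> {x \<in> X. word_act w x \<in> U}"
  then have x: "x \<in> X" "word_act w x \<in> U" by auto
  then obtain n where n: "cyl (word_act w x) n \<subseteq> U"
    using U by (auto simp: openin_boundary_iff)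
  have "cyl x (n + 2 * length w) \<subseteq> {x \<in> X. word_act w x \<in> U}"
    using word_act_cyl[of w x _ n] w x n by (auto simp: reduced_words_def cyl_def[of x])
  then show "\<exists>n. cyl x n \<subseteq> {x \<in> X. word_act w x \<in> U}" by blast
qed auto

lemma clopen_act:
  assumes w: "w \<in> W" and C: "clopen C"
  shows "clopen (word_act w ` C)"
proof -
  have "X - word_act w ` C = {x \<in> X. word_act (winv w) x \<in> X - C}"
    using w C by (auto simp: act_image clopen_subset act_X winv_W)
  moreover have "openin (boundary_topology S) \<dots>"
    using C by (intro openin_act_vimage winv_W w) (simp add: clopen_def)
  moreover have "openin (boundary_topology S) (word_act w ` C)"
    unfolding act_image[OF w clopen_subset[OF C]]
    using C by (intro openin_act_vimage winv_W w) (simp add: clopen_def)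
  ultimately show ?thesis by (simp add: clopen_def)
qed

section \<open>Cylinders as translates, and compactness\<close>

text \<open>Since \<open>y\<close> begins with the letter that follows the prefix in
  \<open>x\<close>, the concatenation is reduced and no cancellation occurs.\<close>

lemma act_concat:
  "x \<in> X \<Longrightarrow> y \<in> X \<Longrightarrow> y 0 = x n \<Longrightarrow>
    word_act (map x [0..<n]) y = (\<lambda>i. if i < n then x i else y (i - n))"
proof (induction n arbitrary: x)
  case 0
  then show ?case by (simp add: fun_eq_iff)
next
  case (Suc n)
  let ?x = "\<lambda>i. x (Suc i)"
  have "?x \<in> X" using Suc.prems(1) by (simp add: boundary_def)
  then have IH: "word_act (map ?x [0..<n]) y = (\<lambda>i. if i < n then ?x i else y (i - n))"
    using Suc by blast
  have "map x [0..<Suc n] = x 0 # map ?x [0..<n]"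
    by (simp add: upt_conv_Cons map_Suc_upt[symmetric] del: upt_Suc)
  moreover have "(if 0 < n then ?x 0 else y (0 - n)) \<noteq> letter_inv (x 0)"
    using Suc.prems by (auto simp: boundary_def)
  ultimately show ?case
    by (auto simp: word_act_def[of "_ # _"] word_act_def[symmetric] IH letter_act_def fun_eq_iff split: nat.split)
qed

lemma map_prefix_W: "x \<in> X \<Longrightarrow> map x [0..<n] \<in> W"
  by (auto simp: reduced_words_def boundary_def successively_conv_nth)

text \<open>By \<open>act_concat\<close> the first \<open>n\<close> letters split off as a
  translating word. This reduces the study of \<theta> on cylinders to the projections of
  first-letter sets.\<close>

lemma cyl_Suc:
  assumes x: "x \<in> X"
  shows "cyl x (Suc n) = word_act (map x [0..<n]) ` first_letter (x n)"
proof (intro equalityI subsetI)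
  fix z assume "z \<in> word_act (map x [0..<n]) ` first_letter (x n)"
  then obtain y where y: "y \<in> X" "y 0 = x n" "z = word_act (map x [0..<n]) y"
    by (auto simp: first_letter_def)
  then show "z \<in> cyl x (Suc n)"
    using act_concat[OF x y(1,2)] act_X[OF map_prefix_W[OF x, of n] y(1)] y
    by (auto simp: cyl_def less_Suc_eq)
next
  fix z assume z: "z \<in> cyl x (Suc n)"
  define y where "y = (\<lambda>i. z (i + n))"
  have y: "y \<in> X" "y 0 = x n" using z by (auto simp: y_def cyl_def boundary_def)
  have "z = word_act (map x [0..<n]) y"
    unfolding act_concat[OF x y] using z by (auto simp: y_def cyl_def fun_eq_iff)
  then show "z \<in> word_act (map x [0..<n]) ` first_letter (x n)"
    using y by (auto simp: first_letter_def)
qed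

text \<open>A failure of reducedness shows in two adjacent letters, so the boundary is closed in a
  product of finite discrete spaces.\<close>

lemma compact_boundary: "compact_space (boundary_topology S)"
proof -
  let ?P = "product_topology (\<lambda>_::nat. discrete_topology (letters S)) UNIV"
  have "compact_space ?P"
    using finite_letters by (simp add: compact_space_product_topology compact_space_discrete_topology)
  moreover have "closedin ?P X"
  proof -
    have "openin ?P (topspace ?P - X)"
      unfolding openin_product_topology_alt
    proof
      fix x assume x: "x \<in> topspace ?P - X"
      then obtain n where n: "x (Suc n) = letter_inv (x n)" and xl: "\<And>i. x i \<in> letters S"
        by (auto simp: boundary_def)
      let ?U = "\<lambda>i. if i < Suc (Suc n) then {x i} else letters S"
      have "{i \<in> UNIV. ?U i \<noteq> letters S} \<subseteq> {..<Suc (Suc n)}" by auto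
      then have "finite {i \<in> UNIV. ?U i \<noteq> letters S}" by (rule finite_subset) simp
      moreover have "x \<in> PiE UNIV ?U" using xl by auto
      moreover have "PiE UNIV ?U \<subseteq> topspace ?P - X"
      proof
        fix y assume y: "y \<in> PiE UNIV ?U"
        have yU: "y i \<in> ?U i" for i using y by blast
        from yU[of n] yU[of "Suc n"] have "y (Suc n) = letter_inv (y n)" using n by simp
        moreover have "y i \<in> letters S" for i using yU[of i] xl[of i] by (cases "i < Suc (Suc n)") simp_all
        ultimately show "y \<in> topspace ?P - X" by (auto simp: boundary_def)
      qed
      ultimately show "\<exists>U. finite {i \<in> UNIV. U i \<noteq> topspace (discrete_topology (letters S))} \<and>
        (\<forall>i\<in>UNIV. openin (discrete_topology (letters S)) (U i)) \<and> x \<in> PiE UNIV U \<and> PiE UNIV U \<subseteq> topspace ?P - X"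
        using xl by (intro exI[of _ ?U]) auto
    qed
    moreover have "X \<subseteq> topspace ?P" by (auto simp: boundary_def)
    ultimately show ?thesis by (simp add: closedin_def)
  qed
  ultimately show ?thesis
    unfolding boundary_topology_def
    by (simp add: compact_space_subtopology closedin_compact_space)
qed

text \<open>A Lebesgue number argument: finitely many cylinders cover the boundary, and as longer
  cylinders refine shorter ones, the maximal length works everywhere.\<close>

lemma uniformly_locally_constant:
  assumes f: "continuous_map (boundary_topology S) euclidean (f :: 'a bpoint \<Rightarrow> complex)" and e: "e > 0"
  shows "\<exists>n. \<forall>x\<in>X. \<forall>y\<in>cyl x n. dist (f y) (f x) < e"
proof -
  have "\<exists>n. cyl x n \<subseteq> {y \<in> X. dist (f y) (f x) < e / 2}" if x: "x \<in> X" for x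
  proof -
    have "openin (boundary_topology S) {y \<in> topspace (boundary_topology S). f y \<in> ball (f x) (e/2)}"
      using f by (intro openin_continuous_map_preimage) auto
    then have "openin (boundary_topology S) {y \<in> X. dist (f y) (f x) < e / 2}"
      by (simp add: dist_commute)
    moreover have "x \<in> {y \<in> X. dist (f y) (f x) < e / 2}" using x e by simp
    ultimately show ?thesis unfolding openin_boundary_iff by blast
  qed
  then have "\<forall>x\<in>X. \<exists>n. cyl x n \<subseteq> {y \<in> X. dist (f y) (f x) < e / 2}" by blast
  from bchoice[OF this] obtain N where N: "\<And>x. x \<in> X \<Longrightarrow> cyl x (N x) \<subseteq> {y \<in> X. dist (f y) (f x) < e / 2}"
    by blast
  have "\<exists>\<F>. finite \<F> \<and> \<F> \<subseteq> (\<lambda>x. cyl x (N x)) ` X \<and> topspace (boundary_topology S) \<subseteq> \<Union>\<F>"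
  proof -
    have "(\<forall>U\<in>(\<lambda>x. cyl x (N x)) ` X. openin (boundary_topology S) U)"
      by (auto simp: openin_cyl)
    moreover have "topspace (boundary_topology S) \<subseteq> \<Union>((\<lambda>x. cyl x (N x)) ` X)"
      using cyl_self by auto
    ultimately show ?thesis
      using compact_boundary unfolding compact_space_alt by meson
  qed
  then obtain \<F> where \<F>: "finite \<F>" "\<F> \<subseteq> (\<lambda>x. cyl x (N x)) ` X" "X \<subseteq> \<Union>\<F>"
    by auto
  from finite_subset_image[OF \<F>(1,2)] obtain F where "F \<subseteq> X" "finite F" "\<F> = (\<lambda>x. cyl x (N x)) ` F"
    by blast
  then have F: "finite F" "F \<subseteq> X" "X \<subseteq> (\<Union>x\<in>F. cyl x (N x))"
    using \<F>(3) by auto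
  define n where "n = Max (insert 0 (N ` F))"
  have "dist (f y) (f x) < e" if x: "x \<in> X" and y: "y \<in> cyl x n" for x y
  proof -
    obtain z where z: "z \<in> F" "x \<in> cyl z (N z)" using F(3) x by auto
    have "N z \<le> n" using z(1) F(1) by (simp add: n_def)
    then have "y \<in> cyl x (N z)" using y cyl_antimono by blast
    then have "y \<in> cyl z (N z)" using cyl_eq[OF z(2)] by simp
    then have "dist (f y) (f z) < e / 2" "dist (f x) (f z) < e / 2"
      using N[of z] z F(2) by auto
    then show ?thesis by (rule dist_triangle_half_l)
  qed
  then show ?thesis by blast
qed

section \<open>First letters and tripods\<close>

text \<open>As \<open>w\<close> is reduced, cancellation could start only at its last letter; if it
  does not start there, all of \<open>w\<close> survives as a prefix.\<close>

lemma act_first_letter: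
  "w \<in> W \<Longrightarrow> w \<noteq> [] \<Longrightarrow> x \<in> X \<Longrightarrow> x 0 \<noteq> letter_inv (last w) \<Longrightarrow> word_act w x 0 = hd w"
proof (induction w)
  case (Cons a w)
  have w: "w \<in> W" using Cons.prems(1) by (auto simp: reduced_words_def successively_Cons)
  have "word_act w x 0 \<noteq> letter_inv a"
  proof (cases "w = []")
    case False
    then have "word_act w x 0 = hd w" using Cons w by simp
    also have "hd w \<noteq> letter_inv a"
      using Cons.prems(1) False by (auto simp: reduced_words_def successively_Cons)
    finally show ?thesis .
  qed (use Cons.prems in simp)
  then show ?case by (simp add: word_act_def letter_act_def)
qed simp

text \<open>A triple of boundary points spans a tripod in the tree; the three first letters are
  distinct precisely when its center is the identity.\<close>

lemma tripod_center:
  assumes w: "w \<in> W" and pts: "p \<in> X" "q \<in> X" "r \<in> X"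
    and dist: "p 0 = x" "q 0 = y" "r 0 = z" "x \<noteq> y" "y \<noteq> z" "x \<noteq> z"
    and dist': "word_act w p 0 = x" "word_act w q 0 = y" "word_act w r 0 = z"
  shows "w = []"
proof (rule ccontr)
  assume "w \<noteq> []"
  \<comment> \<open>At most one of three distinct first letters cancels the last letter of
    \<open>w\<close>; the other two points would both be sent to words beginning with
    \<open>hd w\<close>.\<close>
  note * = act_first_letter[OF w this]
  show False using *[OF pts(1)] *[OF pts(2)] *[OF pts(3)] dist dist' by metis
qed

text \<open>Rank at least 2 provides four letters.\<close>

lemma exists_third_letter:
  obtains z where "z \<in> letters S" "z \<noteq> x" "z \<noteq> y"
proof -
  have "card (letters S) = card S * 2"
    by (simp add: letters_def card_cartesian_product)
  then have "card {x, y} < card (letters S)"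
    using card_S card_insert_le_m1[of 2 "{y}" x] by (simp add: card_insert_if)
  then have "\<not> letters S \<subseteq> {x, y}"
    by (metis card_mono finite.emptyI finite.insertI not_le)
  then show thesis using that by auto
qed

end

section \<open>Rigidity of equivariant measure-valued maps\<close>

lemma AE_pair_fst:
  assumes "AE x in M. P x" and "sigma_finite_measure N"
  shows "AE z in M \<Otimes>\<^sub>M N. P (fst z)"
proof -
  interpret N: sigma_finite_measure N by fact
  from assms(1) obtain Z where Z: "{x \<in> space M. \<not> P x} \<subseteq> Z" "emeasure M Z = 0" "Z \<in> sets M"
    by (rule AE_E)
  have "Z \<times> space N \<in> null_sets (M \<Otimes>\<^sub>M N)"
    using Z by (auto simp: null_sets_def N.emeasure_pair_measure_Times)
  then show ?thesis
    using Z(1) by (intro AE_I'[of "Z \<times> space N"]) (auto simp: space_pair_measure)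
qed

text \<open>If each of the finitely many \<open>f v\<close> left the decreasing sequence at some
  stage, none would remain at the latest of these stages.\<close>

lemma finite_pigeonhole_antimono:
  assumes fin: "finite V" and anti: "\<And>n. A (Suc n) \<subseteq> A n" and ex: "\<And>n. \<exists>v\<in>V. f v \<in> A n"
  shows "\<exists>v\<in>V. \<forall>n::nat. f v \<in> A n"
proof (rule ccontr)
  assume "\<not> ?thesis"
  then have "\<forall>v\<in>V. \<exists>n. f v \<notin> A n" by blast
  then obtain k where k: "\<And>v. v \<in> V \<Longrightarrow> f v \<notin> A (k v)"
    using bchoice[of V "\<lambda>v n. f v \<notin> A n"] by blast
  define N where "N = Max (insert 0 (k ` V))"
  obtain v where v: "v \<in> V" "f v \<in> A N" using ex by blast
  have "k v \<le> N" using v fin by (simp add: N_def)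
  then have "A N \<subseteq> A (k v)" using anti by (rule lift_Suc_antimono_le[rotated])
  with v k show False by blast
qed

locale doubly_ergodic_boundary = free_boundary S for S :: "'a set" +
  fixes \<mu> :: "'a bpoint measure"
  assumes bm: "boundary_measure S \<mu>"
    and qi: "quasi_invariant (free_group S) word_act \<mu>"
    and de: "doubly_ergodic (free_group S) word_act \<mu>"
begin

sublocale sigma_finite_measure \<mu>
  using bm by (simp add: boundary_measure_def)

sublocale pair: pair_sigma_finite \<mu> \<mu> ..

lemma space_\<mu>: "space \<mu> = X"
  using bm by (simp add: boundary_measure_def)

lemma open_measurable: "openin (boundary_topology S) U \<Longrightarrow> U \<in> sets \<mu>"
  using bm by (simp add: boundary_measure_def)

lemma clopen_measurable: "clopen C \<Longrightarrow> C \<in> sets \<mu>"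
  by (simp add: clopen_def open_measurable)

lemma act_measurable: "w \<in> W \<Longrightarrow> word_act w \<in> measurable \<mu> \<mu>"
proof -
  assume w: "w \<in> W"
  have "sets \<mu> = sets (sigma X {U. openin (boundary_topology S) U})"
  proof -
    have "{U. openin (boundary_topology S) U} \<subseteq> Pow X"
      using openin_subset by fastforce
    then show ?thesis using bm by (simp add: boundary_measure_def)
  qed
  moreover have "word_act w \<in> measurable \<mu> (sigma X {U. openin (boundary_topology S) U})"
  proof (rule measurable_measure_of)
    show "{U. openin (boundary_topology S) U} \<subseteq> Pow X"
      using openin_subset by fastforce
    show "word_act w \<in> space \<mu> \<rightarrow> X"
      using w by (auto simp: space_\<mu> act_X)
    fix U assume "U \<in> {U. openin (boundary_topology S) U}"
    then have "openin (boundary_topology S) {x \<in> X. word_act w x \<in> U}"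
      using w by (intro openin_act_vimage) auto
    then show "word_act w -` U \<inter> space \<mu> \<in> sets \<mu>"
      by (auto simp: space_\<mu> Int_def vimage_def conj_commute intro!: open_measurable)
  qed
  ultimately show ?thesis by (simp cong: measurable_cong_sets)
qed

text \<open>An exceptional null set is translated by the inverse word and stays null by
  quasi-invariance.\<close>

lemma act_AE:
  assumes w: "w \<in> W" and P: "AE x in \<mu>. P x"
  shows "AE x in \<mu>. P (word_act w x)"
proof -
  from P obtain Z where Z: "{x \<in> space \<mu>. \<not> P x} \<subseteq> Z" "emeasure \<mu> Z = 0" "Z \<in> sets \<mu>"
    by (rule AE_E)
  have ZX: "Z \<subseteq> X" using sets.sets_into_space[OF Z(3)] by (simp add: space_\<mu>)
  have "Z \<in> null_sets \<mu>" using Z by auto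
  then have "word_act (winv w) ` Z \<in> null_sets \<mu>"
    using qi winv_W[OF w] Z(3) by (auto simp: quasi_invariant_def carrier_free_group)
  moreover have "word_act (winv w) ` Z = {x \<in> X. word_act w x \<in> Z}"
    using act_image[OF winv_W[OF w] ZX] w by (simp add: winv_winv)
  ultimately show ?thesis
    using Z(1) w by (intro AE_I'[of "{x \<in> X. word_act w x \<in> Z}"]) (auto simp: space_\<mu> act_X)
qed

lemma emeasure_X: "emeasure \<mu> X \<noteq> 0"
  using bm unfolding boundary_measure_def space_\<mu> by blast

text \<open>Two translates of \<open>first_letter z\<close> cover the boundary: a point not starting
  with the inverse of \<open>z\<close> enters the set under \<open>z\<close>, and any other point
  does so once another letter has been put in front. If the set were null, quasi-invariance would
  make \<mu> vanish.\<close>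

lemma first_letter_not_null:
  assumes z: "z \<in> letters S"
  shows "emeasure \<mu> (first_letter z) \<noteq> 0"
proof
  assume 0: "emeasure \<mu> (first_letter z) = 0"
  \<comment> \<open>Since \<open>w\<close> is not the inverse of \<open>z\<close>, the inverse of
    \<open>w\<close> does not cancel against the point; since \<open>w\<close> is not
    \<open>z\<close>, the letter \<open>z\<close> does not cancel against the inverse of
    \<open>w\<close>.\<close>
  obtain w where w: "w \<in> letters S" "w \<noteq> z" "w \<noteq> letter_inv z"
    by (rule exists_third_letter)
  have W: "[letter_inv z] \<in> W" "[w] \<in> W" "[z] \<in> W"
    using z w by (auto simp: reduced_words_def)
  have m: "first_letter z \<in> sets \<mu>"
    by (intro clopen_measurable clopen_first_letter)
  have "AE x in \<mu>. x \<notin> first_letter z"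
    using 0 m by (intro AE_not_in) auto
  then have 1: "AE x in \<mu>. word_act [z] x \<notin> first_letter z"
    by (rule act_AE[OF W(3)])
  moreover have "AE x in \<mu>. word_act [z] (word_act [letter_inv w] x) \<notin> first_letter z"
    using w 1 by (intro act_AE[of "[letter_inv w]"]) (auto simp: reduced_words_def)
  ultimately have "AE x in \<mu>. False"
    using AE_space
  proof eventually_elim
    case (elim x)
    then have x: "x \<in> X" by (simp add: space_\<mu>)
    have "x 0 = letter_inv z"
    proof (rule ccontr)
      assume "x 0 \<noteq> letter_inv z"
      then have "word_act [z] x 0 = z" by (simp add: word_act_def letter_act_def)
      then show False using elim(1) act_X[OF W(3) x] by (simp add: first_letter_def)
    qed
    then have "word_act [letter_inv w] x 0 = letter_inv w"
      using w by (auto simp: word_act_def letter_act_def)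
    then have "word_act [z] (word_act [letter_inv w] x) 0 = z"
      using w by (auto simp: word_act_def letter_act_def letter_inv_def prod_eq_iff)
    moreover have "word_act [z] (word_act [letter_inv w] x) \<in> X"
      using w x by (intro act_X W) (auto simp: reduced_words_def)
    ultimately show False using elim(2) by (simp add: first_letter_def)
  qed
  then have "emeasure \<mu> (space \<mu>) = 0" by (simp add: AE_iff_null null_setsD1)
  then show False using emeasure_X by (simp add: space_\<mu>)
qed

section \<open>The diagonal action and ergodicity\<close>

abbreviation "act2 w \<equiv> map_prod (word_act w) (word_act w)"

lemma act2_image:
  assumes w: "w \<in> W" and A: "A \<subseteq> X \<times> X"
  shows "act2 w ` A = {z \<in> X \<times> X. act2 (winv w) z \<in> A}"
proof (intro equalityI subsetI)
  fix z assume "z \<in> act2 w ` A"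
  then show "z \<in> {z \<in> X \<times> X. act2 (winv w) z \<in> A}"
    using A w by (fastforce simp: act_X act_inv)
next
  fix z assume "z \<in> {z \<in> X \<times> X. act2 (winv w) z \<in> A}"
  then have "z = act2 w (act2 (winv w) z)" "act2 (winv w) z \<in> A"
    using w by (auto simp: act_inv)
  then show "z \<in> act2 w ` A" by (rule image_eqI)
qed

lemma act2_measurable: "w \<in> W \<Longrightarrow> act2 w \<in> measurable (\<mu> \<Otimes>\<^sub>M \<mu>) (\<mu> \<Otimes>\<^sub>M \<mu>)"
proof -
  assume [THEN act_measurable, measurable]: "w \<in> W"
  have "(\<lambda>z. (word_act w (fst z), word_act w (snd z))) \<in> measurable (\<mu> \<Otimes>\<^sub>M \<mu>) (\<mu> \<Otimes>\<^sub>M \<mu>)"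
    by measurable
  then show ?thesis by (simp add: map_prod_def split_beta')
qed

lemma act2_sets:
  assumes w: "w \<in> W" and A: "A \<in> sets (\<mu> \<Otimes>\<^sub>M \<mu>)"
  shows "act2 w ` A \<in> sets (\<mu> \<Otimes>\<^sub>M \<mu>)"
proof -
  have AX: "A \<subseteq> X \<times> X"
    using sets.sets_into_space[OF A] by (simp add: space_pair_measure space_\<mu>)
  have "act2 (winv w) -` A \<inter> space (\<mu> \<Otimes>\<^sub>M \<mu>) \<in> sets (\<mu> \<Otimes>\<^sub>M \<mu>)"
    using act2_measurable[OF winv_W[OF w]] A by (rule measurable_sets)
  moreover have "act2 w ` A = act2 (winv w) -` A \<inter> space (\<mu> \<Otimes>\<^sub>M \<mu>)"
    unfolding act2_image[OF w AX] by (auto simp: space_pair_measure space_\<mu>)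
  ultimately show ?thesis by simp
qed

text \<open>The union of all translates is measurable because the group is countable; it is
  invariant and contains the nonnull set \<open>A\<close>, so double ergodicity leaves only one
  alternative.\<close>

lemma saturation_conull:
  assumes A: "A \<in> sets (\<mu> \<Otimes>\<^sub>M \<mu>)" and nn: "A \<notin> null_sets (\<mu> \<Otimes>\<^sub>M \<mu>)"
  shows "AE z in \<mu> \<Otimes>\<^sub>M \<mu>. \<exists>v\<in>W. z \<in> act2 v ` A"
proof -
  let ?M = "\<mu> \<Otimes>\<^sub>M \<mu>"
  have AX: "A \<subseteq> X \<times> X"
    using sets.sets_into_space[OF A] by (simp add: space_pair_measure space_\<mu>)
  define Sat where "Sat = (\<Union>v\<in>W. act2 v ` A)"
  have Sat: "Sat \<in> sets ?M"
    unfolding Sat_def using countable_W act2_sets A by (intro sets.countable_UN'') auto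
  have Sat_def': "z \<in> Sat \<longleftrightarrow> (\<exists>v\<in>W. \<exists>a\<in>A. z = act2 v a)" for z
    by (simp only: Sat_def UN_iff image_iff)
  have sub: "act2 s ` Sat \<subseteq> Sat" if s: "s \<in> W" for s
  proof
    fix z assume "z \<in> act2 s ` Sat"
    then obtain t where t: "t \<in> Sat" "z = act2 s t" by (rule imageE)
    then obtain v a where va: "v \<in> W" "a \<in> A" "z = act2 s (act2 v a)"
      unfolding Sat_def' by blast
    have "a \<in> X \<times> X" using AX va(2) by blast
    then have "z = act2 (s \<otimes>\<^bsub>free_group S\<^esub> v) a"
      using va s by (cases a) (simp add: word_act_mult)
    then show "z \<in> Sat" unfolding Sat_def' using mult_W[OF s va(1)] va(2) by blast
  qed
  have SatX: "Sat \<subseteq> X \<times> X"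
    using sets.sets_into_space[OF Sat] by (simp add: space_pair_measure space_\<mu>)
  have inv: "act2 s ` Sat = Sat" if s: "s \<in> W" for s
  proof
    show "act2 s ` Sat \<subseteq> Sat" using s by (rule sub)
    show "Sat \<subseteq> act2 s ` Sat"
    proof
      fix z assume z: "z \<in> Sat"
      then have "act2 (winv s) z \<in> Sat" using sub[OF winv_W[OF s]] by blast
      then show "z \<in> act2 s ` Sat"
        unfolding act2_image[OF s SatX] using z SatX by blast
    qed
  qed
  have "A \<subseteq> Sat"
  proof
    fix a assume "a \<in> A"
    moreover have "a = act2 [] a" by (cases a) simp
    ultimately show "a \<in> Sat" unfolding Sat_def' using Nil_W by blast
  qed
  then have "Sat \<notin> null_sets ?M" using nn A null_sets_subset[of Sat ?M A] by blast
  then have "space ?M - Sat \<in> null_sets ?M"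
    using de Sat inv unfolding doubly_ergodic_def ergodic_def carrier_free_group by blast
  then have "AE z in ?M. z \<notin> space ?M - Sat" by (rule AE_not_in)
  then show ?thesis
    using AE_space by eventually_elim (auto simp: Sat_def)
qed

lemma singleton_measurable: "x \<in> X \<Longrightarrow> {x} \<in> sets \<mu>"
proof -
  assume x: "x \<in> X"
  have "{x} = (\<Inter>n. cyl x n)"
    using x by (auto simp: cyl_def)
  moreover have "(\<Inter>n. cyl x n) \<in> sets \<mu>"
    by (intro sets.countable_INT) (auto intro!: open_measurable openin_cyl)
  ultimately show ?thesis by simp
qed

text \<open>Almost every pair of boundary points lies in only finitely many translates of the
  rectangle \<open>G\<close>; by ergodicity it lies in a translate of every nonnull part of \<open>G\<close>.
  Shrinking these parts to a point forces a single orbit to be conull.\<close>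

lemma finite_return_contradiction:
  assumes G: "G \<in> sets (\<mu> \<Otimes>\<^sub>M \<mu>)" "G \<notin> null_sets (\<mu> \<Otimes>\<^sub>M \<mu>)"
    and off_diagonal: "\<And>x y. (x, y) \<in> G \<Longrightarrow> x \<noteq> y"
    and fin: "AE z in \<mu> \<Otimes>\<^sub>M \<mu>. finite {v \<in> W. act2 (winv v) z \<in> G}"
  shows False
proof -
  let ?M = "\<mu> \<Otimes>\<^sub>M \<mu>"
  have GX: "G \<subseteq> X \<times> X"
    using sets.sets_into_space[OF G(1)] by (simp add: space_pair_measure space_\<mu>)
  \<comment> \<open>\<open>R (g, n)\<close> is the part of \<open>G\<close> that agrees with
    \<open>g\<close> to depth \<open>n\<close> in both coordinates; for \<open>g\<close> in
    \<open>G\<close> these parts shrink to \<open>g\<close>.\<close>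
  define R where "R = (\<lambda>(g, n). G \<inter> (cyl (fst g) n \<times> cyl (snd g) n))"
  have R_sets: "R gn \<in> sets ?M" for gn
    using G(1) open_measurable[OF openin_cyl] by (cases gn) (auto simp: R_def)
  \<comment> \<open>A nonempty part is determined by two prefixes of length \<open>n\<close>, so
    there are countably many parts although the base points are not restricted to a countable
    set.\<close>
  have count: "countable (range R)"
  proof -
    let ?c = "\<lambda>(p, q). G \<inter> ({y \<in> X. map y [0..<length p] = p} \<times> {y \<in> X. map y [0..<length q] = q})"
    let ?L = "lists (letters S) \<times> lists (letters S)"
    have "range R \<subseteq> insert {} (?c ` ?L)"
    proof
      fix A assume "A \<in> range R"
      then obtain g n where A: "A = R (g, n)" by auto
      show "A \<in> insert {} (?c ` ?L)"
      proof (cases "A = {}")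
        case False
        then obtain h where h: "h \<in> A" by blast
        then have hX: "fst h \<in> X" "snd h \<in> X" "fst h \<in> cyl (fst g) n" "snd h \<in> cyl (snd g) n"
          using GX by (auto simp: A R_def)
        have eq: "cyl x n = {y \<in> X. map y [0..<length (map x [0..<n])] = map x [0..<n]}" for x :: "'a bpoint"
          by (auto simp: cyl_def)
        have "A = G \<inter> (cyl (fst h) n \<times> cyl (snd h) n)"
          using cyl_eq[OF hX(3)] cyl_eq[OF hX(4)] by (simp add: A R_def)
        also have "\<dots> = ?c (map (fst h) [0..<n], map (snd h) [0..<n])"
          unfolding eq[of "fst h"] eq[of "snd h"] by simp
        finally have "A = ?c (map (fst h) [0..<n], map (snd h) [0..<n])" .
        moreover have "(map (fst h) [0..<n], map (snd h) [0..<n]) \<in> ?L"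
          using hX(1,2) by (auto simp: boundary_def)
        ultimately show ?thesis by blast
      qed simp
    qed
    moreover have "countable ?L"
      using finite_letters by (intro countable_SIGMA countable_lists countable_finite) auto
    ultimately show ?thesis
      by (meson countable_image countable_insert countable_subset)
  qed
  \<comment> \<open>Otherwise countably many null parts would cover \<open>G\<close>.\<close>
  have "\<exists>g\<in>G. \<forall>n. R (g, n) \<notin> null_sets ?M"
  proof (rule ccontr)
    assume "\<not> ?thesis"
    then have "\<forall>g\<in>G. \<exists>n. R (g, n) \<in> null_sets ?M" by blast
    moreover have "g \<in> R (g, n)" if "g \<in> G" for g n
      using that GX cyl_self by (auto simp: R_def)
    ultimately have "G \<subseteq> \<Union>(range R \<inter> null_sets ?M)" by blast
    moreover have "\<Union>(range R \<inter> null_sets ?M) \<in> null_sets ?M"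
      using null_sets_UN'[of "range R \<inter> null_sets ?M" "\<lambda>A. A" ?M] count
      by (simp add: countable_Int1)
    ultimately have "G \<in> null_sets ?M"
      using G(1) null_sets_subset by blast
    with G(2) show False by simp
  qed
  then obtain g where g: "g \<in> G" "\<And>n. R (g, n) \<notin> null_sets ?M" by blast
  have ex: "AE z in ?M. \<forall>n. \<exists>v\<in>W. z \<in> act2 v ` R (g, n)"
    unfolding AE_all_countable using saturation_conull[OF R_sets g(2)] by blast
  have orbit: "AE z in ?M. \<exists>v\<in>W. z = act2 v g"
    using ex fin AE_space
  proof eventually_elim
    case (elim z)
    have zX: "z \<in> X \<times> X" using elim(3) by (simp add: space_pair_measure space_\<mu>)
    let ?V = "{v \<in> W. act2 (winv v) z \<in> G}"
    have RX: "R (g, n) \<subseteq> X \<times> X" for n using GX by (auto simp: R_def)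
    \<comment> \<open>All elements returning \<open>z\<close> to some \<open>R (g, n)\<close> lie in
      the finite set \<open>?V\<close>, so a single one works for every \<open>n\<close> and its
      inverse carries \<open>z\<close> exactly to \<open>g\<close>.\<close>
    have "\<exists>v\<in>?V. \<forall>n. act2 (winv v) z \<in> R (g, n)"
    proof (rule finite_pigeonhole_antimono[OF elim(2)])
      show "R (g, Suc n) \<subseteq> R (g, n)" for n
        by (auto simp: R_def cyl_def)
      show "\<exists>v\<in>?V. act2 (winv v) z \<in> R (g, n)" for n
      proof -
        obtain v where v: "v \<in> W" "z \<in> act2 v ` R (g, n)" using elim(1) by blast
        then have "act2 (winv v) z \<in> R (g, n)" using act2_image[OF v(1) RX] by blast
        moreover have "R (g, n) \<subseteq> G" by (auto simp: R_def)
        ultimately show ?thesis using v(1) by blast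
      qed
    qed
    then obtain v where v: "v \<in> W" "\<And>n. act2 (winv v) z \<in> R (g, n)" by blast
    have "fst (act2 (winv v) z) i = fst g i \<and> snd (act2 (winv v) z) i = snd g i" for i
      using v(2)[of "Suc i"] by (simp add: R_def mem_Times_iff cyl_def)
    then have "act2 (winv v) z = g" by (auto simp: prod_eq_iff fun_eq_iff)
    then have "z = act2 v g" using v(1) zX by (auto simp: act_inv)
    then show ?case using v(1) by blast
  qed
  have gX: "fst g \<in> X" "snd g \<in> X" and neq: "fst g \<noteq> snd g"
    using g(1) GX off_diagonal[of "fst g" "snd g"] by auto
  \<comment> \<open>A diagonal pair cannot lie on the orbit of the off-diagonal \<open>g\<close>, so
    the square of the mass of a point is zero. Without atoms a countable orbit is null, yet this one
    is conull.\<close>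
  have no_atom: "emeasure \<mu> {x} = 0" if x: "x \<in> X" for x
  proof -
    have "\<not> (\<exists>v\<in>W. (x, x) = act2 v g)"
    proof
      assume "\<exists>v\<in>W. (x, x) = act2 v g"
      then obtain v where v: "v \<in> W" "word_act v (fst g) = word_act v (snd g)"
        by (cases g) auto
      then have "fst g = snd g" using act_inv(1)[OF v(1)] gX by metis
      with neq show False by simp
    qed
    then have "AE z in ?M. z \<notin> {x} \<times> {x}"
      using orbit by (auto elim!: eventually_mono)
    moreover have "{x} \<times> {x} \<in> sets ?M"
      by (intro pair_measureI singleton_measurable x)
    ultimately have "emeasure ?M ({x} \<times> {x}) = 0"
      using AE_iff_measurable[of "{x} \<times> {x}" ?M "\<lambda>z. z \<notin> {x} \<times> {x}"] x
      by (auto simp: space_pair_measure space_\<mu>)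
    then show ?thesis
      using singleton_measurable[OF x] emeasure_pair_measure_Times[of "{x}" \<mu> "{x}"] by simp
  qed
  have "(\<Union>v\<in>W. {act2 v g}) \<in> null_sets ?M"
  proof (rule null_sets_UN'[OF countable_W])
    fix v assume v: "v \<in> W"
    have x: "word_act v (fst g) \<in> X" "word_act v (snd g) \<in> X" using v gX by (auto intro: act_X)
    have eq: "{act2 v g} = {word_act v (fst g)} \<times> {word_act v (snd g)}" by (cases g) auto
    show "{act2 v g} \<in> null_sets ?M"
      unfolding eq
      using pair_measureI[OF singleton_measurable[OF x(1)] singleton_measurable[OF x(2)]]
        emeasure_pair_measure_Times[OF singleton_measurable[OF x(1)] singleton_measurable[OF x(2)]]
        no_atom[OF x(1)] by (intro null_setsI) simp_all
  qed
  then have "AE z in ?M. z \<notin> (\<Union>v\<in>W. {act2 v g})" by (rule AE_not_in)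
  with orbit have "AE z in ?M. False" by eventually_elim auto
  then have "emeasure ?M (space ?M) = 0" by (simp add: AE_iff_null null_setsD1)
  then show False
    using emeasure_X emeasure_pair_measure_Times[of X \<mu> X] sets.top[of \<mu>]
    by (simp add: space_pair_measure space_\<mu>)
qed

text \<open>The hypothesis \<open>sum\<close> condenses what is known about the field of
  probabilities: over disjoint translates of \<open>first_letter y\<close> the translated values of
  \<open>p\<close> add up to at most the total mass. A lower bound for \<open>p\<close> on a nonnull
  set therefore limits the number of returns.\<close>

lemma equivariant_vanishing:
  assumes letters: "x \<in> letters S" "y \<in> letters S" "x \<noteq> y"
    and p [measurable]: "p \<in> borel_measurable \<mu>" and nonneg: "AE \<xi> in \<mu>. 0 \<le> p \<xi>"
    and sum: "\<And>V. finite V \<Longrightarrow> V \<subseteq> W \<Longrightarrow> disjoint_family_on (\<lambda>v. word_act v ` first_letter y) V \<Longrightarrow>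
      AE \<xi> in \<mu>. (\<Sum>v\<in>V. p (word_act (winv v) \<xi>)) \<le> (1::real)"
  shows "AE \<xi> in \<mu>. \<xi> \<in> first_letter x \<longrightarrow> p \<xi> = 0"
proof (rule ccontr)
  assume neg: "\<not> ?thesis"
  have [measurable]: "first_letter a \<in> sets \<mu>" for a
    by (intro clopen_measurable clopen_first_letter)
  \<comment> \<open>The thresholds \<open>1 / real (Suc n)\<close> exhaust the part of
    \<open>first_letter x\<close> where \<open>p\<close> is positive, so one of these sets is
    nonnull if the claim fails.\<close>
  define B where "B = (\<lambda>n::nat. {\<xi> \<in> space \<mu>. \<xi> \<in> first_letter x \<and> 1 / real (Suc n) < p \<xi>})"
  have B [measurable]: "B n \<in> sets \<mu>" for n unfolding B_def by measurable
  have "\<exists>n. B n \<notin> null_sets \<mu>"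
  proof (rule ccontr)
    assume "\<not> ?thesis"
    then have "\<forall>n. AE \<xi> in \<mu>. \<xi> \<notin> B n" using AE_not_in by blast
    then have "AE \<xi> in \<mu>. \<forall>n. \<xi> \<notin> B n" by (simp add: AE_all_countable)
    then have "AE \<xi> in \<mu>. \<xi> \<in> first_letter x \<longrightarrow> p \<xi> = 0"
      using nonneg AE_space
    proof eventually_elim
      case (elim \<xi>)
      show ?case
      proof (intro impI, rule ccontr)
        assume "\<xi> \<in> first_letter x" "p \<xi> \<noteq> 0"
        then have "0 < p \<xi>" using elim by simp
        then obtain n where "1 / real (Suc n) < p \<xi>"
          using reals_Archimedean[of "p \<xi>"] by (auto simp: inverse_eq_divide)
        then show False using elim \<open>\<xi> \<in> first_letter x\<close> by (auto simp: B_def)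
      qed
    qed
    with neg show False by simp
  qed
  then obtain n where n: "B n \<notin> null_sets \<mu>" by blast
  obtain z where z: "z \<in> letters S" "z \<noteq> x" "z \<noteq> y" by (rule exists_third_letter)
  define G where "G = B n \<times> first_letter z"
  \<comment> \<open>As there are countably many finite sets \<open>V\<close>, one null set serves
    all of them; the set of returning elements, to which the bound is applied, depends on the
    point.\<close>
  have count: "countable {V. finite V \<and> V \<subseteq> W}"
    using countable_W by (rule countable_Collect_finite_subset)
  have "AE \<xi> in \<mu>. \<forall>V\<in>{V. finite V \<and> V \<subseteq> W}. disjoint_family_on (\<lambda>v. word_act v ` first_letter y) V \<longrightarrow>
      (\<Sum>v\<in>V. p (word_act (winv v) \<xi>)) \<le> 1"
    unfolding AE_ball_countable[OF count]
  proof
    fix V assume "V \<in> {V. finite V \<and> V \<subseteq> W}"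
    then show "AE \<xi> in \<mu>. disjoint_family_on (\<lambda>v. word_act v ` first_letter y) V \<longrightarrow>
      (\<Sum>v\<in>V. p (word_act (winv v) \<xi>)) \<le> 1"
      using sum[of V] by (cases "disjoint_family_on (\<lambda>v. word_act v ` first_letter y) V") auto
  qed
  then have "AE c in \<mu> \<Otimes>\<^sub>M \<mu>. \<forall>V\<in>{V. finite V \<and> V \<subseteq> W}.
    disjoint_family_on (\<lambda>v. word_act v ` first_letter y) V \<longrightarrow> (\<Sum>v\<in>V. p (word_act (winv v) (fst c))) \<le> 1"
    by (rule AE_pair_fst) unfold_locales
  then have fin: "AE c in \<mu> \<Otimes>\<^sub>M \<mu>. finite {v \<in> W. act2 (winv v) c \<in> G}"
    using AE_space
  proof eventually_elim
    case (elim c)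
    have c: "fst c \<in> X" "snd c \<in> X" using elim(2) by (auto simp: space_pair_measure space_\<mu>)
    have "card F \<le> Suc n" if F: "F \<subseteq> {v \<in> W. act2 (winv v) c \<in> G}" "finite F" for F
    proof -
      have vG: "word_act (winv v) (fst c) \<in> B n" "word_act (winv v) (snd c) \<in> first_letter z" "v \<in> W"
        if "v \<in> F" for v
        using F that by (auto simp: G_def mem_Times_iff)
      have disj: "disjoint_family_on (\<lambda>v. word_act v ` first_letter y) F"
        unfolding disjoint_family_on_def
      proof (intro ballI impI, rule ccontr)
        fix v w assume vw: "v \<in> F" "w \<in> F" "v \<noteq> w"
          and "word_act v ` first_letter y \<inter> word_act w ` first_letter y \<noteq> {}"
        then obtain \<zeta> where \<zeta>: "\<zeta> \<in> word_act v ` first_letter y" "\<zeta> \<in> word_act w ` first_letter y" by blast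
        have vW: "v \<in> W" "w \<in> W" using vw vG by auto
        have fl: "first_letter y \<subseteq> X" by (auto simp: first_letter_def)
        have \<zeta>': "\<zeta> \<in> X" "word_act (winv v) \<zeta> \<in> first_letter y" "word_act (winv w) \<zeta> \<in> first_letter y"
          using \<zeta> act_image[OF vW(1) fl] act_image[OF vW(2) fl] by auto
        \<comment> \<open>\<open>s\<close> takes the triple seen from \<open>v\<close> to the triple
          seen from \<open>w\<close>. Both triples have first letters \<open>x\<close>,
          \<open>z\<close>, \<open>y\<close>, so \<open>s\<close> must be trivial.\<close>
        define s where "s = winv w \<otimes>\<^bsub>free_group S\<^esub> v"
        have s: "s \<in> W" unfolding s_def using vW by (intro mult_W winv_W)
        have sv: "word_act s (word_act (winv v) q) = word_act (winv w) q" if "q \<in> X" for q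
          unfolding s_def using that vW by (simp add: word_act_mult act_X winv_W act_inv)
        have "s = []"
        proof (rule tripod_center[OF s])
          show "word_act (winv v) (fst c) \<in> X" "word_act (winv v) (snd c) \<in> X" "word_act (winv v) \<zeta> \<in> X"
            using c \<zeta>' vW by (auto intro!: act_X winv_W)
          show "word_act (winv v) (fst c) 0 = x" "word_act (winv v) (snd c) 0 = z" "word_act (winv v) \<zeta> 0 = y"
            "word_act s (word_act (winv v) (fst c)) 0 = x" "word_act s (word_act (winv v) (snd c)) 0 = z"
            "word_act s (word_act (winv v) \<zeta>) 0 = y"
            using vG[OF vw(1)] vG[OF vw(2)] \<zeta>' c by (auto simp: sv B_def first_letter_def)
        qed (use z letters in auto)
        then have "w \<otimes>\<^bsub>free_group S\<^esub> s = w"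
          using vW by (simp add: free_group_def word_mult_Nil)
        moreover have "w \<otimes>\<^bsub>free_group S\<^esub> s = v"
          unfolding s_def using vW group.inv_solve_left[OF group_free_group, of "winv w \<otimes>\<^bsub>free_group S\<^esub> v" S w v]
          by (simp add: carrier_free_group mult_W winv_W)
        ultimately show False using vw by simp
      qed
      have "real (card F) * (1 / real (Suc n)) = (\<Sum>v\<in>F. 1 / real (Suc n))" by simp
      also have "\<dots> \<le> (\<Sum>v\<in>F. p (word_act (winv v) (fst c)))"
        using vG by (intro sum_mono) (auto simp: B_def less_imp_le)
      also have "\<dots> \<le> 1" using elim(1) F(2) vG(3) disj by blast
      finally show "card F \<le> Suc n" by (simp add: field_simps)
    qed
    then show ?case using finite_if_finite_subsets_card_bdd by blast
  qed
  show False
  proof (rule finite_return_contradiction[OF _ _ _ fin])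
    show "G \<in> sets (\<mu> \<Otimes>\<^sub>M \<mu>)" unfolding G_def by measurable
    show "G \<notin> null_sets (\<mu> \<Otimes>\<^sub>M \<mu>)"
      using n B[of n] first_letter_not_null[OF z(1)] by (auto simp: G_def null_sets_def emeasure_pair_measure_Times)
    show "a \<noteq> b" if "(a, b) \<in> G" for a b
      using that z by (auto simp: G_def B_def first_letter_def)
  qed
qed

end

section \<open>The regular representation of a crossed product\<close>

text \<open>Quasi-invariance enters in the form \<open>act_AE\<close>, and countability of the group
  lets measurability and null sets on the product be tested slice by slice.\<close>

locale measured_action = group G + sigma_finite_measure \<mu>
  for G :: "('g, 'b) monoid_scheme" (structure) and \<mu> :: "'x measure" +
  fixes act :: "'g \<Rightarrow> 'x \<Rightarrow> 'x"
  assumes countable_G: "countable (carrier G)"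
    and act_one: "x \<in> space \<mu> \<Longrightarrow> act \<one> x = x"
    and act_mult: "s \<in> carrier G \<Longrightarrow> t \<in> carrier G \<Longrightarrow> x \<in> space \<mu> \<Longrightarrow> act (s \<otimes> t) x = act s (act t x)"
    and act_measurable: "s \<in> carrier G \<Longrightarrow> act s \<in> measurable \<mu> \<mu>"
    and act_AE: "s \<in> carrier G \<Longrightarrow> AE x in \<mu>. P x \<Longrightarrow> AE x in \<mu>. P (act s x)"
begin

abbreviation N :: "('x \<times> 'g) measure" where
  "N \<equiv> \<mu> \<Otimes>\<^sub>M count_space (carrier G)"

abbreviation "gens \<equiv> cp_fun G act \<mu> ` Linfty \<mu> \<union> cp_unitary G \<mu> ` carrier G"

lemma act_space: "s \<in> carrier G \<Longrightarrow> x \<in> space \<mu> \<Longrightarrow> act s x \<in> space \<mu>"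
  using act_measurable by (rule measurable_space)

lemma act_inv_act:
  assumes "s \<in> carrier G" "x \<in> space \<mu>"
  shows "act (inv s) (act s x) = x" "act s (act (inv s) x) = x"
  using act_mult[of "inv s" s x] act_mult[of s "inv s" x] act_one assms by auto

sublocale C: sigma_finite_measure "count_space (carrier G)"
  using countable_G by (rule sigma_finite_measure_count_space_countable)

sublocale P: pair_sigma_finite \<mu> "count_space (carrier G)" ..

sublocale hilbert "L2 N" by (rule hilbert_L2)

abbreviation "H \<equiv> L2 N"
abbreviation "VN \<equiv> vn_crossed_product G act \<mu>"
abbreviation "\<pi> \<equiv> cp_fun G act \<mu>"

section \<open>Slices of the product with a countable group\<close>

lemma space_N: "space N = space \<mu> \<times> carrier G"
  by (simp add: space_pair_measure)

lemma measurable_N: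
  assumes "\<And>t. t \<in> carrier G \<Longrightarrow> (\<lambda>x. F (x, t)) \<in> measurable \<mu> K"
  shows "F \<in> measurable N K"
proof -
  have "(\<lambda>z. (\<lambda>t z. F (fst z, t)) (snd z) z) \<in> measurable N K"
  proof (rule measurable_compose_countable'[OF _ _ countable_G])
    show "(\<lambda>z. F (fst z, t)) \<in> measurable N K" if "t \<in> carrier G" for t
      using measurable_compose[OF measurable_fst assms[OF that]] .
  qed measurable
  then show ?thesis by simp
qed

lemma measurable_slice:
  assumes "F \<in> measurable N K" "t \<in> carrier G"
  shows "(\<lambda>x. F (x, t)) \<in> measurable \<mu> K"
proof -
  have "(\<lambda>x. (x, t)) \<in> measurable \<mu> N" using assms(2) by (intro measurable_Pair2') simp
  from measurable_compose[OF this assms(1)] show ?thesis .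
qed

lemma nn_integral_N:
  assumes "F \<in> borel_measurable N"
  shows "(\<integral>\<^sup>+z. F z \<partial>N) = (\<integral>\<^sup>+t. \<integral>\<^sup>+x. F (x, t) \<partial>\<mu> \<partial>count_space (carrier G))"
  using P.nn_integral_snd[OF assms] by simp

text \<open>Integration over the group is a sum of nonnegative terms, so each slice of a null set is
  null; conversely a countable union of null slices is null.\<close>

lemma AE_N: "(AE z in N. Q z) \<longleftrightarrow> (\<forall>t\<in>carrier G. AE x in \<mu>. Q (x, t))"
proof (intro iffI ballI)
  fix t assume Q: "AE z in N. Q z" and t: "t \<in> carrier G"
  from Q obtain Z where Z: "{z \<in> space N. \<not> Q z} \<subseteq> Z" "emeasure N Z = 0" "Z \<in> sets N"
    by (rule AE_E)
  have ind: "indicator Z \<in> borel_measurable N" using Z(3) by simp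
  have "(\<integral>\<^sup>+t. \<integral>\<^sup>+x. indicator Z (x, t) \<partial>\<mu> \<partial>count_space (carrier G)) = 0"
    using nn_integral_N[OF ind] Z(2,3) by simp
  then have "(\<integral>\<^sup>+x. indicator Z (x, t) \<partial>\<mu>) = 0"
    using t by (subst (asm) nn_integral_0_iff_AE) (auto simp: AE_count_space)
  then have "AE x in \<mu>. indicator Z (x, t) = (0::ennreal)"
    by (subst (asm) nn_integral_0_iff_AE) (use measurable_slice[OF ind t] in auto)
  then show "AE x in \<mu>. Q (x, t)"
    using AE_space by eventually_elim (use Z(1) t in \<open>auto simp: indicator_def space_N split: if_splits\<close>)
next
  assume Q: "\<forall>t\<in>carrier G. AE x in \<mu>. Q (x, t)"
  have "\<forall>t\<in>carrier G. \<exists>Z. {x \<in> space \<mu>. \<not> Q (x, t)} \<subseteq> Z \<and> emeasure \<mu> Z = 0 \<and> Z \<in> sets \<mu>"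
  proof
    fix t assume "t \<in> carrier G"
    with Q have "AE x in \<mu>. Q (x, t)" by blast
    then show "\<exists>Z. {x \<in> space \<mu>. \<not> Q (x, t)} \<subseteq> Z \<and> emeasure \<mu> Z = 0 \<and> Z \<in> sets \<mu>"
      by (rule AE_E) blast
  qed
  from bchoice[OF this] obtain Z where Z: "\<And>t. t \<in> carrier G \<Longrightarrow> {x \<in> space \<mu>. \<not> Q (x, t)} \<subseteq> Z t"
    "\<And>t. t \<in> carrier G \<Longrightarrow> emeasure \<mu> (Z t) = 0" "\<And>t. t \<in> carrier G \<Longrightarrow> Z t \<in> sets \<mu>" by blast
  have "(\<Union>t\<in>carrier G. Z t \<times> {t}) \<in> null_sets N"
  proof (rule null_sets_UN'[OF countable_G])
    fix t assume t: "t \<in> carrier G"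
    show "Z t \<times> {t} \<in> null_sets N"
      using Z(2,3)[OF t] t C.emeasure_pair_measure_Times[of "Z t" \<mu> "{t}"]
      by (intro null_setsI) auto
  qed
  then show "AE z in N. Q z"
    by (rule AE_I') (use Z(1) in \<open>force simp: space_N\<close>)
qed

lemma AE_slice: "AE z in N. Q z \<Longrightarrow> t \<in> carrier G \<Longrightarrow> AE x in \<mu>. Q (x, t)"
  by (simp add: AE_N)

lemma L2_rep_slice:
  assumes "u = L2_class N g" "g \<in> square_integrable N" "t \<in> carrier G"
  shows "AE x in \<mu>. L2_rep u (x, t) = g (x, t)"
  using AE_slice[OF L2_rep_class(2)[OF assms(2)] assms(3)] unfolding assms(1) .

subsection \<open>Generators\<close>

definition trans :: "'g \<Rightarrow> 'x \<times> 'g \<Rightarrow> 'x \<times> 'g" where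
  "trans s z = (fst z, inv s \<otimes> snd z)"

lemma cp_space_eq: "cp_space G \<mu> = H"
  by (simp add: cp_space_def)

lemma cp_fun_eq: "\<pi> f = wcomp N (\<lambda>z. f (act (snd z) (fst z))) (\<lambda>z. z)"
  by (simp add: cp_fun_def wcomp_def cp_space_def split_beta')

lemma cp_unitary_eq: "cp_unitary G \<mu> s = wcomp N (\<lambda>_. 1) (trans s)"
  by (simp add: cp_unitary_def wcomp_def cp_space_def trans_def split_beta')

lemma nn_integral_count_bij:
  assumes "bij_betw g (carrier G) (carrier G)"
  shows "(\<integral>\<^sup>+t. h (g t) \<partial>count_space (carrier G)) = (\<integral>\<^sup>+t. h t \<partial>count_space (carrier G))"
  using assms by (rule nn_integral_bij_count_space)

lemma bij_mult_left: "s \<in> carrier G \<Longrightarrow> bij_betw (\<lambda>t. s \<otimes> t) (carrier G) (carrier G)"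
proof (rule bij_betw_byWitness[where f' = "\<lambda>t. inv s \<otimes> t"])
  assume s: "s \<in> carrier G"
  show "\<forall>t\<in>carrier G. inv s \<otimes> (s \<otimes> t) = t" using s by (simp flip: m_assoc)
  show "\<forall>t\<in>carrier G. s \<otimes> (inv s \<otimes> t) = t" using s by (simp flip: m_assoc)
qed auto

lemma bij_mult_right: "s \<in> carrier G \<Longrightarrow> bij_betw (\<lambda>t. t \<otimes> s) (carrier G) (carrier G)"
proof (rule bij_betw_byWitness[where f' = "\<lambda>t. t \<otimes> inv s"])
  assume s: "s \<in> carrier G"
  show "\<forall>t\<in>carrier G. (t \<otimes> s) \<otimes> inv s = t" using s by (simp add: m_assoc)
  show "\<forall>t\<in>carrier G. (t \<otimes> inv s) \<otimes> s = t" using s by (simp add: m_assoc)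
qed auto

lemma trans_measurable: "s \<in> carrier G \<Longrightarrow> trans s \<in> measurable N N"
proof -
  assume s: "s \<in> carrier G"
  have "(\<lambda>t. inv s \<otimes> t) \<in> measurable (count_space (carrier G)) (count_space (carrier G))"
    using s by (auto simp: measurable_count_space_eq1)
  then have [measurable]: "(\<lambda>z. inv s \<otimes> snd z) \<in> measurable N (count_space (carrier G))"
    by (rule measurable_compose[OF measurable_snd])
  show ?thesis unfolding trans_def by measurable
qed

text \<open>Left multiplication merely permutes the slices.\<close>

lemma trans_preserves:
  assumes s: "s \<in> carrier G"
  shows "distr N N (trans s) = N"
proof (rule measure_eqI)
  fix A assume A: "A \<in> sets (distr N N (trans s))"
  then have [measurable]: "A \<in> sets N" by simp
  note [measurable] = trans_measurable[OF s]
  have "emeasure (distr N N (trans s)) A = (\<integral>\<^sup>+z. indicator A z \<partial>distr N N (trans s))"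
    using A by simp
  also have "\<dots> = (\<integral>\<^sup>+z. indicator A (trans s z) \<partial>N)"
    by (intro nn_integral_distr) auto
  also have "\<dots> = (\<integral>\<^sup>+t. \<integral>\<^sup>+x. indicator A (trans s (x, t)) \<partial>\<mu> \<partial>count_space (carrier G))"
    by (intro nn_integral_N) measurable
  also have "\<dots> = (\<integral>\<^sup>+t. \<integral>\<^sup>+x. indicator A (x, t) \<partial>\<mu> \<partial>count_space (carrier G))"
    using nn_integral_count_bij[OF bij_mult_left[OF inv_closed[OF s]], of "\<lambda>t. \<integral>\<^sup>+x. indicator A (x, t) \<partial>\<mu>"]
    by (simp add: trans_def)
  also have "\<dots> = (\<integral>\<^sup>+z. indicator A z \<partial>N)"
    by (intro nn_integral_N[symmetric]) measurable
  finally show "emeasure (distr N N (trans s)) A = emeasure N A" by simp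
qed simp

lemma admissible_trans: "s \<in> carrier G \<Longrightarrow> admissible N (\<lambda>_. 1) (trans s) 1"
  by (intro admissible_measure_preserving trans_measurable trans_preserves)

text \<open>An essential bound for \<open>f\<close> passes to every slice by \<open>act_AE\<close>.
  The maximum with 0 supplies the sign demanded by \<open>admissible\<close>.\<close>

lemma Linfty_orbit:
  assumes f: "f \<in> Linfty \<mu>"
  obtains C where "0 \<le> C" "(\<lambda>z. f (act (snd z) (fst z))) \<in> borel_measurable N"
    "AE z in N. cmod (f (act (snd z) (fst z))) \<le> C"
proof -
  obtain C where C: "AE x in \<mu>. cmod (f x) \<le> C" and fm: "f \<in> borel_measurable \<mu>"
    using f by (auto simp: Linfty_def)
  show thesis
  proof (rule that[of "max C 0"])
    show "(\<lambda>z. f (act (snd z) (fst z))) \<in> borel_measurable N"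
      using measurable_compose[OF act_measurable fm] by (intro measurable_N) simp
    show "AE z in N. cmod (f (act (snd z) (fst z))) \<le> max C 0"
      unfolding AE_N
    proof
      fix t assume t: "t \<in> carrier G"
      from act_AE[OF t C] show "AE x in \<mu>. cmod (f (act (snd (x, t)) (fst (x, t)))) \<le> max C 0"
        by eventually_elim simp
    qed
  qed simp
qed

lemma admissible_cp_fun:
  assumes "f \<in> Linfty \<mu>"
  obtains C where "admissible N (\<lambda>z. f (act (snd z) (fst z))) (\<lambda>z. z) C"
proof -
  obtain C where "0 \<le> C" "(\<lambda>z. f (act (snd z) (fst z))) \<in> borel_measurable N"
    "AE z in N. cmod (f (act (snd z) (fst z))) \<le> C"
    using assms by (rule Linfty_orbit)
  then show thesis using that[OF admissible_multiplication] by blast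
qed

lemma cp_fun_bounded: "f \<in> Linfty \<mu> \<Longrightarrow> \<pi> f \<in> bounded_ops H"
  unfolding cp_fun_eq by (erule admissible_cp_fun) (rule wcomp_bounded)

lemma cp_unitary_bounded: "s \<in> carrier G \<Longrightarrow> cp_unitary G \<mu> s \<in> bounded_ops H"
  unfolding cp_unitary_eq by (rule wcomp_bounded[OF admissible_trans])

lemma cp_fun_adjoint:
  assumes "f \<in> Linfty \<mu>"
  shows "is_adjoint H (\<pi> f) (\<pi> (\<lambda>x. cnj (f x)))"
  unfolding cp_fun_eq using assms by (rule Linfty_orbit) (rule is_adjoint_multiplication)

lemma cp_unitary_adjoint:
  assumes s: "s \<in> carrier G"
  shows "is_adjoint H (cp_unitary G \<mu> s) (cp_unitary G \<mu> (inv s))"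
  unfolding cp_unitary_eq
  using s by (intro is_adjoint_measure_preserving trans_measurable trans_preserves)
    (auto simp: trans_def space_N simp flip: m_assoc)

lemma Linfty_cnj: "f \<in> Linfty \<mu> \<Longrightarrow> (\<lambda>x. cnj (f x)) \<in> Linfty \<mu>"
  by (auto simp: Linfty_def)

lemma gens_bounded: "T \<in> gens \<Longrightarrow> T \<in> bounded_ops H"
  using cp_fun_bounded cp_unitary_bounded by blast

lemma gens_adjoint: "T \<in> gens \<Longrightarrow> is_adjoint H T U \<Longrightarrow> U \<in> gens"
proof -
  assume T: "T \<in> gens" and adj: "is_adjoint H T U"
  have "\<exists>T'\<in>gens. is_adjoint H T T'"
    using T cp_fun_adjoint cp_unitary_adjoint Linfty_cnj inv_closed by blast
  then show "U \<in> gens"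
    using is_adjoint_unique[OF adj] gens_bounded[OF T] by blast
qed

lemma vn_bounded: "T \<in> VN \<Longrightarrow> T \<in> bounded_ops H"
  by (simp add: vn_crossed_product_def vn_gen_def commutant_def cp_space_eq)

text \<open>The generators already contain their adjoints, so whatever commutes with them lies in
  the commutant whose commutant is \<open>VN\<close>.\<close>

lemma vn_commute:
  assumes T: "T \<in> VN" and R: "R \<in> bounded_ops H"
    and comm: "\<And>U. U \<in> gens \<Longrightarrow> op_mult H R U = op_mult H U R"
  shows "op_mult H T R = op_mult H R T"
proof -
  have "gens \<union> {U. \<exists>T\<in>gens. is_adjoint H T U} = gens"
    using gens_adjoint by blast
  then have "R \<in> commutant H (gens \<union> {U. \<exists>T\<in>gens. is_adjoint H T U})"
    using R comm by (simp add: commutant_def)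
  with T show ?thesis
    unfolding vn_crossed_product_def vn_gen_def cp_space_eq commutant_def[of _ "commutant _ _"] by blast
qed

subsection \<open>Operators in the commutant\<close>

text \<open>The unitaries move only the group coordinate, which \<open>h\<close> does not see, and
  multiplications commute with each other. The lemma forces an element of \<open>VN\<close>,
  compressed to a slice, to act there as a multiplication.\<close>

lemma vn_commute_multiplication:
  assumes T: "T \<in> VN"
    and h: "h \<in> borel_measurable \<mu>" "0 \<le> C" "\<And>x. cmod (h x) \<le> C"
  shows "op_mult H T (wcomp N (\<lambda>z. h (fst z)) (\<lambda>z. z)) = op_mult H (wcomp N (\<lambda>z. h (fst z)) (\<lambda>z. z)) T"
proof (rule vn_commute[OF T])
  have hm: "(\<lambda>z. h (fst z)) \<in> borel_measurable N"
    using h(1) by (rule measurable_compose[OF measurable_fst])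
  have adm: "admissible N (\<lambda>z. h (fst z)) (\<lambda>z. z) C"
    using hm h(2,3) by (intro admissible_multiplication) auto
  then show "wcomp N (\<lambda>z. h (fst z)) (\<lambda>z. z) \<in> bounded_ops H" by (rule wcomp_bounded)
  fix U assume "U \<in> gens"
  then consider f where "f \<in> Linfty \<mu>" "U = \<pi> f" | s where "s \<in> carrier G" "U = cp_unitary G \<mu> s"
    by blast
  then show "op_mult H (wcomp N (\<lambda>z. h (fst z)) (\<lambda>z. z)) U = op_mult H U (wcomp N (\<lambda>z. h (fst z)) (\<lambda>z. z))"
  proof cases
    case 1
    obtain D where "admissible N (\<lambda>z. f (act (snd z) (fst z))) (\<lambda>z. z) D"
      using 1(1) by (rule admissible_cp_fun)
    from adm this show ?thesis
      unfolding 1(2) cp_fun_eq by (rule wcomp_commute) (auto simp: mult.commute)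
  next
    case 2
    from adm admissible_trans[OF 2(1)] show ?thesis
      unfolding 2(2) cp_unitary_eq by (rule wcomp_commute) (auto simp: trans_def)
  qed
qed

text \<open>Truncating the Radon--Nikodym derivative at 1 loses unitarity of the right translations
  but avoids any finiteness discussion; only positivity of the weight matters.\<close>

definition weight :: "'g \<Rightarrow> 'x \<Rightarrow> real" where
  "weight s x = sqrt (enn2real (min (RN_deriv \<mu> (distr \<mu> \<mu> (act s)) x) 1))"

text \<open>The new group coordinate applied to the new point is again \<open>act t x\<close>.
  Composition with this map therefore commutes with every \<open>\<pi> f\<close> and, being a right
  translation on the group, with the unitaries.\<close>

definition rtrans :: "'g \<Rightarrow> 'x \<times> 'g \<Rightarrow> 'x \<times> 'g" where
  "rtrans s z = (act (inv s) (fst z), snd z \<otimes> s)"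

lemma weight_measurable [measurable]: "weight s \<in> borel_measurable \<mu>"
  unfolding weight_def by measurable

lemma density_translate:
  assumes s: "s \<in> carrier G"
  shows "density \<mu> (RN_deriv \<mu> (distr \<mu> \<mu> (act s))) = distr \<mu> \<mu> (act s)"
proof (rule density_RN_deriv)
  show "absolutely_continuous \<mu> (distr \<mu> \<mu> (act s))"
    unfolding absolutely_continuous_def
  proof
    fix A assume A: "A \<in> null_sets \<mu>"
    then have "AE x in \<mu>. x \<notin> A" by (rule AE_not_in)
    then have "AE x in \<mu>. act s x \<notin> A" by (rule act_AE[OF s])
    then have "AE x in distr \<mu> \<mu> (act s). x \<notin> A"
      using A by (subst AE_distr_iff[OF act_measurable[OF s]]) auto
    then show "A \<in> null_sets (distr \<mu> \<mu> (act s))"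
      using A by (subst (asm) AE_iff_null_sets[symmetric]) auto
  qed
qed simp

text \<open>A density is nonzero almost everywhere for the measure that it defines. Moved back along
  the action this becomes a statement about \<mu>, and the truncation keeps the value
  finite.\<close>

lemma weight_pos:
  assumes s: "s \<in> carrier G"
  shows "AE x in \<mu>. 0 < weight s x"
proof -
  let ?D = "RN_deriv \<mu> (distr \<mu> \<mu> (act s))"
  note [measurable] = act_measurable[OF s]
  have "AE x in density \<mu> ?D. ?D x \<noteq> 0"
    by (subst AE_density) auto
  then have "AE x in distr \<mu> \<mu> (act s). ?D x \<noteq> 0"
    unfolding density_translate[OF s] .
  then have "AE x in \<mu>. ?D (act s x) \<noteq> 0"
    by (subst (asm) AE_distr_iff[OF act_measurable[OF s]]) auto
  then have "AE x in \<mu>. ?D (act s (act (inv s) x)) \<noteq> 0"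
    by (rule act_AE[OF inv_closed[OF s]])
  then show ?thesis
    using AE_space
  proof eventually_elim
    case (elim x)
    then have "?D x \<noteq> 0" using s by (simp add: act_inv_act)
    then have "0 < min (?D x) 1" by (simp add: zero_less_iff_neq_zero)
    moreover have "min (?D x) 1 < \<infinity>" by (simp add: min_less_iff_disj)
    ultimately show ?case by (simp add: weight_def enn2real_positive_iff)
  qed
qed

text \<open>The squared weight is at most the density of the translated measure, which the change of
  variables absorbs; right multiplication permutes the slices.\<close>

lemma admissible_rtrans:
  assumes s: "s \<in> carrier G"
  shows "admissible N (\<lambda>z. of_real (weight s (fst z))) (rtrans s) 1"
  unfolding admissible_def
proof (intro conjI ballI)
  let ?D = "RN_deriv \<mu> (distr \<mu> \<mu> (act s))"
  have [measurable]: "act s \<in> measurable \<mu> \<mu>" "act (inv s) \<in> measurable \<mu> \<mu>"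
    using s act_measurable by auto
  have "(\<lambda>t. t \<otimes> s) \<in> measurable (count_space (carrier G)) (count_space (carrier G))"
    using s by (auto simp: measurable_count_space_eq1)
  then have [measurable]: "(\<lambda>z. snd z \<otimes> s) \<in> measurable N (count_space (carrier G))"
    by (rule measurable_compose[OF measurable_snd])
  show rm [measurable]: "rtrans s \<in> measurable N N" unfolding rtrans_def by measurable
  show wm [measurable]: "(\<lambda>z. complex_of_real (weight s (fst z))) \<in> borel_measurable N" by measurable
  fix F :: "'x \<times> 'g \<Rightarrow> ennreal" assume F [measurable]: "F \<in> borel_measurable N"
  have "(\<integral>\<^sup>+z. ennreal ((cmod (of_real (weight s (fst z))))\<^sup>2) * F (rtrans s z) \<partial>N) =
    (\<integral>\<^sup>+t. \<integral>\<^sup>+x. ennreal ((weight s x)\<^sup>2) * F (act (inv s) x, t \<otimes> s) \<partial>\<mu> \<partial>count_space (carrier G))"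
    by (subst nn_integral_N) (auto simp: rtrans_def intro!: borel_measurable_times_ennreal)
  also have "\<dots> \<le> (\<integral>\<^sup>+t. \<integral>\<^sup>+x. F (x, t \<otimes> s) \<partial>\<mu> \<partial>count_space (carrier G))"
  proof (rule nn_integral_mono)
    fix t assume "t \<in> space (count_space (carrier G))"
    then have t: "t \<otimes> s \<in> carrier G" using s by simp
    have Fm [measurable]: "(\<lambda>x. F (x, t \<otimes> s)) \<in> borel_measurable \<mu>" using F t by (rule measurable_slice)
    have wle: "ennreal ((weight s x)\<^sup>2) \<le> ?D x" for x
    proof -
      have "min (?D x) 1 < \<infinity>" by (simp add: min_less_iff_disj)
      then show ?thesis by (simp add: weight_def)
    qed
    have "(\<integral>\<^sup>+x. ennreal ((weight s x)\<^sup>2) * F (act (inv s) x, t \<otimes> s) \<partial>\<mu>) \<le>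
      (\<integral>\<^sup>+x. ?D x * F (act (inv s) x, t \<otimes> s) \<partial>\<mu>)"
      by (intro nn_integral_mono mult_right_mono wle) auto
    also have "\<dots> = (\<integral>\<^sup>+x. F (act (inv s) x, t \<otimes> s) \<partial>density \<mu> ?D)"
      by (intro nn_integral_density[symmetric]) measurable
    also have "\<dots> = (\<integral>\<^sup>+x. F (act (inv s) x, t \<otimes> s) \<partial>distr \<mu> \<mu> (act s))"
      by (simp add: density_translate[OF s])
    also have "\<dots> = (\<integral>\<^sup>+x. F (act (inv s) (act s x), t \<otimes> s) \<partial>\<mu>)"
      by (intro nn_integral_distr) measurable
    also have "\<dots> = (\<integral>\<^sup>+x. F (x, t \<otimes> s) \<partial>\<mu>)"
      using s by (intro nn_integral_cong) (simp add: act_inv_act)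
    finally show "(\<integral>\<^sup>+x. ennreal ((weight s x)\<^sup>2) * F (act (inv s) x, t \<otimes> s) \<partial>\<mu>) \<le> (\<integral>\<^sup>+x. F (x, t \<otimes> s) \<partial>\<mu>)" .
  qed
  also have "\<dots> = (\<integral>\<^sup>+t. \<integral>\<^sup>+x. F (x, t) \<partial>\<mu> \<partial>count_space (carrier G))"
    by (rule nn_integral_count_bij[OF bij_mult_right[OF s], of "\<lambda>t. \<integral>\<^sup>+x. F (x, t) \<partial>\<mu>"])
  also have "\<dots> = (\<integral>\<^sup>+z. F z \<partial>N)" by (rule nn_integral_N[OF F, symmetric])
  finally show "(\<integral>\<^sup>+z. ennreal ((cmod (of_real (weight s (fst z))))\<^sup>2) * F (rtrans s z) \<partial>N) \<le> ennreal (1\<^sup>2) * (\<integral>\<^sup>+z. F z \<partial>N)"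
    by simp
qed simp

lemma vn_commute_rtrans:
  assumes T: "T \<in> VN" and s: "s \<in> carrier G"
  defines "\<rho> \<equiv> wcomp N (\<lambda>z. of_real (weight s (fst z))) (rtrans s)"
  shows "op_mult H T \<rho> = op_mult H \<rho> T"
proof (rule vn_commute[OF T])
  note adm = admissible_rtrans[OF s]
  then show "\<rho> \<in> bounded_ops H" unfolding \<rho>_def by (rule wcomp_bounded)
  fix U assume "U \<in> gens"
  then consider f where "f \<in> Linfty \<mu>" "U = \<pi> f" | r where "r \<in> carrier G" "U = cp_unitary G \<mu> r"
    by blast
  then show "op_mult H \<rho> U = op_mult H U \<rho>"
  proof cases
    case 1
    obtain D where D: "admissible N (\<lambda>z. f (act (snd z) (fst z))) (\<lambda>z. z) D"
      using 1(1) by (rule admissible_cp_fun)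
    have "act (t \<otimes> s) (act (inv s) x) = act t x" if "x \<in> space \<mu>" "t \<in> carrier G" for t x
      using that s by (simp add: act_mult act_space act_inv_act)
    then show ?thesis
      unfolding 1(2) cp_fun_eq \<rho>_def using AE_space[of N]
      by (intro wcomp_commute[OF adm D]) (auto simp: space_N rtrans_def elim!: eventually_mono)
  next
    case 2
    show ?thesis
      unfolding 2(2) cp_unitary_eq \<rho>_def using s 2(1)
      by (intro wcomp_commute[OF adm admissible_trans]) (auto simp: trans_def rtrans_def space_N m_assoc)
  qed
qed

subsection \<open>Diagonal coefficients\<close>

text \<open>The elementary tensor of \<phi> with the basis vector at \<open>t\<close>.\<close>

definition delta :: "('x \<Rightarrow> complex) \<Rightarrow> 'g \<Rightarrow> 'x \<times> 'g \<Rightarrow> complex" where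
  "delta \<phi> t z = (if snd z = t then \<phi> (fst z) else 0)"

lemma integral_supported_slice:
  assumes F: "integrable N F" and t: "t \<in> carrier G" and supp: "\<And>x u. u \<noteq> t \<Longrightarrow> F (x, u) = 0"
  shows "(\<integral>z. F z \<partial>N) = (\<integral>x. F (x, t) \<partial>\<mu> :: complex)"
proof -
  have "(\<integral>z. F z \<partial>N) = (\<integral>u. (\<integral>x. F (x, u) \<partial>\<mu>) \<partial>count_space (carrier G))"
    using P.integral_snd[of "\<lambda>x u. F (x, u)"] F by simp
  also have "\<dots> = (\<Sum>u\<in>{t}. \<integral>x. F (x, u) \<partial>\<mu>)"
  proof -
    have "(\<integral>x. F (x, u) \<partial>\<mu>) = 0" if "u \<noteq> t" for u
      using supp[OF that] by simp
    then have sub: "{u \<in> carrier G. (\<integral>x. F (x, u) \<partial>\<mu>) \<noteq> 0} \<subseteq> {t}"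
      by blast
    then have "finite {u \<in> carrier G. (\<integral>x. F (x, u) \<partial>\<mu>) \<noteq> 0}"
      by (rule finite_subset) simp
    from lebesgue_integral_count_space_finite_support[OF this] show ?thesis
      using sub t by (simp only:) (intro sum.mono_neutral_left, auto)
  qed
  finally show ?thesis by simp
qed

lemma slice_square_integrable:
  assumes F: "F \<in> square_integrable N" and t: "t \<in> carrier G"
  shows "(\<lambda>x. F (x, t)) \<in> square_integrable \<mu>"
proof -
  have Fm [measurable]: "F \<in> borel_measurable N" using F by (rule square_integrableD)
  have "(\<integral>\<^sup>+x. ennreal ((cmod (F (x, t)))\<^sup>2) \<partial>\<mu>) \<le>
    (\<integral>\<^sup>+u. \<integral>\<^sup>+x. ennreal ((cmod (F (x, u)))\<^sup>2) \<partial>\<mu> \<partial>count_space (carrier G))"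
    using t by (rule nn_integral_ge_point[of t "carrier G" "\<lambda>u. \<integral>\<^sup>+x. ennreal ((cmod (F (x, u)))\<^sup>2) \<partial>\<mu>"])
  also have "\<dots> = (\<integral>\<^sup>+z. ennreal ((cmod (F z))\<^sup>2) \<partial>N)"
    by (intro nn_integral_N[symmetric]) measurable
  also have "\<dots> < \<infinity>"
    unfolding nn_integral_vnorm[OF F] by simp
  finally have "(\<integral>\<^sup>+x. ennreal ((cmod (F (x, t)))\<^sup>2) \<partial>\<mu>) < \<infinity>" .
  moreover have [measurable]: "(\<lambda>x. F (x, t)) \<in> borel_measurable \<mu>" using Fm t by (rule measurable_slice)
  ultimately show ?thesis
    unfolding square_integrable_def by (auto intro!: integrableI_bounded)
qed

lemma delta_square_integrable:
  assumes \<phi>: "\<phi> \<in> square_integrable \<mu>" and t: "t \<in> carrier G"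
  shows "delta \<phi> t \<in> square_integrable N"
proof -
  have [measurable]: "\<phi> \<in> borel_measurable \<mu>" using \<phi> by (rule square_integrableD)
  have dm [measurable]: "delta \<phi> t \<in> borel_measurable N"
  proof (rule measurable_N)
    show "(\<lambda>x. delta \<phi> t (x, u)) \<in> borel_measurable \<mu>" for u
      unfolding delta_def by (cases "u = t") simp_all
  qed
  have "(\<integral>\<^sup>+z. ennreal ((cmod (delta \<phi> t z))\<^sup>2) \<partial>N) =
    (\<integral>\<^sup>+u. \<integral>\<^sup>+x. ennreal ((cmod (delta \<phi> t (x, u)))\<^sup>2) \<partial>\<mu> \<partial>count_space (carrier G))"
    by (intro nn_integral_N) measurable
  also have "\<dots> = (\<integral>\<^sup>+u. (\<integral>\<^sup>+x. ennreal ((cmod (\<phi> x))\<^sup>2) \<partial>\<mu>) * indicator {t} u \<partial>count_space (carrier G))"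
    by (intro nn_integral_cong) (auto simp: delta_def indicator_def)
  also have "\<dots> = (\<integral>\<^sup>+x. ennreal ((cmod (\<phi> x))\<^sup>2) \<partial>\<mu>)"
    using t by (subst nn_integral_cmult_indicator) auto
  also have "\<dots> < \<infinity>" unfolding nn_integral_vnorm[OF \<phi>] by simp
  finally show ?thesis
    unfolding square_integrable_def using dm by (auto intro!: integrableI_bounded)
qed

abbreviation vdelta :: "('x \<Rightarrow> complex) \<Rightarrow> 'g \<Rightarrow> ('x \<times> 'g \<Rightarrow> complex) set" where
  "vdelta \<phi> t \<equiv> L2_class N (delta \<phi> t)"

lemma vdelta_vecs: "\<phi> \<in> square_integrable \<mu> \<Longrightarrow> t \<in> carrier G \<Longrightarrow> vdelta \<phi> t \<in> V"
  by (intro L2_class_vecs delta_square_integrable)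

lemma vinner_vdelta:
  assumes u: "u \<in> V" and \<phi>: "\<phi> \<in> square_integrable \<mu>" and t: "t \<in> carrier G"
  shows "ip u (vdelta \<phi> t) = (\<integral>x. L2_rep u (x, t) * cnj (\<phi> x) \<partial>\<mu>)"
proof -
  note d = delta_square_integrable[OF \<phi> t] and r = L2_rep_vecs[OF u]
  have "ip u (vdelta \<phi> t) = (\<integral>z. L2_rep u z * cnj (delta \<phi> t z) \<partial>N)"
    using vinner_class[OF r(1) d] r(2) by simp
  also have "\<dots> = (\<integral>x. L2_rep u (x, t) * cnj (delta \<phi> t (x, t)) \<partial>\<mu>)"
    using square_integrable_inner[OF r(1) d] t by (rule integral_supported_slice) (simp add: delta_def)
  finally show ?thesis by (simp add: delta_def)
qed

text \<open>The elementary tensors separate vectors: on each slice the difference is tested against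
  itself.\<close>

lemma eq_if_vdelta_eq:
  assumes u: "u \<in> V" and v: "v \<in> V"
    and eq: "\<And>\<phi> t. \<phi> \<in> square_integrable \<mu> \<Longrightarrow> t \<in> carrier G \<Longrightarrow>
      ip u (vdelta \<phi> t) = ip v (vdelta \<phi> t)"
  shows "u = v"
proof -
  define g where "g = (\<lambda>z. L2_rep u z - L2_rep v z)"
  have g: "g \<in> square_integrable N"
    using square_integrable_add[OF L2_rep_vecs(1)[OF u] square_integrable_scale[OF L2_rep_vecs(1)[OF v], of "-1"]]
    by (simp add: g_def)
  have "AE x in \<mu>. L2_rep u (x, t) = L2_rep v (x, t)" if t: "t \<in> carrier G" for t
  proof -
    define \<phi> where "\<phi> = (\<lambda>x. g (x, t))"
    have \<phi>: "\<phi> \<in> square_integrable \<mu>" unfolding \<phi>_def using g t by (rule slice_square_integrable)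
    have ru: "(\<lambda>x. L2_rep u (x, t)) \<in> square_integrable \<mu>" and rv: "(\<lambda>x. L2_rep v (x, t)) \<in> square_integrable \<mu>"
      using u v t by (auto intro!: slice_square_integrable L2_rep_vecs)
    have "(\<integral>x. \<phi> x * cnj (\<phi> x) \<partial>\<mu>) = (\<integral>x. L2_rep u (x, t) * cnj (\<phi> x) - L2_rep v (x, t) * cnj (\<phi> x) \<partial>\<mu>)"
      by (intro Bochner_Integration.integral_cong refl) (simp add: \<phi>_def g_def left_diff_distrib)
    also have "\<dots> = (\<integral>x. L2_rep u (x, t) * cnj (\<phi> x) \<partial>\<mu>) - (\<integral>x. L2_rep v (x, t) * cnj (\<phi> x) \<partial>\<mu>)"
      by (intro Bochner_Integration.integral_diff square_integrable_inner ru rv \<phi>)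
    also have "\<dots> = 0"
      using eq[OF \<phi> t] by (simp add: vinner_vdelta[OF u \<phi> t] vinner_vdelta[OF v \<phi> t])
    finally have "(\<integral>x. (cmod (\<phi> x))\<^sup>2 \<partial>\<mu>) = 0"
      using vinner_self_class[OF \<phi>] vinner_class[OF \<phi> \<phi>] by simp
    then have "AE x in \<mu>. (cmod (\<phi> x))\<^sup>2 = 0"
      using integral_nonneg_eq_0_iff_AE[OF square_integrableD(2)[OF \<phi>]] by simp
    then show ?thesis by eventually_elim (simp add: \<phi>_def g_def)
  qed
  then have "AE z in N. L2_rep u z = L2_rep v z" by (simp add: AE_N)
  then have "L2_class N (L2_rep u) = L2_class N (L2_rep v)" by (rule L2_class_cong)
  then show ?thesis using L2_rep_vecs(2)[OF u] L2_rep_vecs(2)[OF v] by simp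
qed

text \<open>Available by sigma-finiteness, this function takes the place of the constant 1, which is
  not square-integrable for an infinite measure.\<close>

definition psi :: "'x \<Rightarrow> complex" where
  "psi = (SOME \<psi>. \<psi> \<in> square_integrable \<mu> \<and> (\<forall>x. \<psi> x \<noteq> 0))"

lemma psi_exists: "\<exists>\<psi>. \<psi> \<in> square_integrable \<mu> \<and> (\<forall>x. \<psi> x \<noteq> 0)"
proof -
  obtain f :: "'x \<Rightarrow> real" where f: "f \<in> borel_measurable \<mu>" "\<And>x. f x > 0" "integrable \<mu> f"
    using obtain_positive_integrable_function by metis
  note [measurable] = f(1)
  have "(\<lambda>x. complex_of_real (sqrt (f x))) \<in> square_integrable \<mu>"
  proof (rule square_integrable_bound[OF f(3)])
    show "AE x in \<mu>. (cmod (complex_of_real (sqrt (f x))))\<^sup>2 \<le> f x"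
      using f(2) by (simp add: less_imp_le)
  qed measurable
  moreover have "complex_of_real (sqrt (f x)) \<noteq> 0" for x
    using f(2)[of x] by simp
  ultimately show ?thesis by blast
qed

lemma psi: "psi \<in> square_integrable \<mu>" "psi x \<noteq> 0"
  using someI_ex[OF psi_exists] unfolding psi_def by blast+

text \<open>For \<open>T\<close> in \<open>VN\<close> this is the multiplier by which the
  compression of \<open>T\<close> to the slice at \<open>t\<close> acts. At the unit of the group it
  is the conditional expectation of \<open>T\<close>.\<close>

definition coef :: "(('x \<times> 'g \<Rightarrow> complex) set \<Rightarrow> ('x \<times> 'g \<Rightarrow> complex) set) \<Rightarrow> 'g \<Rightarrow> 'x \<Rightarrow> complex" where
  "coef T t x = L2_rep (T (vdelta psi t)) (x, t) / psi x"

lemma T_rep: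
  assumes "T \<in> bounded_ops H" "u \<in> V"
  shows "L2_rep (T u) \<in> square_integrable N" "L2_class N (L2_rep (T u)) = T u"
  using L2_rep_vecs[OF bounded_opsD[OF assms]] by auto

lemma coef_measurable:
  assumes T: "T \<in> bounded_ops H" and t: "t \<in> carrier G"
  shows "coef T t \<in> borel_measurable \<mu>"
proof -
  have "(\<lambda>x. L2_rep (T (vdelta psi t)) (x, t)) \<in> borel_measurable \<mu>"
    using square_integrableD(1)[OF T_rep(1)[OF T vdelta_vecs[OF psi(1) t]]] t by (rule measurable_slice)
  moreover have "psi \<in> borel_measurable \<mu>" using psi(1) by (rule square_integrableD)
  ultimately show ?thesis unfolding coef_def by measurable
qed

lemma vn_slice_mult:
  assumes T: "T \<in> VN" and \<phi>: "\<phi> \<in> square_integrable \<mu>" and t: "t \<in> carrier G"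
    and h: "h \<in> borel_measurable \<mu>" "0 \<le> C" "\<And>x. cmod (h x) \<le> C"
  shows "(\<lambda>x. h x * \<phi> x) \<in> square_integrable \<mu>"
    and "AE x in \<mu>. L2_rep (T (vdelta (\<lambda>x. h x * \<phi> x) t)) (x, t) = h x * L2_rep (T (vdelta \<phi> t)) (x, t)"
proof -
  note Tb = vn_bounded[OF T]
  define M where "M = wcomp N (\<lambda>z. h (fst z)) (\<lambda>z. z)"
  have "(\<lambda>z. h (fst z)) \<in> borel_measurable N"
    using h(1) by (rule measurable_compose[OF measurable_fst])
  then have adm: "admissible N (\<lambda>z. h (fst z)) (\<lambda>z. z) C"
    using h(2,3) by (intro admissible_multiplication) auto
  have "admissible \<mu> h (\<lambda>x. x) C"
    using h by (intro admissible_multiplication) auto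
  then show "(\<lambda>x. h x * \<phi> x) \<in> square_integrable \<mu>"
    using \<phi> by (rule admissible_square_integrable)
  have "M (vdelta \<phi> t) = vdelta (\<lambda>x. h x * \<phi> x) t"
    unfolding M_def wcomp_class[OF adm delta_square_integrable[OF \<phi> t]]
    by (rule arg_cong[where f = "L2_class N"]) (auto simp: delta_def)
  moreover have "op_mult H T M = op_mult H M T"
    unfolding M_def using T h by (rule vn_commute_multiplication)
  then have "op_mult H T M (vdelta \<phi> t) = op_mult H M T (vdelta \<phi> t)" by simp
  then have "T (M (vdelta \<phi> t)) = M (T (vdelta \<phi> t))"
    by (simp only: op_apply(3)[OF vdelta_vecs[OF \<phi> t]])
  ultimately have "T (vdelta (\<lambda>x. h x * \<phi> x) t) = M (L2_class N (L2_rep (T (vdelta \<phi> t))))"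
    using T_rep(2)[OF Tb vdelta_vecs[OF \<phi> t]] by simp
  also have "\<dots> = L2_class N (\<lambda>z. h (fst z) * L2_rep (T (vdelta \<phi> t)) z)"
    unfolding M_def using T_rep(1)[OF Tb vdelta_vecs[OF \<phi> t]] by (rule wcomp_class[OF adm])
  finally have eq: "T (vdelta (\<lambda>x. h x * \<phi> x) t) = L2_class N (\<lambda>z. h (fst z) * L2_rep (T (vdelta \<phi> t)) z)" .
  from L2_rep_slice[OF eq admissible_square_integrable(1)[OF adm T_rep(1)[OF Tb vdelta_vecs[OF \<phi> t]]] t]
  show "AE x in \<mu>. L2_rep (T (vdelta (\<lambda>x. h x * \<phi> x) t)) (x, t) = h x * L2_rep (T (vdelta \<phi> t)) (x, t)"
    by simp
qed

text \<open>The multiplier is read off at the single vector \<open>psi\<close>. Truncation carries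
  it over to \<phi>, whose quotient by \<open>psi\<close> may be unbounded.\<close>

lemma vn_slice:
  assumes T: "T \<in> VN" and \<phi>: "\<phi> \<in> square_integrable \<mu>" and t: "t \<in> carrier G"
  shows "AE x in \<mu>. L2_rep (T (vdelta \<phi> t)) (x, t) = coef T t x * \<phi> x"
proof -
  define A where "A = (\<lambda>n::nat. {x \<in> space \<mu>. cmod (\<phi> x / psi x) \<le> real n})"
  define h where "h = (\<lambda>n x. indicator (A n) x * (\<phi> x / psi x))"
  have [measurable]: "\<phi> \<in> borel_measurable \<mu>" "psi \<in> borel_measurable \<mu>"
    using \<phi> psi(1) by (auto simp: square_integrable_def)
  have Am [measurable]: "A n \<in> sets \<mu>" for n unfolding A_def by measurable
  have hm: "h n \<in> borel_measurable \<mu>" for n unfolding h_def by measurable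
  have km: "(\<lambda>x. indicator (A n) x :: complex) \<in> borel_measurable \<mu>" for n by measurable
  have hb: "cmod (h n x) \<le> real n" for n x
    by (auto simp: h_def A_def indicator_def)
  have kb: "cmod (indicator (A n) x) \<le> 1" for n x by (auto simp: indicator_def)
  \<comment> \<open>On \<open>A n\<close> the function \<phi> is a bounded multiple of
    \<open>psi\<close>, so \<open>T\<close> can be evaluated on its truncation in two ways.\<close>
  have eq: "(\<lambda>x. h n x * psi x) = (\<lambda>x. indicator (A n) x * \<phi> x)" for n
    using psi(2) by (auto simp: h_def fun_eq_iff)
  have "AE x in \<mu>. \<forall>n. indicator (A n) x * L2_rep (T (vdelta \<phi> t)) (x, t) = h n x * L2_rep (T (vdelta psi t)) (x, t)"
    unfolding AE_all_countable
  proof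
    fix n
    show "AE x in \<mu>. indicator (A n) x * L2_rep (T (vdelta \<phi> t)) (x, t) = h n x * L2_rep (T (vdelta psi t)) (x, t)"
      using vn_slice_mult(2)[OF T psi(1) t hm[of n] _ hb, unfolded eq] vn_slice_mult(2)[OF T \<phi> t km[of n] _ kb]
      by (auto elim: eventually_elim2)
  qed
  then show ?thesis
    using AE_space
  proof eventually_elim
    case (elim x)
    obtain n where "cmod (\<phi> x / psi x) \<le> real n" using real_arch_simple by blast
    then have "x \<in> A n" using elim(2) by (simp add: A_def)
    then show ?case
      using elim(1)[rule_format, of n] psi(2)[of x] by (simp add: h_def coef_def field_simps)
  qed
qed

lemma vinner_vn:
  assumes T: "T \<in> VN" and t: "t \<in> carrier G"
    and \<phi>: "\<phi> \<in> square_integrable \<mu>" and \<eta>: "\<eta> \<in> square_integrable \<mu>"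
  shows "ip (T (vdelta \<phi> t)) (vdelta \<eta> t) = (\<integral>x. coef T t x * \<phi> x * cnj (\<eta> x) \<partial>\<mu>)"
    and "integrable \<mu> (\<lambda>x. coef T t x * \<phi> x * cnj (\<eta> x))"
proof -
  note Tb = vn_bounded[OF T]
  let ?r = "\<lambda>x. L2_rep (T (vdelta \<phi> t)) (x, t)"
  have r: "?r \<in> square_integrable \<mu>"
    using T_rep(1)[OF Tb vdelta_vecs[OF \<phi> t]] t by (rule slice_square_integrable)
  have [measurable]: "?r \<in> borel_measurable \<mu>" "\<phi> \<in> borel_measurable \<mu>" "\<eta> \<in> borel_measurable \<mu>"
    "coef T t \<in> borel_measurable \<mu>"
    using r \<phi> \<eta> coef_measurable[OF Tb t] by (auto simp: square_integrable_def)
  have ae: "AE x in \<mu>. ?r x * cnj (\<eta> x) = coef T t x * \<phi> x * cnj (\<eta> x)"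
    using vn_slice[OF T \<phi> t] by eventually_elim simp
  have "ip (T (vdelta \<phi> t)) (vdelta \<eta> t) = (\<integral>x. ?r x * cnj (\<eta> x) \<partial>\<mu>)"
    by (intro vinner_vdelta \<eta> t bounded_opsD[OF Tb] vdelta_vecs \<phi>)
  also have "\<dots> = (\<integral>x. coef T t x * \<phi> x * cnj (\<eta> x) \<partial>\<mu>)"
    using ae by (intro integral_cong_AE) measurable
  finally show "ip (T (vdelta \<phi> t)) (vdelta \<eta> t) = (\<integral>x. coef T t x * \<phi> x * cnj (\<eta> x) \<partial>\<mu>)" .
  have "integrable \<mu> (\<lambda>x. ?r x * cnj (\<eta> x))" using r \<eta> by (rule square_integrable_inner)
  moreover have "integrable \<mu> (\<lambda>x. ?r x * cnj (\<eta> x)) \<longleftrightarrow> integrable \<mu> (\<lambda>x. coef T t x * \<phi> x * cnj (\<eta> x))"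
    using ae by (intro integrable_cong_AE) measurable
  ultimately show "integrable \<mu> (\<lambda>x. coef T t x * \<phi> x * cnj (\<eta> x))" by blast
qed

text \<open>Otherwise the form would be negative at \<open>psi\<close> cut down to the set where the
  real part is negative.\<close>

lemma coef_nonneg:
  assumes T: "T \<in> VN" and t: "t \<in> carrier G"
    and pos: "\<And>v. v \<in> V \<Longrightarrow> ip (T v) v \<in> \<real>\<^sub>\<ge>\<^sub>0"
  shows "AE x in \<mu>. 0 \<le> Re (coef T t x)"
proof -
  note [measurable] = coef_measurable[OF vn_bounded[OF T] t]
  have [measurable]: "psi \<in> borel_measurable \<mu>" using psi(1) by (rule square_integrableD)
  define A where "A = {x \<in> space \<mu>. Re (coef T t x) < 0}"
  have Am [measurable]: "A \<in> sets \<mu>" unfolding A_def by measurable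
  define \<phi> where "\<phi> = (\<lambda>x. indicator A x * psi x)"
  have \<phi>: "\<phi> \<in> square_integrable \<mu>"
    unfolding \<phi>_def by (rule vn_slice_mult(1)[OF T psi(1) t, where C = 1]) (auto simp: indicator_def)
  have eq: "coef T t x * \<phi> x * cnj (\<phi> x) = of_real ((cmod (\<phi> x))\<^sup>2) * coef T t x" for x
    unfolding complex_norm_square by simp
  have int: "integrable \<mu> (\<lambda>x. of_real ((cmod (\<phi> x))\<^sup>2) * coef T t x)"
    using vinner_vn(2)[OF T t \<phi> \<phi>] unfolding eq .
  have "0 \<le> Re (ip (T (vdelta \<phi> t)) (vdelta \<phi> t))"
    using pos[OF vdelta_vecs[OF \<phi> t]] by (simp add: complex_nonneg_Reals_iff)
  also have "\<dots> = (\<integral>x. Re (of_real ((cmod (\<phi> x))\<^sup>2) * coef T t x) \<partial>\<mu>)"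
    unfolding vinner_vn(1)[OF T t \<phi> \<phi>] eq using int by (rule integral_Re[symmetric])
  finally have le: "(\<integral>x. - Re (of_real ((cmod (\<phi> x))\<^sup>2) * coef T t x) \<partial>\<mu>) \<le> 0"
    by simp
  have int': "integrable \<mu> (\<lambda>x. - Re (of_real ((cmod (\<phi> x))\<^sup>2) * coef T t x))"
    using int by (intro integrable_minus integrable_Re)
  have nn: "0 \<le> - Re (of_real ((cmod (\<phi> x))\<^sup>2) * coef T t x)" for x
    by (auto simp: \<phi>_def A_def indicator_def mult_nonneg_nonpos)
  have "(\<integral>x. - Re (of_real ((cmod (\<phi> x))\<^sup>2) * coef T t x) \<partial>\<mu>) = 0"
    using le nn by (intro antisym Bochner_Integration.integral_nonneg)
  then have "AE x in \<mu>. - Re (of_real ((cmod (\<phi> x))\<^sup>2) * coef T t x) = 0"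
    using integral_nonneg_eq_0_iff_AE[OF int'] nn by simp
  then show ?thesis
    using AE_space
  proof eventually_elim
    case (elim x)
    show ?case
    proof (rule ccontr)
      assume "\<not> 0 \<le> Re (coef T t x)"
      then have "x \<in> A" "Re (coef T t x) \<noteq> 0" using elim(2) by (auto simp: A_def)
      then show False using elim(1) psi(2)[of x] by (simp add: \<phi>_def)
    qed
  qed
qed

text \<open>The diagonal coefficient determines the form at vectors on one slice, and
  \<open>positive_op_zero\<close> turns vanishing of the form into annihilation. Here diagonal data
  acquire control over the whole operator.\<close>

lemma vn_positive_vanish:
  assumes T: "T \<in> VN" and t: "t \<in> carrier G" and \<phi>: "\<phi> \<in> square_integrable \<mu>"
    and pos: "\<And>v. v \<in> V \<Longrightarrow> ip (T v) v \<in> \<real>\<^sub>\<ge>\<^sub>0"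
    and zero: "AE x in \<mu>. \<phi> x \<noteq> 0 \<longrightarrow> Re (coef T t x) = 0" and y: "y \<in> V"
  shows "ip (T (vdelta \<phi> t)) y = 0"
proof (rule positive_op_zero[OF vn_bounded[OF T] pos vdelta_vecs[OF \<phi> t] _ y])
  have eq: "coef T t x * \<phi> x * cnj (\<phi> x) = of_real ((cmod (\<phi> x))\<^sup>2) * coef T t x" for x
    unfolding complex_norm_square by simp
  have int: "integrable \<mu> (\<lambda>x. of_real ((cmod (\<phi> x))\<^sup>2) * coef T t x)"
    using vinner_vn(2)[OF T t \<phi> \<phi>] unfolding eq .
  have "Re (ip (T (vdelta \<phi> t)) (vdelta \<phi> t)) = (\<integral>x. Re (of_real ((cmod (\<phi> x))\<^sup>2) * coef T t x) \<partial>\<mu>)"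
    unfolding vinner_vn(1)[OF T t \<phi> \<phi>] eq using int by (rule integral_Re[symmetric])
  also have "\<dots> = 0"
    using zero by (intro integral_eq_zero_AE) (auto elim!: eventually_mono)
  finally show "ip (T (vdelta \<phi> t)) (vdelta \<phi> t) = 0"
    using pos[OF vdelta_vecs[OF \<phi> t]] by (simp add: complex_nonneg_Reals_iff complex_eq_iff)
qed

text \<open>Commuting \<open>T\<close> with the weighted right translation by the inverse of
  \<open>t\<close> compares the slice at the unit with the slice at \<open>t\<close>; the weight and
  \<open>psi\<close>, being nonzero almost everywhere, cancel.\<close>

lemma coef_translate:
  assumes T: "T \<in> VN" and t: "t \<in> carrier G"
  shows "AE x in \<mu>. coef T t x = coef T \<one> (act t x)"
proof -
  define s where "s = inv t"
  have s: "s \<in> carrier G" "inv s = t" using t by (auto simp: s_def)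
  note Tb = vn_bounded[OF T] and adm = admissible_rtrans[OF s(1)]
  define \<rho> where "\<rho> = wcomp N (\<lambda>z. of_real (weight s (fst z))) (rtrans s)"
  \<comment> \<open>Chosen so that \<rho> maps \<open>vdelta psi \<one>\<close> to
    \<open>vdelta \<phi> t\<close>.\<close>
  define \<phi> where "\<phi> = (\<lambda>x. of_real (weight s x) * psi (act t x))"
  note d1 = delta_square_integrable[OF psi(1) one_closed]
  note v1 = vdelta_vecs[OF psi(1) one_closed]
  have "(\<lambda>x. of_real (weight s (fst (x, t))) * delta psi \<one> (rtrans s (x, t))) \<in> square_integrable \<mu>"
    using admissible_square_integrable(1)[OF adm d1] t by (rule slice_square_integrable)
  then have \<phi>: "\<phi> \<in> square_integrable \<mu>"
    using t s by (simp add: \<phi>_def delta_def rtrans_def s_def)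
  have "\<rho> (vdelta psi \<one>) = L2_class N (\<lambda>z. of_real (weight s (fst z)) * delta psi \<one> (rtrans s z))"
    unfolding \<rho>_def by (rule wcomp_class[OF adm d1])
  also have "\<dots> = vdelta \<phi> t"
  proof (rule L2_class_cong)
    have iff: "u \<otimes> s = \<one> \<longleftrightarrow> u = t" if "u \<in> carrier G" for u
      using that t s inv_equality[of u s] by (auto simp: s_def)
    show "AE z in N. of_real (weight s (fst z)) * delta psi \<one> (rtrans s z) = delta \<phi> t z"
      using AE_space by eventually_elim (auto simp: space_N delta_def rtrans_def \<phi>_def iff s(2))
  qed
  finally have \<rho>1: "\<rho> (vdelta psi \<one>) = vdelta \<phi> t" .
  have "op_mult H T \<rho> (vdelta psi \<one>) = op_mult H \<rho> T (vdelta psi \<one>)"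
    unfolding \<rho>_def using vn_commute_rtrans[OF T s(1)] by simp
  then have "T (vdelta \<phi> t) = \<rho> (T (vdelta psi \<one>))"
    by (simp only: op_apply(3)[OF v1] \<rho>1)
  also have "\<dots> = \<rho> (L2_class N (L2_rep (T (vdelta psi \<one>))))"
    by (simp only: T_rep(2)[OF Tb v1])
  also have "\<dots> = L2_class N (\<lambda>z. of_real (weight s (fst z)) * L2_rep (T (vdelta psi \<one>)) (rtrans s z))"
    unfolding \<rho>_def by (rule wcomp_class[OF adm T_rep(1)[OF Tb v1]])
  finally have eq: "T (vdelta \<phi> t) = L2_class N (\<lambda>z. of_real (weight s (fst z)) * L2_rep (T (vdelta psi \<one>)) (rtrans s z))" .
  from L2_rep_slice[OF eq admissible_square_integrable(1)[OF adm T_rep(1)[OF Tb v1]] t]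
  have "AE x in \<mu>. L2_rep (T (vdelta \<phi> t)) (x, t) = of_real (weight s x) * L2_rep (T (vdelta psi \<one>)) (act t x, \<one>)"
    using t by (simp add: rtrans_def s_def)
  then show ?thesis
    using vn_slice[OF T \<phi> t] weight_pos[OF s(1)]
  proof eventually_elim
    case (elim x)
    then have "coef T t x * (of_real (weight s x) * psi (act t x)) =
      of_real (weight s x) * (coef T \<one> (act t x) * psi (act t x))"
      using psi(2) by (simp add: \<phi>_def coef_def[of T \<one>])
    then show ?case using elim(3) psi(2)[of "act t x"] by simp
  qed
qed

text \<open>The inner unitary moves the unit slice to the slice at \<open>inv s\<close>, where
  \<open>T\<close> acts, and the outer one moves it back; the first coordinate stays untouched.
  Combined with \<open>coef_translate\<close> this becomes equivariance.\<close>

lemma coef_conjugate: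
  assumes T: "T \<in> bounded_ops H" and s: "s \<in> carrier G"
  shows "AE x in \<mu>. coef (op_mult H (op_mult H (cp_unitary G \<mu> s) T) (cp_unitary G \<mu> (inv s))) \<one> x
    = coef T (inv s) x"
proof -
  note v1 = vdelta_vecs[OF psi(1) one_closed] and d1 = delta_square_integrable[OF psi(1) one_closed]
  have sc: "inv s \<in> carrier G" using s by simp
  note vi = vdelta_vecs[OF psi(1) sc]
  have "cp_unitary G \<mu> (inv s) (vdelta psi \<one>) = L2_class N (\<lambda>z. 1 * delta psi \<one> (trans (inv s) z))"
    unfolding cp_unitary_eq by (rule wcomp_class[OF admissible_trans[OF sc] d1])
  also have "\<dots> = vdelta psi (inv s)"
  proof (rule L2_class_cong)
    have iff: "s \<otimes> u = \<one> \<longleftrightarrow> u = inv s" if "u \<in> carrier G" for u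
      using that s by (metis inv_equality inv_inv r_inv inv_closed)
    show "AE z in N. 1 * delta psi \<one> (trans (inv s) z) = delta psi (inv s) z"
      using AE_space by eventually_elim (use s in \<open>auto simp: space_N delta_def trans_def iff\<close>)
  qed
  finally have 1: "cp_unitary G \<mu> (inv s) (vdelta psi \<one>) = vdelta psi (inv s)" .
  let ?R = "op_mult H (op_mult H (cp_unitary G \<mu> s) T) (cp_unitary G \<mu> (inv s))"
  have "?R (vdelta psi \<one>) = cp_unitary G \<mu> s (T (vdelta psi (inv s)))"
    by (simp only: op_apply(3)[OF v1] 1 op_apply(3)[OF vi])
  also have "\<dots> = cp_unitary G \<mu> s (L2_class N (L2_rep (T (vdelta psi (inv s)))))"
    by (simp only: T_rep(2)[OF T vi])
  also have "\<dots> = L2_class N (\<lambda>z. 1 * L2_rep (T (vdelta psi (inv s))) (trans s z))"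
    unfolding cp_unitary_eq by (rule wcomp_class[OF admissible_trans[OF s] T_rep(1)[OF T vi]])
  finally have eq: "?R (vdelta psi \<one>) = L2_class N (\<lambda>z. 1 * L2_rep (T (vdelta psi (inv s))) (trans s z))" .
  from L2_rep_slice[OF eq admissible_square_integrable(1)[OF admissible_trans[OF s] T_rep(1)[OF T vi]] one_closed]
  have "AE x in \<mu>. L2_rep (?R (vdelta psi \<one>)) (x, \<one>) = L2_rep (T (vdelta psi (inv s))) (x, inv s)"
    using s by (simp add: trans_def)
  then show ?thesis by eventually_elim (simp add: coef_def)
qed

lemma coef_add:
  assumes T: "T \<in> bounded_ops H" and U: "U \<in> bounded_ops H" and t: "t \<in> carrier G"
  shows "AE x in \<mu>. coef (op_add H T U) t x = coef T t x + coef U t x"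
proof -
  note v = vdelta_vecs[OF psi(1) t]
  note rT = T_rep[OF T v] and rU = T_rep[OF U v]
  have "op_add H T U (vdelta psi t) = vadd H (L2_class N (L2_rep (T (vdelta psi t)))) (L2_class N (L2_rep (U (vdelta psi t))))"
    by (simp only: op_apply(1)[OF v] rT(2) rU(2))
  also have "\<dots> = L2_class N (\<lambda>z. L2_rep (T (vdelta psi t)) z + L2_rep (U (vdelta psi t)) z)"
    by (rule vadd_class[OF rT(1) rU(1)])
  finally have eq: "op_add H T U (vdelta psi t) = L2_class N (\<lambda>z. L2_rep (T (vdelta psi t)) z + L2_rep (U (vdelta psi t)) z)" .
  from L2_rep_slice[OF eq square_integrable_add[OF rT(1) rU(1)] t]
  show ?thesis by eventually_elim (simp add: coef_def add_divide_distrib)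
qed

lemma coef_one:
  assumes t: "t \<in> carrier G"
  shows "AE x in \<mu>. coef op_one t x = 1"
proof -
  from L2_rep_slice[OF op_apply(4)[OF vdelta_vecs[OF psi(1) t]] delta_square_integrable[OF psi(1) t] t]
  show ?thesis by eventually_elim (simp add: coef_def delta_def psi(2))
qed

end

section \<open>The inclusion of the crossed product is rigid\<close>

lemma (in hilbert) gen_cstar_gen:
  assumes T: "T \<in> A" "T \<in> bounded_ops H"
  shows "T \<in> cstar_gen H A"
  unfolding cstar_gen_def
proof (intro CollectI conjI allI impI T)
  fix e :: real assume e: "e > 0"
  have "vnorm H (op_add H T (op_scale H (-1) T) x) \<le> 0 * vnorm H x" if "x \<in> vecs H" for x
    using that bounded_opsD[OF T(2) that] by (simp add: vnorm_def vinner_simps)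
  then have "op_norm H (op_add H T (op_scale H (-1) T)) \<le> 0"
    by (intro op_norm_le) auto
  with e show "\<exists>U\<in>star_alg_gen H A. op_norm H (op_add H T (op_scale H (-1) U)) < e"
    using star_alg_gen.gen[of T A H] T(1) by (intro bexI[of _ T]) auto
qed

context measured_action
begin

section \<open>Algebraic relations between the generators\<close>

lemma cp_fun_class:
  assumes "f \<in> Linfty \<mu>" "g \<in> square_integrable N"
  shows "\<pi> f (L2_class N g) = L2_class N (\<lambda>z. f (act (snd z) (fst z)) * g z)"
    and "(\<lambda>z. f (act (snd z) (fst z)) * g z) \<in> square_integrable N"
proof -
  obtain C where C: "admissible N (\<lambda>z. f (act (snd z) (fst z))) (\<lambda>z. z) C"
    using assms(1) by (rule admissible_cp_fun)
  show "\<pi> f (L2_class N g) = L2_class N (\<lambda>z. f (act (snd z) (fst z)) * g z)"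
    unfolding cp_fun_eq by (rule wcomp_class[OF C assms(2)])
  show "(\<lambda>z. f (act (snd z) (fst z)) * g z) \<in> square_integrable N"
    by (rule admissible_square_integrable(1)[OF C assms(2)])
qed

lemma cp_unitary_class:
  assumes s: "s \<in> carrier G" and g: "g \<in> square_integrable N"
  shows "cp_unitary G \<mu> s (L2_class N g) = L2_class N (\<lambda>z. g (trans s z))"
    and "(\<lambda>z. g (trans s z)) \<in> square_integrable N"
  using wcomp_class[OF admissible_trans[OF s] g] admissible_square_integrable(1)[OF admissible_trans[OF s] g]
  by (simp_all add: cp_unitary_eq)

lemma cp_fun_cong:
  assumes "f \<in> Linfty \<mu>" "g \<in> Linfty \<mu>" "\<And>x. x \<in> space \<mu> \<Longrightarrow> f x = g x"
  shows "\<pi> f = \<pi> g"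
proof (rule op_eq_L2)
  show "\<pi> f \<in> bounded_ops H" "\<pi> g \<in> bounded_ops H"
    using assms by (auto intro: cp_fun_bounded)
  fix h assume h: "h \<in> square_integrable N"
  have "AE z in N. f (act (snd z) (fst z)) * h z = g (act (snd z) (fst z)) * h z"
    using AE_space by eventually_elim (auto simp: space_N act_space assms(3))
  then show "\<pi> f (L2_class N h) = \<pi> g (L2_class N h)"
    unfolding cp_fun_class(1)[OF assms(1) h] cp_fun_class(1)[OF assms(2) h] by (rule L2_class_cong)
qed

lemma Linfty_add:
  assumes "f \<in> Linfty \<mu>" "g \<in> Linfty \<mu>"
  shows "(\<lambda>x. f x + g x) \<in> Linfty \<mu>"
proof -
  obtain C D where C: "AE x in \<mu>. cmod (f x) \<le> C" and D: "AE x in \<mu>. cmod (g x) \<le> D"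
    using assms by (auto simp: Linfty_def)
  have "AE x in \<mu>. cmod (f x + g x) \<le> C + D"
    using C D by eventually_elim (metis add_mono norm_triangle_le)
  with assms show ?thesis by (auto simp: Linfty_def)
qed

lemma Linfty_scale:
  assumes "f \<in> Linfty \<mu>"
  shows "(\<lambda>x. c * f x) \<in> Linfty \<mu>"
proof -
  obtain C where C: "AE x in \<mu>. cmod (f x) \<le> C"
    using assms by (auto simp: Linfty_def)
  have "AE x in \<mu>. cmod (c * f x) \<le> cmod c * C"
    using C by eventually_elim (simp add: norm_mult mult_left_mono)
  with assms show ?thesis by (auto simp: Linfty_def)
qed

lemma cp_fun_add:
  assumes f: "f \<in> Linfty \<mu>" and g: "g \<in> Linfty \<mu>"
  shows "op_add H (\<pi> f) (\<pi> g) = \<pi> (\<lambda>x. f x + g x)"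
proof (rule op_eq_L2)
  show "op_add H (\<pi> f) (\<pi> g) \<in> bounded_ops H"
    "\<pi> (\<lambda>x. f x + g x) \<in> bounded_ops H"
    using f g by (auto intro!: bounded_op_add cp_fun_bounded Linfty_add)
  fix h assume h: "h \<in> square_integrable N"
  show "op_add H (\<pi> f) (\<pi> g) (L2_class N h) = \<pi> (\<lambda>x. f x + g x) (L2_class N h)"
    unfolding op_apply(1)[OF L2_class_vecs[OF h]] cp_fun_class(1)[OF f h] cp_fun_class(1)[OF g h]
      cp_fun_class(1)[OF Linfty_add[OF f g] h] vadd_class[OF cp_fun_class(2)[OF f h] cp_fun_class(2)[OF g h]]
    by (simp add: distrib_right)
qed

lemma cp_fun_scale:
  assumes f: "f \<in> Linfty \<mu>"
  shows "op_scale H c (\<pi> f) = \<pi> (\<lambda>x. c * f x)"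
proof (rule op_eq_L2)
  show "op_scale H c (\<pi> f) \<in> bounded_ops H"
    "\<pi> (\<lambda>x. c * f x) \<in> bounded_ops H"
    using f by (auto intro!: bounded_op_scale cp_fun_bounded Linfty_scale)
  fix h assume h: "h \<in> square_integrable N"
  show "op_scale H c (\<pi> f) (L2_class N h) = \<pi> (\<lambda>x. c * f x) (L2_class N h)"
    unfolding op_apply(2)[OF L2_class_vecs[OF h]] cp_fun_class(1)[OF f h]
      cp_fun_class(1)[OF Linfty_scale[OF f] h] vscale_class[OF cp_fun_class(2)[OF f h]]
    by (simp add: mult.assoc)
qed

lemma cp_fun_mult:
  assumes f: "f \<in> Linfty \<mu>" and g: "g \<in> Linfty \<mu>" and fg: "(\<lambda>x. f x * g x) \<in> Linfty \<mu>"
  shows "op_mult H (\<pi> f) (\<pi> g) = \<pi> (\<lambda>x. f x * g x)"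
proof (rule op_eq_L2)
  show "op_mult H (\<pi> f) (\<pi> g) \<in> bounded_ops H"
    "\<pi> (\<lambda>x. f x * g x) \<in> bounded_ops H"
    using f g fg by (auto intro!: bounded_op_mult cp_fun_bounded)
  fix h assume h: "h \<in> square_integrable N"
  show "op_mult H (\<pi> f) (\<pi> g) (L2_class N h) = \<pi> (\<lambda>x. f x * g x) (L2_class N h)"
    unfolding op_apply(3)[OF L2_class_vecs[OF h]] cp_fun_class(1)[OF g h]
      cp_fun_class(1)[OF fg h] cp_fun_class(1)[OF f cp_fun_class(2)[OF g h]]
    by (simp add: mult.assoc)
qed

lemma cp_fun_one: "\<pi> (\<lambda>_. 1) = op_one"
proof (rule op_eq_L2)
  have L: "(\<lambda>_. 1) \<in> Linfty \<mu>" by (auto simp: Linfty_def)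
  show "\<pi> (\<lambda>_. 1) \<in> bounded_ops H" "op_one \<in> bounded_ops H"
    using L by (auto intro: cp_fun_bounded bounded_op_one)
  fix h assume h: "h \<in> square_integrable N"
  show "\<pi> (\<lambda>_. 1) (L2_class N h) = op_one (L2_class N h)"
    using cp_fun_class(1)[OF L h] op_apply(4)[OF L2_class_vecs[OF h]] by simp
qed

lemma cp_unitary_mult_inv:
  assumes s: "s \<in> carrier G"
  shows "op_mult H (cp_unitary G \<mu> s) (cp_unitary G \<mu> (inv s)) = op_one"
proof (rule op_eq_L2)
  show "op_mult H (cp_unitary G \<mu> s) (cp_unitary G \<mu> (inv s)) \<in> bounded_ops H" "op_one \<in> bounded_ops H"
    using s by (auto intro!: bounded_op_mult cp_unitary_bounded bounded_op_one)
  fix h assume h: "h \<in> square_integrable N"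
  have i: "inv s \<in> carrier G" using s by simp
  have "AE z in N. h (trans (inv s) (trans s z)) = h z"
    using AE_space by eventually_elim (use s in \<open>auto simp: space_N trans_def simp flip: m_assoc\<close>)
  then show "op_mult H (cp_unitary G \<mu> s) (cp_unitary G \<mu> (inv s)) (L2_class N h) = op_one (L2_class N h)"
    unfolding op_apply(3,4)[OF L2_class_vecs[OF h]] cp_unitary_class(1)[OF i h]
      cp_unitary_class(1)[OF s cp_unitary_class(2)[OF i h]]
    by (rule L2_class_cong)
qed

lemma cp_unitary_one: "cp_unitary G \<mu> \<one> = op_one"
proof (rule op_eq_L2)
  show "cp_unitary G \<mu> \<one> \<in> bounded_ops H" "op_one \<in> bounded_ops H"
    by (auto intro: cp_unitary_bounded bounded_op_one)
  fix h assume h: "h \<in> square_integrable N"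
  have "AE z in N. h (trans \<one> z) = h z"
    using AE_space by eventually_elim (auto simp: space_N trans_def)
  then show "cp_unitary G \<mu> \<one> (L2_class N h) = op_one (L2_class N h)"
    unfolding op_apply(4)[OF L2_class_vecs[OF h]] cp_unitary_class(1)[OF one_closed h]
    by (rule L2_class_cong)
qed

lemma cp_unitary_conjugate:
  assumes s: "s \<in> carrier G" and f: "f \<in> Linfty \<mu>" and g: "g \<in> Linfty \<mu>"
    and eq: "\<And>x. x \<in> space \<mu> \<Longrightarrow> f (act (inv s) x) = g x"
  shows "op_mult H (op_mult H (cp_unitary G \<mu> s) (\<pi> f)) (cp_unitary G \<mu> (inv s)) = \<pi> g"
proof (rule op_eq_L2)
  show "op_mult H (op_mult H (cp_unitary G \<mu> s) (\<pi> f)) (cp_unitary G \<mu> (inv s)) \<in> bounded_ops H"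
    "\<pi> g \<in> bounded_ops H"
    using s f g by (auto intro!: bounded_op_mult cp_fun_bounded cp_unitary_bounded)
  fix h assume h: "h \<in> square_integrable N"
  have i: "inv s \<in> carrier G" using s by simp
  note c1 = cp_unitary_class[OF i h]
  note c2 = cp_fun_class[OF f c1(2)]
  note c3 = cp_unitary_class[OF s c2(2)]
  have ae: "AE z in N. f (act (snd (trans s z)) (fst (trans s z))) * h (trans (inv s) (trans s z)) =
    g (act (snd z) (fst z)) * h z"
    using AE_space
  proof eventually_elim
    case (elim z)
    obtain x t where z: "z = (x, t)" "x \<in> space \<mu>" "t \<in> carrier G" using elim by (auto simp: space_N)
    have "f (act (inv s \<otimes> t) x) = g (act t x)"
      using eq[OF act_space[OF z(3,2)]] act_mult[OF i z(3,2)] by simp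
    then show ?case using z s by (simp add: trans_def flip: m_assoc)
  qed
  show "op_mult H (op_mult H (cp_unitary G \<mu> s) (\<pi> f)) (cp_unitary G \<mu> (inv s)) (L2_class N h)
    = \<pi> g (L2_class N h)"
    unfolding op_apply(3)[OF L2_class_vecs[OF h]] c1(1) op_apply(3)[OF L2_class_vecs[OF c1(2)]] c2(1) c3(1)
      cp_fun_class(1)[OF g h] by (rule L2_class_cong[OF ae])
qed

end

locale crossed_product_fixing = doubly_ergodic_boundary S \<mu>
  for S :: "'a set" and \<mu> :: "'a bpoint measure" +
  fixes \<theta> :: "(('a bpoint \<times> 'a letter list \<Rightarrow> complex) set \<Rightarrow> ('a bpoint \<times> 'a letter list \<Rightarrow> complex) set) \<Rightarrow>
      (('a bpoint \<times> 'a letter list \<Rightarrow> complex) set \<Rightarrow> ('a bpoint \<times> 'a letter list \<Rightarrow> complex) set)"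
  assumes cp: "completely_positive (cp_space (free_group S) \<mu>)
      (cstar_crossed_product (free_group S) word_act (boundary_topology S) \<mu>)
      (vn_crossed_product (free_group S) word_act \<mu>) \<theta>"
    and fixing: "\<forall>T\<in>cstar_group (free_group S) \<mu>. \<theta> T = T"
begin

abbreviation "\<Gamma> \<equiv> free_group S"

sublocale A: measured_action \<Gamma> \<mu> word_act
proof (intro measured_action.intro measured_action_axioms.intro)
  show "group \<Gamma>" by (rule group_free_group)
  show "sigma_finite_measure \<mu>" by unfold_locales
  show "countable (carrier \<Gamma>)" by (simp add: carrier_free_group countable_W)
  show "word_act \<one>\<^bsub>\<Gamma>\<^esub> x = x" for x :: "'a bpoint"
    by (simp add: free_group_def)
  show "word_act (s \<otimes>\<^bsub>\<Gamma>\<^esub> t) x = word_act s (word_act t x)"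
    if "s \<in> carrier \<Gamma>" "t \<in> carrier \<Gamma>" "x \<in> space \<mu>" for s t x
    using that by (intro word_act_mult) (auto simp: carrier_free_group space_\<mu>)
  show "word_act s \<in> measurable \<mu> \<mu>" if "s \<in> carrier \<Gamma>" for s
    using that by (simp add: carrier_free_group act_measurable)
  show "AE x in \<mu>. P (word_act s x)" if "s \<in> carrier \<Gamma>" "AE x in \<mu>. P x" for s P
    using that by (simp add: carrier_free_group act_AE)
qed

abbreviation "H \<equiv> L2 A.N"
abbreviation "\<pi> f \<equiv> cp_fun \<Gamma> word_act \<mu> f"
abbreviation "U s \<equiv> cp_unitary \<Gamma> \<mu> s"
abbreviation "e C \<equiv> \<pi> (indicator C)"

section \<open>Continuous functions and projections of clopen sets\<close>

lemma continuous_Linfty: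
  assumes f: "continuous_map (boundary_topology S) euclidean (f :: 'a bpoint \<Rightarrow> complex)"
  shows "f \<in> Linfty \<mu>"
  unfolding Linfty_def
proof (intro CollectI conjI)
  show "f \<in> borel_measurable \<mu>"
  proof (rule borel_measurableI)
    fix V :: "complex set" assume "open V"
    then have "openin (boundary_topology S) {x \<in> topspace (boundary_topology S). f x \<in> V}"
      using f by (intro openin_continuous_map_preimage) auto
    then show "f -` V \<inter> space \<mu> \<in> sets \<mu>"
      by (auto simp: space_\<mu> Int_def vimage_def conj_commute intro!: open_measurable)
  qed
  have "compactin (boundary_topology S) X"
    using compact_boundary by (simp add: compact_space_def)
  then have "compactin euclidean (f ` X)"
    using f by (rule image_compactin)
  then have "bounded (f ` X)" by (simp add: compact_imp_bounded)
  then obtain C where "\<forall>x\<in>X. cmod (f x) \<le> C" by (auto simp: bounded_iff)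
  then show "\<exists>C. AE x in \<mu>. cmod (f x) \<le> C"
    by (intro exI[of _ C] AE_I2) (auto simp: space_\<mu>)
qed

lemma continuous_indicator:
  assumes C: "clopen C"
  shows "continuous_map (boundary_topology S) euclidean (indicator C :: 'a bpoint \<Rightarrow> complex)"
  unfolding continuous_map_def
proof (intro conjI allI impI)
  fix V :: "complex set"
  have "{x \<in> topspace (boundary_topology S). indicator C x \<in> V} =
    (if (1::complex) \<in> V then C else {}) \<union> (if (0::complex) \<in> V then X - C else {})"
    using clopen_subset[OF C] by (auto simp: indicator_def)
  moreover have "openin (boundary_topology S) \<dots>"
    using C by (intro openin_Un) (auto simp: clopen_def)
  ultimately show "openin (boundary_topology S) {x \<in> topspace (boundary_topology S). indicator C x \<in> V}"
    by simp
qed auto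

lemma ind_Linfty: "clopen C \<Longrightarrow> indicator C \<in> Linfty \<mu>"
  by (intro continuous_Linfty continuous_indicator)

definition A0 :: "(('a bpoint \<times> 'a letter list \<Rightarrow> complex) set \<Rightarrow> ('a bpoint \<times> 'a letter list \<Rightarrow> complex) set) set" where
  "A0 = cp_fun \<Gamma> word_act \<mu> ` {f. continuous_map (boundary_topology S) euclidean f} \<union> cp_unitary \<Gamma> \<mu> ` carrier \<Gamma>"

lemma unitary_fixed: "s \<in> carrier \<Gamma> \<Longrightarrow> \<theta> (U s) = U s"
proof -
  assume s: "s \<in> carrier \<Gamma>"
  have "U s \<in> cstar_gen H (cp_unitary \<Gamma> \<mu> ` carrier \<Gamma>)"
    using s by (intro A.gen_cstar_gen A.cp_unitary_bounded) auto
  then show ?thesis using fixing by (simp add: cstar_group_def A.cp_space_eq)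
qed

text \<open>Unitality comes from the unit being the unitary of the trivial group element, which
  \<theta> fixes.\<close>

sublocale C: unital_cp H A0 "vn_crossed_product \<Gamma> word_act \<mu>" \<theta>
proof (intro unital_cp.intro unital_cp_axioms.intro)
  show "hilbert H" by (rule hilbert_L2)
  show "A0 \<subseteq> bounded_ops H"
    unfolding A0_def using A.cp_fun_bounded continuous_Linfty A.cp_unitary_bounded by blast
  show "\<exists>T'\<in>A0. is_adjoint H T T'" if "T \<in> A0" for T
  proof -
    from that consider f where "continuous_map (boundary_topology S) euclidean f" "T = \<pi> f"
      | s where "s \<in> carrier \<Gamma>" "T = U s" by (auto simp: A0_def)
    then show ?thesis
    proof cases
      case 1
      have "continuous_map (boundary_topology S) euclidean (cnj \<circ> f)"
        using 1(1) by (rule continuous_map_compose) (simp add: continuous_on_cnj continuous_on_id)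
      then have "\<pi> (\<lambda>x. cnj (f x)) \<in> A0" by (auto simp: A0_def comp_def)
      then show ?thesis using A.cp_fun_adjoint[OF continuous_Linfty[OF 1(1)]] 1(2) by blast
    next
      case 2
      then have "U (inv\<^bsub>\<Gamma>\<^esub> s) \<in> A0" by (auto simp: A0_def)
      then show ?thesis using A.cp_unitary_adjoint[OF 2(1)] 2(2) by blast
    qed
  qed
  show "A.op_one \<in> A0"
    using A.cp_unitary_one[symmetric] by (auto simp: A0_def)
  show "vn_crossed_product \<Gamma> word_act \<mu> \<subseteq> bounded_ops H"
    using A.vn_bounded by blast
  show "completely_positive H (cstar_gen H A0) (vn_crossed_product \<Gamma> word_act \<mu>) \<theta>"
    using cp by (simp add: A0_def cstar_crossed_product_def A.cp_space_eq)
  show "\<theta> A.op_one = A.op_one"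
    using unitary_fixed[OF A.one_closed] by (simp add: A.cp_unitary_one)
qed

lemma pi_SA: "continuous_map (boundary_topology S) euclidean f \<Longrightarrow> \<pi> f \<in> C.SA"
  by (intro star_alg_gen.gen) (auto simp: A0_def)

lemma U_SA: "s \<in> carrier \<Gamma> \<Longrightarrow> U s \<in> C.SA"
  by (intro star_alg_gen.gen) (auto simp: A0_def)

lemma e_SA: "clopen C \<Longrightarrow> e C \<in> C.SA"
  by (intro pi_SA continuous_indicator)

lemma e_adjoint: "clopen C \<Longrightarrow> is_adjoint H (e C) (e C)"
proof -
  assume C: "clopen C"
  have "(\<lambda>x. cnj (indicator C x)) = (indicator C :: 'a bpoint \<Rightarrow> complex)"
    by (auto simp: indicator_def fun_eq_iff)
  then show ?thesis using A.cp_fun_adjoint[OF ind_Linfty[OF C]] by simp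
qed

lemma e_idem: "clopen C \<Longrightarrow> op_mult H (e C) (e C) = e C"
proof -
  assume C: "clopen C"
  have "(\<lambda>x. indicator C x * indicator C x) = (indicator C :: 'a bpoint \<Rightarrow> complex)"
    by (auto simp: indicator_def fun_eq_iff)
  then show ?thesis using A.cp_fun_mult[OF ind_Linfty[OF C] ind_Linfty[OF C]] ind_Linfty[OF C] by simp
qed

lemma e_add: "clopen C \<Longrightarrow> clopen D \<Longrightarrow> C \<inter> D = {} \<Longrightarrow> op_add H (e C) (e D) = e (C \<union> D)"
proof -
  assume C: "clopen C" and D: "clopen D" and "C \<inter> D = {}"
  then have "(\<lambda>x. indicator C x + indicator D x) = (indicator (C \<union> D) :: 'a bpoint \<Rightarrow> complex)"
    by (auto simp: indicator_def fun_eq_iff)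
  then show ?thesis using A.cp_fun_add[OF ind_Linfty[OF C] ind_Linfty[OF D]] by simp
qed

text \<open>As a total function the indicator differs from the constant 1 outside the boundary,
  hence the detour through \<open>cp_fun_cong\<close>.\<close>

lemma e_X: "e X = A.op_one"
proof -
  have "e X = \<pi> (\<lambda>_. 1)"
    by (intro A.cp_fun_cong ind_Linfty clopen_X) (auto simp: Linfty_def space_\<mu>)
  then show ?thesis by (simp add: A.cp_fun_one)
qed

lemma e_act:
  assumes s: "s \<in> carrier \<Gamma>" and C: "clopen C"
  shows "op_mult H (op_mult H (U s) (e C)) (U (winv s)) = e (word_act s ` C)"
proof (rule A.cp_unitary_conjugate[OF s ind_Linfty[OF C] ind_Linfty])
  have sW: "s \<in> W" using s by (simp add: carrier_free_group)
  show "clopen (word_act s ` C)" using sW C by (rule clopen_act)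
  show "indicator C (word_act (winv s) x) = (indicator (word_act s ` C) x :: complex)" if "x \<in> space \<mu>" for x
    using that by (auto simp: act_image[OF sW clopen_subset[OF C]] space_\<mu> indicator_def)
qed

section \<open>The equivariant field of probabilities\<close>

abbreviation "q C \<equiv> \<theta> (e C)"

lemma q_vn: "clopen C \<Longrightarrow> q C \<in> vn_crossed_product \<Gamma> word_act \<mu>"
  by (intro C.\<theta>_range C.SA_CA e_SA)

lemma q_positive: "clopen C \<Longrightarrow> v \<in> A.V \<Longrightarrow> A.ip (q C v) v \<in> \<real>\<^sub>\<ge>\<^sub>0"
  using C.\<theta>_positive_op[OF e_SA e_adjoint] by (simp add: e_idem)

text \<open>The conditional expectation of \<open>q C\<close>, since \<open>[]\<close> is the unit
  of the group. Positivity of \<open>q C\<close> makes the real part carry the information.\<close>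

definition p :: "'a bpoint set \<Rightarrow> 'a bpoint \<Rightarrow> real" where
  "p C x = Re (A.coef (q C) [] x)"

lemma one_eq: "\<one>\<^bsub>\<Gamma>\<^esub> = []"
  by (simp add: free_group_def)

lemma Nil_carrier: "[] \<in> carrier \<Gamma>"
  by (simp add: carrier_free_group)

lemma p_measurable: "clopen C \<Longrightarrow> p C \<in> borel_measurable \<mu>"
  unfolding p_def using A.coef_measurable[OF A.vn_bounded[OF q_vn] Nil_carrier] by measurable

lemma p_nonneg: "clopen C \<Longrightarrow> AE x in \<mu>. 0 \<le> p C x"
  unfolding p_def by (intro A.coef_nonneg q_vn Nil_carrier q_positive)

lemma p_add:
  assumes "clopen C" "clopen D" "C \<inter> D = {}"
  shows "AE x in \<mu>. p (C \<union> D) x = p C x + p D x"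
proof -
  have "q (C \<union> D) = op_add H (q C) (q D)"
    using assms by (simp add: C.\<theta>_add C.SA_CA e_SA flip: e_add)
  moreover have "AE x in \<mu>. A.coef (op_add H (q C) (q D)) [] x = A.coef (q C) [] x + A.coef (q D) [] x"
    using assms by (intro A.coef_add A.vn_bounded q_vn Nil_carrier)
  ultimately show ?thesis by (auto simp: p_def elim: eventually_mono)
qed

lemma p_X: "AE x in \<mu>. p X x = 1"
  using A.coef_one[OF Nil_carrier] by (auto simp: p_def e_X C.unital elim: eventually_mono)

text \<open>The unitaries lie in the multiplicative domain of \<theta>, so the left and the right
  factor can be pulled out in turn.\<close>

lemma q_act:
  assumes s: "s \<in> carrier \<Gamma>" and C: "clopen C"
  shows "q (word_act s ` C) = op_mult H (op_mult H (U s) (q C)) (U (winv s))"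
proof -
  have i: "winv s \<in> carrier \<Gamma>" using s by simp
  have ii: "winv (winv s) = s" using s by simp
  note fx = unitary_fixed[OF s] unitary_fixed[OF i]
  have l: "\<theta> (op_mult H (U s) (e C)) = op_mult H (U s) (q C)"
    by (rule C.\<theta>_mult_left[OF U_SA[OF s] A.cp_unitary_adjoint[OF s] e_SA[OF C]])
      (simp_all only: fx A.cp_unitary_mult_inv[OF s] C.unital)
  have "\<theta> (op_mult H (op_mult H (U s) (e C)) (U (winv s))) = op_mult H (\<theta> (op_mult H (U s) (e C))) (U (winv s))"
  proof (rule C.\<theta>_mult_right[OF U_SA[OF i] _ star_alg_gen.mult[OF U_SA[OF s] e_SA[OF C]]])
    show "is_adjoint H (U (winv s)) (U s)" using A.cp_unitary_adjoint[OF i] by (simp only: ii)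
  qed (simp_all only: fx A.cp_unitary_mult_inv[OF s] C.unital)
  then show ?thesis by (simp only: e_act[OF s C] l)
qed

text \<open>Conjugation shifts the slice, and \<open>coef_translate\<close> shifts it back at the
  cost of translating the point.\<close>

lemma p_act:
  assumes s: "s \<in> carrier \<Gamma>" and C: "clopen C"
  shows "AE x in \<mu>. p (word_act s ` C) x = p C (word_act (winv s) x)"
proof -
  have i: "winv s \<in> carrier \<Gamma>" using s by simp
  have "AE x in \<mu>. A.coef (q (word_act s ` C)) [] x = A.coef (q C) (winv s) x"
    using A.coef_conjugate[OF A.vn_bounded[OF q_vn[OF C]] s] unfolding q_act[OF s C] one_eq .
  moreover have "AE x in \<mu>. A.coef (q C) (winv s) x = A.coef (q C) [] (word_act (winv s) x)"
    using A.coef_translate[OF q_vn[OF C] i] unfolding one_eq .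
  ultimately show ?thesis by eventually_elim (simp add: p_def)
qed

lemma p_UN:
  assumes "finite I" "\<And>i. i \<in> I \<Longrightarrow> clopen (D i)" "disjoint_family_on D I"
  shows "AE x in \<mu>. p (\<Union>i\<in>I. D i) x = (\<Sum>i\<in>I. p (D i) x)"
  using assms
proof (induction rule: finite_induct)
  case empty
  show ?case using p_add[OF clopen_empty clopen_empty] by (auto elim: eventually_mono)
next
  case (insert i I)
  have "disjoint_family_on D I" using insert.prems(2) by (auto simp: disjoint_family_on_def)
  then have IH: "AE x in \<mu>. p (\<Union>i\<in>I. D i) x = (\<Sum>i\<in>I. p (D i) x)"
    using insert by auto
  have "D i \<inter> (\<Union>i\<in>I. D i) = {}"
    using insert.prems(2) insert.hyps(2) by (fastforce simp: disjoint_family_on_def)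
  then have "AE x in \<mu>. p (D i \<union> (\<Union>i\<in>I. D i)) x = p (D i) x + p (\<Union>i\<in>I. D i) x"
    using insert by (intro p_add clopen_UN) auto
  with IH show ?case
    by eventually_elim (use insert.hyps in simp)
qed

lemma p_le_1:
  assumes C: "clopen C"
  shows "AE x in \<mu>. p C x \<le> 1"
proof -
  have "C \<union> (X - C) = X" using clopen_subset[OF C] by blast
  then have "AE x in \<mu>. p X x = p C x + p (X - C) x"
    using p_add[OF C clopen_diff[OF C]] by simp
  with p_X p_nonneg[OF clopen_diff[OF C]] show ?thesis by eventually_elim simp
qed

text \<open>Additivity and equivariance of \<open>p\<close>, with the bound by the total mass,
  supply the hypothesis on sums over disjoint translates.\<close>

lemma p_first_letter:
  assumes "x \<in> letters S" "y \<in> letters S" "x \<noteq> y"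
  shows "AE \<xi> in \<mu>. \<xi> \<in> first_letter x \<longrightarrow> p (first_letter y) \<xi> = 0"
proof (rule equivariant_vanishing[OF assms p_measurable p_nonneg])
  fix V assume V: "finite V" "V \<subseteq> W" "disjoint_family_on (\<lambda>v. word_act v ` first_letter y) V"
  have cl: "clopen (word_act v ` first_letter y)" if "v \<in> V" for v
    using that V(2) by (intro clopen_act clopen_first_letter) auto
  have "AE \<xi> in \<mu>. \<forall>v\<in>V. p (word_act v ` first_letter y) \<xi> = p (first_letter y) (word_act (winv v) \<xi>)"
    unfolding AE_finite_all[OF V(1)]
    using V(2) by (auto intro!: p_act clopen_first_letter simp: carrier_free_group)
  moreover have "AE \<xi> in \<mu>. p (\<Union>v\<in>V. word_act v ` first_letter y) \<xi> = (\<Sum>v\<in>V. p (word_act v ` first_letter y) \<xi>)"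
    using V cl by (intro p_UN)
  moreover have "AE \<xi> in \<mu>. p (\<Union>v\<in>V. word_act v ` first_letter y) \<xi> \<le> 1"
    using V(1) cl by (intro p_le_1 clopen_UN)
  ultimately show "AE \<xi> in \<mu>. (\<Sum>v\<in>V. p (first_letter y) (word_act (winv v) \<xi>)) \<le> 1"
    by eventually_elim simp
qed (auto intro: clopen_first_letter)

lemma first_letter_decomp:
  "F \<subseteq> letters S \<Longrightarrow> X - (\<Union>a\<in>F. first_letter a) = (\<Union>a\<in>letters S - F. first_letter a)"
  by (auto simp: first_letter_def boundary_def)

text \<open>A point outside the union begins with some other letter, where
  \<open>p_first_letter\<close> kills every summand.\<close>

lemma p_vanish:
  assumes F: "F \<subseteq> letters S"
  shows "AE \<xi> in \<mu>. \<xi> \<notin> (\<Union>a\<in>F. first_letter a) \<longrightarrow> p (\<Union>a\<in>F. first_letter a) \<xi> = 0"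
proof -
  have fin: "finite F" using F finite_letters by (rule finite_subset)
  have "AE \<xi> in \<mu>. \<forall>a\<in>F. \<forall>b\<in>letters S. a \<noteq> b \<longrightarrow> \<xi> \<in> first_letter b \<longrightarrow> p (first_letter a) \<xi> = 0"
    unfolding AE_finite_all[OF fin] AE_finite_all[OF finite_letters]
  proof (intro ballI)
    fix a b assume "a \<in> F" "b \<in> letters S"
    then show "AE \<xi> in \<mu>. a \<noteq> b \<longrightarrow> \<xi> \<in> first_letter b \<longrightarrow> p (first_letter a) \<xi> = 0"
      using p_first_letter[of b a] F by (cases "a = b") auto
  qed
  moreover have "AE \<xi> in \<mu>. p (\<Union>a\<in>F. first_letter a) \<xi> = (\<Sum>a\<in>F. p (first_letter a) \<xi>)"
    using fin by (intro p_UN clopen_first_letter) (auto simp: disjoint_family_on_def first_letter_def)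
  ultimately show ?thesis
    using AE_space
  proof eventually_elim
    case (elim \<xi>)
    show ?case
    proof
      assume nF: "\<xi> \<notin> (\<Union>a\<in>F. first_letter a)"
      have \<xi>: "\<xi> \<in> X" using elim(3) by (simp add: space_\<mu>)
      then have b: "\<xi> 0 \<in> letters S" "\<xi> \<in> first_letter (\<xi> 0)" by (auto simp: boundary_def first_letter_def)
      have "p (first_letter a) \<xi> = 0" if "a \<in> F" for a
      proof -
        have "a \<noteq> \<xi> 0" using nF that b(2) by blast
        then show ?thesis using elim(1) that b by blast
      qed
      then show "p (\<Union>a\<in>F. first_letter a) \<xi> = 0" using elim(2) by simp
    qed
  qed
qed

section \<open>From diagonal coefficients to operators\<close>

text \<open>On the slice at \<open>t\<close> the real part of the coefficient is \<open>p\<close> at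
  the translated point, so the vanishing of \<open>p\<close> becomes annihilation of all vectors
  carried by the complement.\<close>

lemma q_vanish:
  assumes F: "F \<subseteq> letters S" and \<phi>: "\<phi> \<in> square_integrable \<mu>" and t: "t \<in> carrier \<Gamma>"
    and supp: "\<And>x. \<phi> x \<noteq> 0 \<Longrightarrow> word_act t x \<notin> (\<Union>a\<in>F. first_letter a)" and y: "y \<in> A.V"
  shows "A.ip (q (\<Union>a\<in>F. first_letter a) (A.vdelta \<phi> t)) y = 0"
proof (rule A.vn_positive_vanish[OF _ t \<phi> _ _ y])
  have cl: "clopen (\<Union>a\<in>F. first_letter a)"
    using F finite_letters by (intro clopen_UN clopen_first_letter) (auto intro: finite_subset)
  show vn: "q (\<Union>a\<in>F. first_letter a) \<in> vn_crossed_product \<Gamma> word_act \<mu>" using cl by (rule q_vn)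
  show "A.ip (q (\<Union>a\<in>F. first_letter a) v) v \<in> \<real>\<^sub>\<ge>\<^sub>0" if "v \<in> A.V" for v
    using cl that by (rule q_positive)
  have "AE x in \<mu>. A.coef (q (\<Union>a\<in>F. first_letter a)) t x = A.coef (q (\<Union>a\<in>F. first_letter a)) [] (word_act t x)"
    using A.coef_translate[OF vn t] unfolding one_eq .
  moreover have "AE x in \<mu>. word_act t x \<notin> (\<Union>a\<in>F. first_letter a) \<longrightarrow> p (\<Union>a\<in>F. first_letter a) (word_act t x) = 0"
    using t p_vanish[OF F] by (rule A.act_AE)
  ultimately show "AE x in \<mu>. \<phi> x \<noteq> 0 \<longrightarrow> Re (A.coef (q (\<Union>a\<in>F. first_letter a)) t x) = 0"
    by eventually_elim (use supp in \<open>auto simp: p_def\<close>)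
qed

text \<open>The positive operators \<open>q ?C\<close> and \<open>q ?D\<close> add up to the unit,
  and each kills the elementary tensors carried by the complement of its own set. So
  \<open>q ?C\<close> acts on elementary tensors as the projection does.\<close>

lemma q_first_letter:
  assumes a: "a \<in> letters S"
  shows "q (first_letter a) = e (first_letter a)"
proof -
  let ?C = "first_letter a" and ?D = "\<Union>b\<in>letters S - {a}. first_letter b"
  have D: "?D = X - ?C" using first_letter_decomp[of "{a}"] a by simp
  have cl: "clopen ?C" "clopen ?D" unfolding D by (auto intro: clopen_first_letter clopen_diff)
  have CX: "?C \<subseteq> X" using cl(1) by (rule clopen_subset)
  have "e X = op_add H (e ?C) (e ?D)"
    using e_add[OF cl] CX unfolding D by (simp add: Un_absorb1)
  then have sum: "op_add H (q ?C) (q ?D) = A.op_one"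
    using e_X C.unital by (simp add: C.\<theta>_add C.SA_CA e_SA cl)
  note bd = A.vn_bounded[OF q_vn[OF cl(1)]] A.vn_bounded[OF q_vn[OF cl(2)]] A.cp_fun_bounded[OF ind_Linfty[OF cl(1)]]
  note bv = bd[THEN A.bounded_opsD]
  have on_delta: "q ?C (A.vdelta \<phi> t) = e ?C (A.vdelta \<phi> t)"
    if \<phi>: "\<phi> \<in> square_integrable \<mu>" and t: "t \<in> carrier \<Gamma>" for \<phi> t
  proof -
    \<comment> \<open>On the slice at \<open>t\<close> the operator \<open>e ?C\<close> multiplies
      by the indicator at the translated point, so \<phi> is split according to that point.\<close>
    define h where "h = (\<lambda>x. indicator ?C (word_act t x) :: complex)"
    have hm: "h \<in> borel_measurable \<mu>"
      unfolding h_def using A.act_measurable[OF t] clopen_measurable[OF cl(1)] by measurable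
    have h': "admissible \<mu> h (\<lambda>x. x) 1" "admissible \<mu> (\<lambda>x. 1 - h x) (\<lambda>x. x) 1"
      using hm by (auto intro!: admissible_multiplication simp: h_def indicator_def)
    define \<phi>1 \<phi>2 where "\<phi>1 = (\<lambda>x. h x * \<phi> x)" and "\<phi>2 = (\<lambda>x. (1 - h x) * \<phi> x)"
    have sq: "\<phi>1 \<in> square_integrable \<mu>" "\<phi>2 \<in> square_integrable \<mu>"
      unfolding \<phi>1_def \<phi>2_def using admissible_square_integrable(1)[OF h'(1) \<phi>] admissible_square_integrable(1)[OF h'(2) \<phi>]
      by auto
    note v = A.vdelta_vecs[OF \<phi> t] A.vdelta_vecs[OF sq(1) t] A.vdelta_vecs[OF sq(2) t]
    have dec: "A.vdelta \<phi> t = vadd H (A.vdelta \<phi>1 t) (A.vdelta \<phi>2 t)"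
      unfolding vadd_class[OF A.delta_square_integrable[OF sq(1) t] A.delta_square_integrable[OF sq(2) t]]
      by (rule arg_cong[where f = "L2_class A.N"]) (auto simp: A.delta_def \<phi>1_def \<phi>2_def fun_eq_iff algebra_simps)
    have z2: "A.ip (q ?C (A.vdelta \<phi>2 t)) y = 0" if y: "y \<in> A.V" for y
      using q_vanish[of "{a}" \<phi>2 t y] a sq(2) t y by (auto simp: \<phi>2_def h_def indicator_def)
    have z1: "A.ip (q ?D (A.vdelta \<phi>1 t)) y = 0" if y: "y \<in> A.V" for y
    proof (rule q_vanish[OF _ sq(1) t _ y])
      fix x assume "\<phi>1 x \<noteq> 0"
      then have "word_act t x \<in> ?C" by (auto simp: \<phi>1_def h_def indicator_def)
      then show "word_act t x \<notin> ?D" by (auto simp: first_letter_def)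
    qed auto
    have e1: "e ?C (A.vdelta \<phi> t) = A.vdelta \<phi>1 t"
      unfolding A.cp_fun_class(1)[OF ind_Linfty[OF cl(1)] A.delta_square_integrable[OF \<phi> t]]
      by (rule arg_cong[where f = "L2_class A.N"]) (auto simp: A.delta_def \<phi>1_def h_def fun_eq_iff)
    show ?thesis
    proof (rule A.vinner_ext)
      show "q ?C (A.vdelta \<phi> t) \<in> A.V" "e ?C (A.vdelta \<phi> t) \<in> A.V" using v bv by auto
      fix y assume y: "y \<in> A.V"
      have "op_add H (q ?C) (q ?D) (A.vdelta \<phi>1 t) = A.op_one (A.vdelta \<phi>1 t)" using sum by simp
      then have "vadd H (q ?C (A.vdelta \<phi>1 t)) (q ?D (A.vdelta \<phi>1 t)) = A.vdelta \<phi>1 t"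
        by (simp only: A.op_apply(1,4)[OF v(2)])
      then have "A.ip (vadd H (q ?C (A.vdelta \<phi>1 t)) (q ?D (A.vdelta \<phi>1 t))) y = A.ip (A.vdelta \<phi>1 t) y"
        by simp
      then have 1: "A.ip (q ?C (A.vdelta \<phi>1 t)) y = A.ip (A.vdelta \<phi>1 t) y"
        by (simp only: A.vinner_add[OF bv(1)[OF v(2)] bv(2)[OF v(2)] y] z1[OF y] add_0_right)
      have "q ?C (A.vdelta \<phi> t) = vadd H (q ?C (A.vdelta \<phi>1 t)) (q ?C (A.vdelta \<phi>2 t))"
        unfolding dec by (rule A.bounded_ops_lin(1)[OF bd(1) v(2,3)])
      then show "A.ip (q ?C (A.vdelta \<phi> t)) y = A.ip (e ?C (A.vdelta \<phi> t)) y"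
        by (simp only: A.vinner_add[OF bv(1)[OF v(2)] bv(1)[OF v(3)] y] z2[OF y] 1 e1 add_0_right)
    qed
  qed
  show ?thesis
  proof (rule A.op_ext[OF bd(1,3)])
    fix u w assume u: "u \<in> A.V" and w: "w \<in> A.V"
    have "q ?C u = e ?C u"
    proof (rule A.eq_if_vdelta_eq[OF bv(1)[OF u] bv(3)[OF u]])
      fix \<phi> t assume \<phi>: "\<phi> \<in> square_integrable \<mu>" and t: "t \<in> carrier \<Gamma>"
      note v = A.vdelta_vecs[OF \<phi> t]
      \<comment> \<open>Symmetry moves both operators onto the elementary tensors, where they are
        known to agree.\<close>
      have "A.ip (q ?C u) (A.vdelta \<phi> t) = A.ip u (q ?C (A.vdelta \<phi> t))"
        by (rule A.positive_op_hermitian[OF bd(1) q_positive[OF cl(1)] u v])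
      also have "\<dots> = A.ip (e ?C u) (A.vdelta \<phi> t)"
        unfolding on_delta[OF \<phi> t] by (rule A.is_adjointD(2)[OF e_adjoint[OF cl(1)] u v, symmetric])
      finally show "A.ip (q ?C u) (A.vdelta \<phi> t) = A.ip (e ?C u) (A.vdelta \<phi> t)" .
    qed
    then show "A.ip (q ?C u) w = A.ip (e ?C u) w" by simp
  qed
qed

section \<open>Generation of the crossed product\<close>

lemma U_fixed_left: "s \<in> carrier \<Gamma> \<Longrightarrow> U s \<in> C.fixed_left"
proof -
  assume s: "s \<in> carrier \<Gamma>"
  then have i: "winv s \<in> carrier \<Gamma>" by simp
  have "\<theta> (op_mult H (U s) x) = op_mult H (U s) (\<theta> x)" if "x \<in> C.SA" for x
    by (rule C.\<theta>_mult_left[OF U_SA[OF s] A.cp_unitary_adjoint[OF s] that])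
      (simp_all only: unitary_fixed[OF s] unitary_fixed[OF i] A.cp_unitary_mult_inv[OF s] C.unital)
  then show ?thesis using U_SA[OF s] by (simp add: C.fixed_left_def)
qed

lemma first_letter_fixed_left: "a \<in> letters S \<Longrightarrow> e (first_letter a) \<in> C.fixed_left"
proof -
  assume a: "a \<in> letters S"
  note cl = clopen_first_letter[of a]
  have "\<theta> (op_mult H (e (first_letter a)) x) = op_mult H (e (first_letter a)) (\<theta> x)" if "x \<in> C.SA" for x
    by (rule C.\<theta>_mult_left[OF e_SA[OF cl] e_adjoint[OF cl] that])
      (simp_all only: q_first_letter[OF a] e_idem[OF cl])
  then show ?thesis using e_SA[OF cl] by (simp add: C.fixed_left_def)
qed

text \<open>Conjugating a first-letter projection by a unitary gives a product of three elements of
  \<open>fixed_left\<close>.\<close>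

lemma cyl_fixed_left:
  assumes x: "x \<in> X"
  shows "e (cyl x (Suc n)) \<in> C.fixed_left"
proof -
  have w: "map x [0..<n] \<in> carrier \<Gamma>" using map_prefix_W[OF x] by (simp add: carrier_free_group)
  then have i: "winv (map x [0..<n]) \<in> carrier \<Gamma>" by (rule A.inv_closed)
  have "x n \<in> letters S" using x by (simp add: boundary_def)
  then show ?thesis
    unfolding cyl_Suc[OF x] e_act[OF w clopen_first_letter, symmetric]
    using w i by (intro C.fixed_left_mult U_fixed_left first_letter_fixed_left)
qed

lemma step_fixed_left:
  assumes "finite F" "\<And>c. c \<in> F \<Longrightarrow> clopen c \<and> e c \<in> C.fixed_left"
  shows "(\<lambda>x. \<Sum>c\<in>F. b c * indicator c x) \<in> Linfty \<mu> \<and> \<pi> (\<lambda>x. \<Sum>c\<in>F. b c * indicator c x) \<in> C.fixed_left"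
  using assms
proof (induction rule: finite_induct)
  case empty
  \<comment> \<open>The empty sum is the zero function, which is written as a multiple of the
    unit.\<close>
  have "op_scale H 0 (e X) = \<pi> (\<lambda>x. 0 * indicator X x)"
    by (intro A.cp_fun_scale ind_Linfty clopen_X)
  moreover have "A.op_one \<in> C.fixed_left"
    using U_fixed_left[OF A.one_closed] by (simp add: A.cp_unitary_one)
  ultimately have "\<pi> (\<lambda>x. 0) \<in> C.fixed_left"
    using C.fixed_left_scale[of "e X" 0] by (simp add: e_X)
  then show ?case by (auto simp: Linfty_def)
next
  case (insert c F)
  then have IH: "(\<lambda>x. \<Sum>c\<in>F. b c * indicator c x) \<in> Linfty \<mu>" "\<pi> (\<lambda>x. \<Sum>c\<in>F. b c * indicator c x) \<in> C.fixed_left"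
    and c: "clopen c" "e c \<in> C.fixed_left" by auto
  have L: "(\<lambda>x. b c * indicator c x) \<in> Linfty \<mu>" using ind_Linfty[OF c(1)] by (rule A.Linfty_scale)
  have eq: "(\<lambda>x. \<Sum>c\<in>insert c F. b c * indicator c x) = (\<lambda>x. b c * indicator c x + (\<Sum>c\<in>F. b c * indicator c x))"
    by (rule ext) (rule sum.insert[OF insert.hyps(1,2)])
  have "op_add H (op_scale H (b c) (e c)) (\<pi> (\<lambda>x. \<Sum>c\<in>F. b c * indicator c x)) =
    \<pi> (\<lambda>x. \<Sum>c\<in>insert c F. b c * indicator c x)"
    unfolding eq A.cp_fun_scale[OF ind_Linfty[OF c(1)]] by (rule A.cp_fun_add[OF L IH(1)])
  moreover have "op_add H (op_scale H (b c) (e c)) (\<pi> (\<lambda>x. \<Sum>c\<in>F. b c * indicator c x)) \<in> C.fixed_left"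
    using c(2) IH(2) by (intro C.fixed_left_add C.fixed_left_scale)
  ultimately show ?case
    using A.Linfty_add[OF L IH(1)] unfolding eq by simp
qed

text \<open>Step functions on cylinders of a fixed length approximate \<open>f\<close> uniformly,
  and a uniform bound for a function bounds its multiplication operator.\<close>

lemma pi_fixed_left:
  assumes f: "continuous_map (boundary_topology S) euclidean f"
  shows "\<pi> f \<in> C.fixed_left"
proof (rule C.fixed_left_limit[OF pi_SA[OF f]])
  fix \<epsilon> :: real assume \<epsilon>: "\<epsilon> > 0"
  obtain n where n: "\<And>x y. x \<in> X \<Longrightarrow> y \<in> cyl x n \<Longrightarrow> dist (f y) (f x) < \<epsilon>"
    using uniformly_locally_constant[OF f \<epsilon>] by blast
  \<comment> \<open>The length is \<open>Suc n\<close> because \<open>cyl_fixed_left\<close>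
    concerns cylinders of positive length.\<close>
  define F where "F = (\<lambda>x. cyl x (Suc n)) ` X"
  have fin: "finite F"
  proof (rule finite_subset)
    show "F \<subseteq> (\<lambda>w. {y \<in> X. map y [0..<Suc n] = w}) ` {w. set w \<subseteq> letters S \<and> length w = Suc n}"
    proof
      fix c assume "c \<in> F"
      then obtain x where x: "x \<in> X" "c = cyl x (Suc n)" by (auto simp: F_def)
      have "c = {y \<in> X. map y [0..<Suc n] = map x [0..<Suc n]}"
        unfolding x(2) by (auto simp: cyl_def simp del: upt_Suc)
      moreover have "set (map x [0..<Suc n]) \<subseteq> letters S" using x(1) by (auto simp: boundary_def)
      ultimately show "c \<in> (\<lambda>w. {y \<in> X. map y [0..<Suc n] = w}) ` {w. set w \<subseteq> letters S \<and> length w = Suc n}"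
        by (intro image_eqI[of _ _ "map x [0..<Suc n]"]) (simp_all del: upt_Suc)
    qed
    show "finite ((\<lambda>w. {y \<in> X. map y [0..<Suc n] = w}) ` {w. set w \<subseteq> letters S \<and> length w = Suc n})"
      using finite_letters by (intro finite_imageI finite_lists_length_eq)
  qed
  \<comment> \<open>Any point of the cylinder may serve as the sample point, by the choice of
    \<open>n\<close>.\<close>
  define b where "b = (\<lambda>c. f (SOME x. x \<in> c))"
  define g where "g = (\<lambda>x. \<Sum>c\<in>F. b c * indicator c x)"
  have "(\<lambda>x. \<Sum>c\<in>F. b c * indicator c x) \<in> Linfty \<mu> \<and> \<pi> (\<lambda>x. \<Sum>c\<in>F. b c * indicator c x) \<in> C.fixed_left"
    using fin by (rule step_fixed_left) (auto simp: F_def intro: clopen_cyl cyl_fixed_left)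
  then have g: "g \<in> Linfty \<mu>" "\<pi> g \<in> C.fixed_left" by (auto simp: g_def)
  have close: "cmod (f x + -1 * g x) \<le> \<epsilon>" if x: "x \<in> X" for x
  proof -
    have c: "cyl x (Suc n) \<in> F" "x \<in> cyl x (Suc n)" using x by (auto simp: F_def cyl_self)
    \<comment> \<open>Cylinders of equal length are equal or disjoint, so only one summand
      survives.\<close>
    have "g x = (\<Sum>c\<in>{cyl x (Suc n)}. b c * indicator c x)"
      unfolding g_def
    proof (rule sum.mono_neutral_right[OF fin])
      show "\<forall>c\<in>F - {cyl x (Suc n)}. b c * indicator c x = 0"
      proof
        fix c assume "c \<in> F - {cyl x (Suc n)}"
        then obtain y where "c = cyl y (Suc n)" "c \<noteq> cyl x (Suc n)" by (auto simp: F_def)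
        then have "x \<notin> c" using cyl_eq by blast
        then show "b c * indicator c x = 0" by simp
      qed
    qed (use c in auto)
    then have gx: "g x = b (cyl x (Suc n))" using c by simp
    have "(SOME y. y \<in> cyl x (Suc n)) \<in> cyl x (Suc n)" using c(2) by (rule someI[where P = "\<lambda>y. y \<in> cyl x (Suc n)"])
    then have "(SOME y. y \<in> cyl x (Suc n)) \<in> cyl x n" using cyl_antimono[of n "Suc n" x] by auto
    from n[OF x this] show ?thesis
      by (simp add: gx b_def dist_norm norm_minus_commute)
  qed
  let ?h = "\<lambda>x. f x + -1 * g x"
  note fL = continuous_Linfty[OF f] and g1 = A.Linfty_scale[OF g(1), of "-1"]
  have hL: "?h \<in> Linfty \<mu>" using fL g1 by (rule A.Linfty_add)
  obtain C where "0 \<le> C" and hm: "(\<lambda>z. ?h (word_act (snd z) (fst z))) \<in> borel_measurable A.N"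
    and "AE z in A.N. cmod (?h (word_act (snd z) (fst z))) \<le> C"
    using hL by (rule A.Linfty_orbit)
  have adm: "admissible A.N (\<lambda>z. ?h (word_act (snd z) (fst z))) (\<lambda>z. z) \<epsilon>"
  proof (rule admissible_multiplication[OF hm])
    show "AE z in A.N. cmod (?h (word_act (snd z) (fst z))) \<le> \<epsilon>"
      using AE_space
    proof eventually_elim
      case (elim z)
      then have "word_act (snd z) (fst z) \<in> X"
        using A.act_space[of "snd z" "fst z"] by (auto simp: A.space_N space_\<mu>)
      then show ?case by (rule close)
    qed
  qed (use \<epsilon> in simp)
  show "\<exists>V\<in>C.fixed_left. A.op_close \<epsilon> (\<pi> f) V"
    unfolding A.op_close_def
  proof (intro bexI ballI)
    show "\<pi> g \<in> C.fixed_left" by (rule g(2))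
    fix u assume u: "u \<in> A.V"
    have "op_add H (\<pi> f) (op_scale H (-1) (\<pi> g)) = \<pi> ?h"
      unfolding A.cp_fun_scale[OF g(1)] by (rule A.cp_fun_add[OF fL g1])
    then have "op_add H (\<pi> f) (op_scale H (-1) (\<pi> g)) u = \<pi> ?h u" by simp
    then have eq: "vadd H (\<pi> f u) (vscale H (-1) (\<pi> g u)) = \<pi> ?h u"
      by (simp only: A.op_apply(1,2)[OF u])
    obtain k where k: "k \<in> square_integrable A.N" "u = L2_class A.N k" using u by (rule L2_vecsE)
    show "vnorm H (vadd H (\<pi> f u) (vscale H (-1) (\<pi> g u))) \<le> \<epsilon> * vnorm H u"
      unfolding eq unfolding k(2) A.cp_fun_class(1)[OF hL k(1)] by (rule admissible_square_integrable(2)[OF adm k(1)])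
  qed
qed

lemma \<theta>_identity:
  assumes "T \<in> cstar_crossed_product \<Gamma> word_act (boundary_topology S) \<mu>"
  shows "\<theta> T = T"
proof (rule C.fixes_cstar_gen)
  show "A0 \<subseteq> C.fixed_left"
  proof
    fix V assume "V \<in> A0"
    then consider f where "continuous_map (boundary_topology S) euclidean f" "V = \<pi> f"
      | s where "s \<in> carrier \<Gamma>" "V = U s" by (auto simp: A0_def)
    then show "V \<in> C.fixed_left"
      using pi_fixed_left U_fixed_left by cases simp_all
  qed
  show "T \<in> C.CA"
    using assms unfolding A0_def cstar_crossed_product_def A.cp_space_eq .
qed

end

theorem theorem1:
  fixes S :: "'a set" and r :: nat and \<mu> :: "'a bpoint measure"
    and \<theta> :: "(('a bpoint \<times> 'a letter list \<Rightarrow> complex) set \<Rightarrow> ('a bpoint \<times> 'a letter list \<Rightarrow> complex) set) \<Rightarrow>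
      (('a bpoint \<times> 'a letter list \<Rightarrow> complex) set \<Rightarrow> ('a bpoint \<times> 'a letter list \<Rightarrow> complex) set)"
  assumes "finite S" and "card S = r" and "2 \<le> r"
    and "boundary_measure S \<mu>"
    and "quasi_invariant (free_group S) word_act \<mu>"
    and "doubly_ergodic (free_group S) word_act \<mu>"
    and "completely_positive (cp_space (free_group S) \<mu>)
      (cstar_crossed_product (free_group S) word_act (boundary_topology S) \<mu>)
      (vn_crossed_product (free_group S) word_act \<mu>) \<theta>"
    and "\<forall>T\<in>cstar_group (free_group S) \<mu>. \<theta> T = T"
  shows "\<forall>T\<in>cstar_crossed_product (free_group S) word_act (boundary_topology S) \<mu>. \<theta> T = T"
proof -
  interpret crossed_product_fixing S \<mu> \<theta>
    using assms by unfold_locales auto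
  show ?thesis using \<theta>_identity by blast
qed

end
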